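(* Let $n\ge 2$, $p\in[0,1)$ and $k\in\{2,\dots,n-2\}$. There exists $\eta>0$ such that if $K\subset\mathbb{R}^n$ is an origin symmetric convex body of class $C^{2,+}$ whose support function $h_K$ satisfies $$\|1-h_K\|_{C^2(\mathbb{S}^{n-1})}\le\eta,$$ then the condition $$h_K^{1-p}\,\mathrm{d}S_{k-1}(K,\cdot)=\mathrm{d}S_{k-1}(B_n,\cdot)\qquad\text{(equality of measures on }\mathbb{S}^{n-1})$$ implies that $K=B_n$.
   Context: A convex body in $\mathbb{R}^n$ is a nonempty compact convex subset of $\mathbb{R}^n$. $B_n$ is the closed Euclidean unit ball and $\mathbb{S}^{n-1}$ the unit sphere. The support function of a convex body $K$ is $h_K(x)=\sup\{(x,y):y\in K\}$, $x\in\mathbb{S}^{n-1}$, where $(\cdot,\cdot)$ is the standard scalar product. $K$ is origin symmetric if $K=-K$. $K$ is of class $C^{2,+}$ if its boundary is of class $C^2$ and has positive Gauss curvature at every point; equivalently, $h_K\in C^2(\mathbb{S}^{n-1})$ and the matrix $Q[h_K]=((h_K)_{ij}+h_K\delta_{ij})_{i,j=1,\dots,n-1}$ is positive definite at every point of $\mathbb{S}^{n-1}$, where $(h_K)_{ij}$ are second covariant derivatives with respect to a local orthonormal frame on $\mathbb{S}^{n-1}$. $\|\cdot\|_{C^2(\mathbb{S}^{n-1})}$ is the standard $C^2$ norm on the sphere. $S_{k-1}(K,\cdot)$ denotes the area measure of order $k-1$ of $K$, a Borel measure on $\mathbb{S}^{n-1}$. For $K$ of class $C^{2,+}$ it is,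 up to a multiplicative constant depending only on $n$ and $k$, the measure with density $S_{k-1}(Q[h_K](x))$ with respect to the $(n-1)$-dimensional Hausdorff measure on $\mathbb{S}^{n-1}$, where $S_r(A)$ denotes the $r$-th elementary symmetric function of the eigenvalues of the symmetric matrix $A$. Thus the condition is equivalent to $h_K(x)^{1-p}S_{k-1}(Q[h_K](x))=\binom{n-1}{k-1}$ for all $x\in\mathbb{S}^{n-1}$. *)

theory Defs
  imports "HOL-Analysis.Analysis"
begin

definition gradient :: "(real^'n \<Rightarrow> real) \<Rightarrow> real^'n \<Rightarrow> real^'n" where
  "gradient f x = (THE D. GDERIV f x :> D)"

definition hessian :: "(real^'n \<Rightarrow> real) \<Rightarrow> real^'n \<Rightarrow> real^'n^'n" where
  "hessian f x = jacobian (gradient f) (at x)"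

text \<open>Meant for open sets \<open>U\<close> only.\<close>

definition C2_on :: "(real^'n) set \<Rightarrow> (real^'n \<Rightarrow> real) \<Rightarrow> bool" where
  "C2_on U f \<longleftrightarrow>
     (\<forall>x\<in>U. GDERIV f x :> gradient f x) \<and>
     (\<forall>x\<in>U. gradient f differentiable (at x)) \<and>
     continuous_on U (hessian f)"

text \<open>Matrix of the orthogonal projection onto the hyperplane orthogonal to the unit vector \<open>u\<close>,
  which is the tangent space of the sphere at \<open>u\<close>.\<close>

definition tangent_proj :: "real^'n \<Rightarrow> real^'n^'n" where
  "tangent_proj u = mat 1 - (\<chi> i j. u $ i * u $ j)"

text \<open>Since \<open>sgn x = x / norm x\<close>, the function \<open>\<lambda>x. f (sgn x)\<close> is the extension of
  \<open>f\<close> from the sphere that is homogeneous of degree 0. It is of class \<open>C\<^sup>2\<close> off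
  the origin iff \<open>f\<close> is of class \<open>C\<^sup>2\<close> on the sphere.\<close>

definition C2_sphere :: "(real^'n \<Rightarrow> real) \<Rightarrow> bool" where
  "C2_sphere f \<longleftrightarrow> C2_on (- {0}) (\<lambda>x. f (sgn x))"

definition sphere_gradient :: "(real^'n \<Rightarrow> real) \<Rightarrow> real^'n \<Rightarrow> real^'n" where
  "sphere_gradient f u = gradient (\<lambda>x. f (sgn x)) u"

text \<open>For any extension \<open>F\<close> of \<open>f\<close> and tangent vectors \<open>v\<close>, \<open>w\<close> at
  \<open>u\<close>, the second covariant derivative of \<open>f\<close> in the directions \<open>v\<close>, \<open>w\<close> is
  \<open>D\<^sup>2F(u)(v,w) - (v \<bullet> w) DF(u)(u)\<close>, and the last term vanishes for the extension of
  degree 0. The following matrix is this bilinear form, extended by 0 to the normal direction;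
  in an orthonormal basis consisting of a tangent frame and \<open>u\<close> its entries are
  the \<open>f\<^sub>i\<^sub>j\<close>, bordered by zeros.\<close>

definition sphere_hessian :: "(real^'n \<Rightarrow> real) \<Rightarrow> real^'n \<Rightarrow> real^'n^'n" where
  "sphere_hessian f u =
     tangent_proj u ** hessian (\<lambda>x. f (sgn x)) u ** tangent_proj u"

text \<open>The norm of a matrix is the Frobenius norm. Functions that are not of class \<open>C\<^sup>2\<close>
  have infinite norm.\<close>

definition C2_norm_sphere :: "(real^'n \<Rightarrow> real) \<Rightarrow> ennreal" where
  "C2_norm_sphere f =
     (if C2_sphere f
      then (SUP u\<in>sphere 0 1. ennreal \<bar>f u\<bar>)
         + (SUP u\<in>sphere 0 1. ennreal (norm (sphere_gradient f u)))
         + (SUP u\<in>sphere 0 1. ennreal (norm (sphere_hessian f u)))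
      else \<infinity>)"

definition convex_body :: "(real^'n) set \<Rightarrow> bool" where
  "convex_body K \<longleftrightarrow> K \<noteq> {} \<and> compact K \<and> convex K"

definition origin_symmetric :: "(real^'n) set \<Rightarrow> bool" where
  "origin_symmetric K \<longleftrightarrow> K = uminus ` K"

definition support_fun :: "(real^'n) set \<Rightarrow> real^'n \<Rightarrow> real" where
  "support_fun K x = (SUP y\<in>K. x \<bullet> y)"

text \<open>Gauss curvature at \<open>x\<close>, with respect to the outward normal \<open>\<nu>\<close>, of the boundary of
  \<open>{y. F y \<le> 0}\<close> (so it is positive for a ball): the shape operator on the tangent space is
  \<open>P D\<^sup>2F P / norm (gradient F x)\<close>; the summand \<open>mat 1 - P\<close> makes the normal direction an
  eigenvector with eigenvalue 1, so that the determinant on the whole space is that of the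
  shape operator on the tangent space.\<close>

definition gauss_curvature :: "(real^'n \<Rightarrow> real) \<Rightarrow> real^'n \<Rightarrow> real" where
  "gauss_curvature F x =
     (let \<nu> = sgn (gradient F x); P = tangent_proj \<nu> in
      det ((1 / norm (gradient F x)) *\<^sub>R (P ** hessian F x ** P) + (mat 1 - P)))"

definition class_C2plus :: "(real^'n) set \<Rightarrow> bool" where
  "class_C2plus K \<longleftrightarrow>
     (\<forall>x\<in>frontier K. \<exists>U F. open U \<and> x \<in> U \<and> C2_on U F \<and> (\<forall>y\<in>U. gradient F y \<noteq> 0) \<and>
        K \<inter> U = {y\<in>U. F y \<le> 0} \<and> gauss_curvature F x > 0)"

definition local_parallel_set :: "(real^'n) set \<Rightarrow> real \<Rightarrow> (real^'n) set \<Rightarrow> (real^'n) set" where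
  "local_parallel_set K \<rho> \<omega> =
     {x. 0 < infdist x K \<and> infdist x K \<le> \<rho> \<and> sgn (x - closest_point K x) \<in> \<omega>}"

text \<open>The area measures of orders \<open>0, \<dots>, n-1\<close> of a convex body are the finite Borel measures on
  the unit sphere determined by the local Steiner formula (in the normalization in which
  the one of order \<open>n-1\<close> is the surface area measure and the one of order 0 is the spherical
  Lebesgue measure).\<close>

definition steiner_family :: "(real^'n) set \<Rightarrow> (nat \<Rightarrow> (real^'n) measure) \<Rightarrow> bool" where
  "steiner_family K S \<longleftrightarrow>
     (\<forall>j<CARD('n). finite_measure (S j) \<and> sets (S j) = sets (restrict_space borel (sphere 0 1))) \<and>
     (\<forall>\<rho>>0. \<forall>\<omega>\<in>sets (restrict_space borel (sphere 0 1)).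
        measure lborel (local_parallel_set K \<rho> \<omega>) =
          (\<Sum>j<CARD('n). real (CARD('n) choose j) * \<rho> ^ (CARD('n) - j) * measure (S j) \<omega>)
            / real CARD('n))"

text \<open>Only meaningful for \<open>j < n\<close>.\<close>

definition area_measure :: "nat \<Rightarrow> (real^'n) set \<Rightarrow> (real^'n) measure" where
  "area_measure j K = (THE \<mu>. \<exists>S. steiner_family K S \<and> \<mu> = S j)"

end

theory Submission
  imports Defs
begin

text \<open>Write \<open>h = 1 - \<Phi>\<close> for the support function on the sphere, \<open>\<Phi>\<close> being extended to be homogeneous of
  degree 0. The map \<open>x \<mapsto> \<nabla>h(x) + x\<close> parametrizes the complement of \<open>K\<close>; its Jacobian gives the
  local Steiner formula, hence the area measures have densities \<open>e\<^sub>j(D\<^sup>2h)\<close> and the hypothesis becomes the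
  pointwise equation \<open>h powr (1 - p) * e\<^sub>k\<^sub>-\<^sub>1(D\<^sup>2h) = const\<close>. Its linearization at the ball is
  \<open>\<Delta>\<Phi> + \<lambda>\<Phi>\<close> with \<open>n - 1 \<le> \<lambda> \<le> 2(n - 1)\<close>, which stays below \<open>2n\<close>, the first nonzero
  eigenvalue of \<open>- \<Delta>\<close> on even functions, while the remainder is quadratic in the \<open>C\<^sup>2\<close> norm; so \<open>\<Phi> = 0\<close>.

  The spectral gap is obtained, together with control of the full Hessian, by working in Euclidean space
  with the Gaussian weight and the function \<open>\<bar>x\<bar>\<^sup>2 \<Phi>(x)\<close>: its gradient is odd and homogeneous of
  degree 1, so the Gaussian Poincare inequality for odd functions and Gaussian integration by parts
  (a Bochner identity) apply.\<close>

section \<open>Elementary symmetric functions of a matrix\<close>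

text \<open>The error left by the linearization is quadratic in the full second order jet of \<Phi>,
  whereas the operator \<Delta> + \<lambda> bounds only the Laplacian. An L2 bound of the whole
  Hessian by the Laplacian is therefore required, and the factor |x|^2 provides it: the Hessian
  \<open>M2\<close> of |x|^2 \<Phi> is homogeneous of degree 0, hence bounded, and contains \<Phi>,
  its gradient and its spherical Hessian together. The error becomes at most \<epsilon> |M2|
  pointwise, with \<epsilon> as small as the C2 norm permits. As \<Phi> is only of class C2, the
  third derivatives of the classical Bochner argument do not exist; difference quotients, which
  commute by translation invariance of Lebesgue measure, replace them. The number 2n is the
  eigenvalue l(l + n - 2) at l = 2, and \<lambda> = (n - 1)(1 + (1 - p)/(k - 1)) is at most 2n - 2,
  so the gap is at least 2 whatever p and k are. Area measures are given by a definite description,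
  so the Steiner formula has to be complemented by uniqueness, and the same description must be
  evaluated for the ball.\<close>

definition esym :: "nat \<Rightarrow> real^'n^'n \<Rightarrow> real" where
  "esym j A = (\<Sum>p | p permutes (UNIV :: 'n set). of_int (sign p) *
     (\<Sum>S | card S = j. (\<Prod>i\<in>S. A $ i $ p i) * (\<Prod>i\<in>-S. mat 1 $ i $ p i)))"

text \<open>Each row of the Leibniz product offers \<open>t * A\<close> or the identity, and
  \<open>S\<close> is the set of rows that take \<open>A\<close>. This identifies
  \<open>esym j A\<close> as a coefficient of the characteristic polynomial, hence as the elementary
  symmetric function of the eigenvalues, with no diagonalization.\<close>

lemma det_one_plus_scaleR:
  fixes A :: "real^'n^'n"
  shows "det (mat 1 + t *\<^sub>R A) = (\<Sum>j\<le>CARD('n). esym j A * t ^ j)"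
proof -
  have "(\<Prod>i\<in>UNIV. (mat 1 + t *\<^sub>R A) $ i $ p i) =
      (\<Sum>j\<le>CARD('n). t ^ j * (\<Sum>S | card S = j. (\<Prod>i\<in>S. A $ i $ p i) * (\<Prod>i\<in>-S. mat 1 $ i $ p i)))"
    for p :: "'n \<Rightarrow> 'n"
  proof -
    have "(\<Prod>i\<in>UNIV. (mat 1 + t *\<^sub>R A) $ i $ p i) = (\<Prod>i\<in>UNIV. t * A $ i $ p i + mat 1 $ i $ p i)"
      by (simp add: add.commute)
    also have "\<dots> = (\<Sum>S\<in>Pow UNIV. (\<Prod>i\<in>S. t * A $ i $ p i) * (\<Prod>i\<in>UNIV - S. mat 1 $ i $ p i))"
      by (rule prod_add) simp
    also have "\<dots> = (\<Sum>S\<in>UNIV. t ^ card S * ((\<Prod>i\<in>S. A $ i $ p i) * (\<Prod>i\<in>-S. mat 1 $ i $ p i)))"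
      by (simp add: prod.distrib Compl_eq_Diff_UNIV mult.assoc)
    also have "\<dots> = (\<Sum>j\<le>CARD('n). \<Sum>S | S \<in> UNIV \<and> card S = j.
        t ^ card S * ((\<Prod>i\<in>S. A $ i $ p i) * (\<Prod>i\<in>-S. mat 1 $ i $ p i)))"
      by (rule sum.group[symmetric]) (auto intro: card_mono)
    finally show ?thesis by (simp add: sum_distrib_left)
  qed
  then show ?thesis
    unfolding det_def esym_def
    by (subst sum_distrib_right, subst sum.swap) (simp add: sum_distrib_left mult_ac)
qed

lemma esym_0: "esym 0 A = 1"
proof -
  have "esym 0 A = det (mat 1 + 0 *\<^sub>R A)"
    unfolding det_one_plus_scaleR by (simp add: power_0_left sum.delta if_distrib cong: if_cong)
  then show ?thesis by simp
qed

lemma esym_card: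
  fixes A :: "real^'n^'n"
  shows "esym CARD('n) A = det A"
proof -
  have "{S :: 'n set. card S = CARD('n)} = {UNIV}"
    using card_subset_eq[OF finite_class.finite_UNIV subset_UNIV] by auto
  then show ?thesis by (simp add: esym_def det_def)
qed

text \<open>For a singleton \<open>S\<close> the identity entries force \<open>p\<close> to fix
  every other index, and a permutation fixing all indices but one is the identity.\<close>

lemma esym_1:
  fixes A :: "real^'n^'n"
  shows "esym 1 A = trace A"
proof -
  have S: "{S :: 'n set. card S = 1} = (\<lambda>i. {i}) ` UNIV"
    by (auto simp: card_1_singleton_iff)
  have inj: "inj (\<lambda>i :: 'n. {i})" by (auto simp: inj_def)
  have "(\<Sum>S | card S = 1. (\<Prod>i\<in>S. A $ i $ p i) * (\<Prod>i\<in>-S. mat 1 $ i $ p i)) =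
      (if p = id then trace A else 0)" if p: "p permutes UNIV" for p :: "'n \<Rightarrow> 'n"
  proof -
    have "A $ i $ p i * (\<Prod>j\<in>-{i}. mat 1 $ j $ p j) = (if p = id then A $ i $ i else 0)" for i
    proof (cases "p = id")
      case True then show ?thesis by (simp add: mat_def)
    next
      case False
      have "\<exists>j. j \<noteq> i \<and> p j \<noteq> j"
      proof (rule ccontr)
        assume "\<not> ?thesis"
        then have fix_others: "\<And>j. j \<noteq> i \<Longrightarrow> p j = j" by auto
        then have "p i = i" using permutes_inj[OF p] by (metis injD)
        with fix_others False show False by (metis eq_id_iff)
      qed
      then have "(\<Prod>j\<in>-{i}. (mat 1 :: real^'n^'n) $ j $ p j) = 0"
        by (intro prod_zero) (force simp: mat_def)+
      with False show ?thesis by simp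
    qed
    then show ?thesis
      unfolding S by (simp add: sum.reindex[OF inj] trace_def)
  qed
  then have "esym 1 A = (\<Sum>p | p permutes (UNIV :: 'n set). if p = id then trace A else 0)"
    unfolding esym_def by (intro sum.cong) auto
  also have "\<dots> = trace A"
    by (simp add: sum.delta finite_permutations permutes_id)
  finally show ?thesis .
qed

lemma component_le_norm_matrix: "\<bar>A $ i $ j\<bar> \<le> norm (A :: real^'n^'m)"
  by (metis Finite_Cartesian_Product.norm_nth_le component_le_norm_cart order_trans)

text \<open>\<open>esym j\<close> is a sum of products of j entries of A, the identity entries being
  at most 1. The exponent matters: in the linearization every term with j at least 2 is
  quadratically small.\<close>

lemma esym_bound:
  "\<exists>C\<ge>0. \<forall>A :: real^'n^'n. \<bar>esym j A\<bar> \<le> C * norm A ^ j"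
proof -
  define C where "C = (\<Sum>p | p permutes (UNIV :: 'n set). real (card {S :: 'n set. card S = j}))"
  have "\<bar>esym j A\<bar> \<le> C * norm A ^ j" for A :: "real^'n^'n"
  proof -
    have "\<bar>(\<Prod>i\<in>S. A $ i $ p i) * (\<Prod>i\<in>-S. mat 1 $ i $ p i)\<bar> \<le> norm A ^ j"
      if "card S = j" for S and p :: "'n \<Rightarrow> 'n"
    proof -
      have "\<bar>\<Prod>i\<in>S. A $ i $ p i\<bar> \<le> (\<Prod>i\<in>S. norm A)"
        unfolding abs_prod by (intro prod_mono) (auto simp: component_le_norm_matrix)
      moreover have "\<bar>\<Prod>i\<in>-S. (mat 1 :: real^'n^'n) $ i $ p i\<bar> \<le> (\<Prod>i\<in>-S. 1)"
        unfolding abs_prod by (intro prod_mono) (auto simp: mat_def)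
      ultimately show ?thesis
        using that by (auto simp: abs_mult intro: order_trans[OF mult_mono])
    qed
    then have "\<bar>\<Sum>S | card S = j. (\<Prod>i\<in>S. A $ i $ p i) * (\<Prod>i\<in>-S. mat 1 $ i $ p i)\<bar>
        \<le> real (card {S :: 'n set. card S = j}) * norm A ^ j" for p :: "'n \<Rightarrow> 'n"
      by (intro order_trans[OF sum_abs] sum_bounded_above) auto
    then have "\<bar>of_int (sign p) * (\<Sum>S | card S = j. (\<Prod>i\<in>S. A $ i $ p i) * (\<Prod>i\<in>-S. mat 1 $ i $ p i))\<bar>
        \<le> real (card {S :: 'n set. card S = j}) * norm A ^ j" for p :: "'n \<Rightarrow> 'n"
      by (auto simp: sign_def abs_mult)
    then show ?thesis
      unfolding esym_def C_def sum_distrib_right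
      by (intro order_trans[OF sum_abs] sum_mono) auto
  qed
  moreover have "C \<ge> 0" by (simp add: C_def)
  ultimately show ?thesis by blast
qed

lemma continuous_esym [continuous_intros]:
  assumes "continuous_on X f"
  shows "continuous_on X (\<lambda>x. esym j (f x))"
  unfolding esym_def by (intro continuous_intros assms)

text \<open>Compares coefficients of polynomials known to agree only at positive arguments:
  \<open>t\<close> in a determinant expansion, an inverse radius in the Steiner formula.\<close>

lemma polyfun_zero_on_pos:
  fixes c :: "nat \<Rightarrow> real"
  assumes "\<And>t. t > 0 \<Longrightarrow> (\<Sum>i\<le>N. c i * t ^ i) = 0" and "i \<le> N"
  shows "c i = 0"
proof (rule ccontr)
  assume "c i \<noteq> 0"
  then have "finite {t. (\<Sum>i\<le>N. c i * t ^ i) = 0}"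
    using polyfun_roots_finite[of c i N] assms(2) by blast
  then have "finite {0 :: real<..}"
    by (rule finite_subset[rotated]) (use assms(1) in auto)
  then show False by (simp add: infinite_Ioi)
qed

section \<open>Perturbations of the projection onto a tangent hyperplane\<close>

lemma matrix_add_rdistrib: "(A + B) ** C = A ** C + B ** (C :: real^'k^'m)"
  for A B :: "real^'m^'n"
  by (simp add: vec_eq_iff matrix_matrix_mult_def sum.distrib distrib_right)

lemma tangent_proj_nth: "tangent_proj u $ i $ j = (if i = j then 1 else 0) - u $ i * u $ j"
  by (simp add: tangent_proj_def mat_def)

text \<open>The hypothesis puts the columns of B into the hyperplane orthogonal to u, where the
  projection is the identity.\<close>

lemma tangent_proj_mult_left:
  assumes "u v* B = 0"
  shows "tangent_proj u ** B = B"
proof -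
  have "(\<Sum>k\<in>UNIV. u $ k * B $ k $ j) = 0" for j
    using arg_cong[OF assms, of "\<lambda>v. v $ j"] by (simp add: vector_matrix_mult_def mult.commute)
  then have z: "(\<Sum>k\<in>UNIV. u $ i * (u $ k * B $ k $ j)) = 0" for i j
    by (simp flip: sum_distrib_left)
  show ?thesis
    by (simp add: vec_eq_iff matrix_matrix_mult_def tangent_proj_nth left_diff_distrib sum_subtractf
        if_distrib[of "\<lambda>a. a * _"] mult.assoc z cong: if_cong)
qed

text \<open>The projection has eigenvalue 0 on u and 1 on the orthogonal complement. An orthogonal
  \<open>Q\<close> sending a basis vector to u reduces the matrix to the diagonal \<open>D\<close>,
  with one entry 1 and all others 1 + t.\<close>

lemma det_one_plus_tangent_proj:
  fixes u :: "real^'n"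
  assumes u: "norm u = 1"
  shows "det (mat 1 + t *\<^sub>R tangent_proj u) = (1 + t) ^ (CARD('n) - 1)"
proof -
  obtain k :: 'n where True by simp
  obtain Q where Q: "orthogonal_matrix Q" "Q *v axis k 1 = u"
    using orthogonal_matrix_exists_basis[OF u] by metis
  have u_nth: "u $ i = Q $ i $ k" for i
    using Q(2) by (auto simp: matrix_vector_mult_def axis_def if_distrib cong: if_cong)
  have QQ: "Q ** transpose Q = mat 1" using Q(1) by (simp add: orthogonal_matrix_def)
  define D :: "real^'n^'n" where "D = (\<chi> i j. if i = j then (if i = k then 1 else 1 + t) else 0)"
  have "(Q ** D ** transpose Q) $ i $ j = (mat 1 + t *\<^sub>R tangent_proj u) $ i $ j" for i j
  proof -
    have "(\<Sum>l\<in>UNIV. Q $ i $ l * Q $ j $ l) = (if i = j then 1 else 0)"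
      using arg_cong[OF QQ, of "\<lambda>M. M $ i $ j"]
      by (simp add: matrix_matrix_mult_def transpose_def mat_def)
    moreover have "(Q ** D ** transpose Q) $ i $ j =
        (\<Sum>l\<in>UNIV. (1 + t) * (Q $ i $ l * Q $ j $ l) - (if l = k then t * (Q $ i $ l * Q $ j $ l) else 0))"
      by (auto simp: matrix_matrix_mult_def transpose_def D_def if_distrib algebra_simps
          intro!: sum.cong cong: if_cong)
    ultimately show ?thesis
      by (simp add: sum_subtractf sum.delta flip: sum_distrib_left)
         (simp add: tangent_proj_nth u_nth mat_def algebra_simps)
  qed
  then have eq: "mat 1 + t *\<^sub>R tangent_proj u = Q ** D ** transpose Q"
    by (simp add: vec_eq_iff)
  have "det Q * det Q = 1" using arg_cong[OF QQ, of det] by (simp add: det_mul)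
  then have "det (Q ** D ** transpose Q) = det D"
    by (simp add: det_mul)
  also have "det D = (\<Prod>i\<in>UNIV. if i = k then 1 else 1 + t)"
    by (subst det_diagonal) (auto simp: D_def)
  also have "\<dots> = (\<Prod>i\<in>UNIV - {k}. 1 + t)"
    by (subst prod.remove[of _ k]) (auto intro: prod.cong)
  finally show ?thesis by (simp add: eq)
qed

lemma det_eq_0_if_left_kernel:
  fixes B :: "real^'n^'n"
  assumes "u v* B = 0" "u \<noteq> 0"
  shows "det B = 0"
proof (rule ccontr)
  assume "det B \<noteq> 0"
  then obtain C where "B ** C = mat 1" using invertible_det_nz invertible_def by metis
  then have "u = u v* (B ** C)" by simp
  also have "\<dots> = (u v* B) v* C" by (simp add: vector_matrix_mul_assoc)
  finally show False using assms by simp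
qed

text \<open>With P the projection, P B = B, so det (1 + t (P + B)) factors as (1 + t)^(n - 1) det (1
  + s B) with s = t / (1 + t). Both B and P + B annihilate u from the left, so the terms of order n
  vanish; the power (1 + t)^(n - 1) then clears all denominators and coefficients of t can be
  compared.\<close>

lemma esym_tangent_proj_add:
  fixes B :: "real^'n^'n"
  assumes u: "norm u = 1" and B: "u v* B = 0" and m: "m < CARD('n)"
  shows "esym m (tangent_proj u + B) =
    (\<Sum>i\<le>m. real ((CARD('n) - 1 - i) choose (m - i)) * esym i B)"
proof -
  define N where "N = CARD('n) - 1"
  have N: "CARD('n) = Suc N" by (simp add: N_def)
  have "u \<noteq> 0" using u by auto
  have "det B = 0" by (rule det_eq_0_if_left_kernel[OF B \<open>u \<noteq> 0\<close>])
  have "det (tangent_proj u + B) = 0"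
  proof (rule det_eq_0_if_left_kernel[OF _ \<open>u \<noteq> 0\<close>])
    have "(\<Sum>k\<in>UNIV. u $ k * u $ k) = 1"
      using u by (simp add: norm_eq_1 inner_vec_def)
    moreover have "u $ k * tangent_proj u $ k $ j = (if k = j then u $ k else 0) - u $ j * (u $ k * u $ k)"
      for k j by (simp add: tangent_proj_nth algebra_simps)
    ultimately have "u v* tangent_proj u = 0"
      by (simp add: vec_eq_iff vector_matrix_mult_def sum_subtractf flip: sum_distrib_left)
    then show "u v* (tangent_proj u + B) = 0"
      using B by (simp add: vector_matrix_mult_add_rdistrib)
  qed
  define c where "c j = (\<Sum>i\<le>j. real ((N - i) choose (j - i)) * esym i B)" for j
  have "(\<Sum>j\<le>N. (esym j (tangent_proj u + B) - c j) * t ^ j) = 0" if "t > 0" for t :: real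
  proof -
    define s where "s = t / (1 + t)"
    have st: "s * (1 + t) = t" using that by (simp add: s_def)
    have "mat 1 + t *\<^sub>R (tangent_proj u + B) =
        (mat 1 + t *\<^sub>R tangent_proj u) ** (mat 1 + s *\<^sub>R B)"
    proof -
      have "(mat 1 + t *\<^sub>R tangent_proj u) ** (mat 1 + s *\<^sub>R B)
          = mat 1 + t *\<^sub>R tangent_proj u + s *\<^sub>R (B + t *\<^sub>R B)"
        by (simp add: matrix_add_ldistrib matrix_add_rdistrib matrix_scalar_ac
            tangent_proj_mult_left[OF B] scaleR_add_right flip: scalar_matrix_assoc)
      also have "s *\<^sub>R (B + t *\<^sub>R B) = t *\<^sub>R B"
        using st by (metis scaleR_one scaleR_left_distrib scaleR_scaleR)
      finally show ?thesis by (simp add: scaleR_add_right)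
    qed
    then have "det (mat 1 + t *\<^sub>R (tangent_proj u + B)) =
        (1 + t) ^ N * det (mat 1 + s *\<^sub>R B)"
      by (simp add: det_mul det_one_plus_tangent_proj[OF u] N_def)
    then have "(\<Sum>j\<le>N. esym j (tangent_proj u + B) * t ^ j) = (1 + t) ^ N * (\<Sum>i\<le>N. esym i B * s ^ i)"
      using \<open>det B = 0\<close> \<open>det (tangent_proj u + B) = 0\<close> esym_card[of B] esym_card[of "tangent_proj u + B"]
      unfolding det_one_plus_scaleR by (simp add: N)
    also have "\<dots> = (\<Sum>i\<le>N. esym i B * t ^ i * (1 + t) ^ (N - i))"
      unfolding sum_distrib_left
    proof (rule sum.cong)
      fix i assume "i \<in> {..N}"
      then have "(1 + t) ^ N = (1 + t) ^ i * (1 + t) ^ (N - i)" by (simp flip: power_add)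
      moreover have "t ^ i = s ^ i * (1 + t) ^ i" by (simp add: st flip: power_mult_distrib)
      ultimately show "(1 + t) ^ N * (esym i B * s ^ i) = esym i B * t ^ i * (1 + t) ^ (N - i)"
        by (simp only: mult_ac)
    qed simp
    also have "\<dots> = (\<Sum>i\<le>N. \<Sum>j\<in>{i..N}. real ((N - i) choose (j - i)) * esym i B * t ^ j)"
    proof (rule sum.cong)
      fix i assume "i \<in> {..N}"
      then have i: "i \<le> N" by simp
      have "(1 + t) ^ (N - i) = (\<Sum>l\<le>N - i. real ((N - i) choose l) * t ^ l)"
        using binomial_ring[of t 1 "N - i"] by (simp add: add.commute)
      then have "esym i B * t ^ i * (1 + t) ^ (N - i) =
          (\<Sum>l\<le>N - i. real ((N - i) choose l) * esym i B * t ^ (l + i))"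
        by (simp add: sum_distrib_left power_add mult_ac)
      also have "\<dots> = (\<Sum>j\<in>{i..N}. real ((N - i) choose (j - i)) * esym i B * t ^ j)"
        using i by (intro sum.reindex_bij_witness[of _ "\<lambda>j. j - i" "\<lambda>l. l + i"]) auto
      finally show "esym i B * t ^ i * (1 + t) ^ (N - i) = \<dots>" .
    qed simp
    also have "\<dots> = (\<Sum>j\<le>N. \<Sum>i\<le>j. real ((N - i) choose (j - i)) * esym i B * t ^ j)"
    proof -
      have "(\<Sum>i\<le>N. \<Sum>j\<in>{i..N}. f i j) = (\<Sum>j\<le>N. \<Sum>i\<le>j. f i j)" for f :: "nat \<Rightarrow> nat \<Rightarrow> real"
        by (simp add: sum.Sigma) (rule sum.reindex_bij_witness[of _ "\<lambda>(j, i). (i, j)" "\<lambda>(i, j). (j, i)"]; force)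
      then show ?thesis .
    qed
    also have "\<dots> = (\<Sum>j\<le>N. c j * t ^ j)"
      by (simp add: c_def sum_distrib_right)
    finally show ?thesis by (simp add: left_diff_distrib sum_subtractf)
  qed
  from polyfun_zero_on_pos[OF this, of m] m show ?thesis
    by (simp add: N c_def)
qed

section \<open>Gaussian integrals\<close>

text \<open>The normalizing factor is omitted: the relations between integrals below are homogeneous
  in the weight.\<close>

definition gauss :: "'a::euclidean_space \<Rightarrow> real" where
  "gauss x = exp (- (x \<bullet> x) / 2)"

lemma gauss_pos: "gauss x > 0" and gauss_nonneg: "gauss x \<ge> 0"
  by (simp_all add: gauss_def)

lemma gauss_measurable [measurable]: "gauss \<in> borel_measurable borel"
  unfolding gauss_def[abs_def] by measurable

text \<open>Apply y \<le> exp y to y = (1 + r) / (2 m) and raise to the power m.\<close>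

lemma one_plus_power_le_exp: "\<exists>C\<ge>0. \<forall>r\<ge>0. (1 + r) ^ m \<le> C * exp (r / 2 :: real)"
proof (cases "m = 0")
  case True then show ?thesis by (intro exI[of _ 1]) auto
next
  case False
  define C where "C = (2 * real m) ^ m * exp (1 / 2)"
  have "(1 + r) ^ m \<le> C * exp (r / 2)" if "r \<ge> 0" for r
  proof -
    have "(1 + r) / 2 / m \<le> exp ((1 + r) / 2 / m)"
      using exp_ge_add_one_self[of "(1 + r) / 2 / m"] by linarith
    then have "1 + r \<le> 2 * m * exp ((1 + r) / 2 / m)"
      using False by (simp add: field_simps)
    then have "(1 + r) ^ m \<le> (2 * m * exp ((1 + r) / 2 / m)) ^ m"
      using that by (intro power_mono) auto
    also have "\<dots> = (2 * real m) ^ m * exp ((1 + r) / 2)"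
      using False by (simp add: power_mult_distrib flip: exp_of_nat_mult)
    also have "exp ((1 + r) / 2) = exp (1 / 2) * exp (r / 2)"
      by (simp add: add_divide_distrib exp_add)
    finally show ?thesis by (simp add: C_def)
  qed
  then show ?thesis by (intro exI[of _ C]) (auto simp: C_def)
qed

lemma suminf_upper_single: "f k \<le> (\<Sum>i. f i)" for f :: "nat \<Rightarrow> ennreal"
proof -
  have "sum f {k} \<le> (\<Sum>i. f i)" by (rule sum_le_suminf) auto
  then show ?thesis by simp
qed

text \<open>On the shell where \<open>norm x\<close> lies between k and k + 1 the integrand is at
  most exp (-k), while the ball of radius k + 1 has polynomial volume; half of the exponent absorbs
  it and leaves a geometric series of ratio exp (-1/2). This function is the common majorant for the
  difference quotients below.\<close>

lemma integrable_exp_neg_norm: "integrable lborel (\<lambda>x :: 'a::euclidean_space. exp (- norm x))"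
proof (rule integrableI_bounded)
  obtain C where C: "C \<ge> 0" "\<And>r. r \<ge> 0 \<Longrightarrow> (1 + r) ^ DIM('a) \<le> C * exp (r / 2 :: real)"
    using one_plus_power_le_exp by blast
  let ?V = "unit_ball_vol (real DIM('a))"
  have V: "?V \<ge> 0" by simp
  have "(\<integral>\<^sup>+ (x :: 'a). ennreal (norm (exp (- norm x))) \<partial>lborel)
      \<le> (\<integral>\<^sup>+ (x :: 'a). (\<Sum>k. ennreal (exp (- real k)) * indicator (cball 0 (real k + 1)) x) \<partial>lborel)"
  proof (rule nn_integral_mono)
    fix x :: 'a
    define k where "k = nat \<lfloor>norm x\<rfloor>"
    have k: "real k \<le> norm x" "norm x \<le> real k + 1"
      unfolding k_def by (auto simp: of_nat_floor)
    have "ennreal (norm (exp (- norm x))) \<le> ennreal (exp (- real k)) * indicator (cball 0 (real k + 1)) x"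
      using k by (auto simp: indicator_def intro!: ennreal_leI)
    also have "\<dots> \<le> (\<Sum>k. ennreal (exp (- real k)) * indicator (cball 0 (real k + 1)) x)"
      by (rule suminf_upper_single)
    finally show "ennreal (norm (exp (- norm x))) \<le> \<dots>" .
  qed
  also have "\<dots> = (\<Sum>k. ennreal (exp (- real k)) * emeasure lborel (cball (0 :: 'a) (real k + 1)))"
    by (subst nn_integral_suminf)
       (auto simp: nn_integral_cmult_indicator
         intro!: borel_measurable_times_ennreal borel_measurable_indicator)
  also have "\<dots> = (\<Sum>k. ennreal (exp (- real k) * (?V * (real k + 1) ^ DIM('a))))"
    by (simp add: emeasure_cball ennreal_mult'')
  also have "\<dots> \<le> (\<Sum>k. ennreal (C * ?V * exp (- 1 / 2) ^ k))"
  proof (intro suminf_le allI ennreal_leI)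
    fix k
    have "exp (- real k) * (?V * (real k + 1) ^ DIM('a)) \<le> exp (- real k) * (?V * (C * exp (real k / 2)))"
      using C(2)[of "real k"] V by (intro mult_left_mono) (auto simp: add.commute)
    also have "\<dots> = C * ?V * (exp (- real k) * exp (real k / 2))" by simp
    also have "exp (- real k) * exp (real k / 2) = exp (- 1 / 2) ^ k"
      by (simp flip: exp_add exp_of_nat_mult)
    finally show "exp (- real k) * (?V * (real k + 1) ^ DIM('a)) \<le> C * ?V * exp (- 1 / 2) ^ k" .
  qed auto
  also have "\<dots> < \<infinity>"
  proof -
    have "summable (\<lambda>k. C * ?V * exp (- 1 / 2 :: real) ^ k)"
      by (intro summable_mult summable_geometric) simp
    then show ?thesis
      using C(1) V by (subst suminf_ennreal2) auto
  qed
  finally show "(\<integral>\<^sup>+ (x :: 'a). ennreal (norm (exp (- norm x))) \<partial>lborel) < \<infinity>" .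
qed simp

text \<open>One majorant for all shifts y of length at most 1, as dominated convergence of
  difference quotients demands.\<close>

lemma gauss_dom:
  "\<exists>C\<ge>0. \<forall>x y :: 'a::euclidean_space. norm y \<le> 1 \<longrightarrow>
     (1 + norm x) ^ m * gauss (x + y) \<le> C * exp (- norm x)"
proof -
  obtain C where C: "C \<ge> 0" "\<And>r. r \<ge> 0 \<Longrightarrow> (1 + r) ^ m \<le> C * exp (r / 2 :: real)"
    using one_plus_power_le_exp by blast
  have "(1 + norm x) ^ m * gauss (x + y) \<le> C * exp 3 * exp (- norm x)" if "norm y \<le> 1" for x y :: 'a
  proof -
    have "norm x \<le> norm (x + y) + 1"
      using norm_triangle_ineq4[of "x + y" y] that by simp
    then have "norm x ^ 2 \<le> (norm (x + y) + 1) ^ 2" by (intro power_mono) auto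
    also have "\<dots> \<le> 2 * norm (x + y) ^ 2 + 2"
      using sum_squares_ge_zero[of "norm (x + y) - 1" 0] by (simp add: power2_eq_square algebra_simps)
    finally have "- (norm (x + y))\<^sup>2 / 2 \<le> 1 / 2 - norm x ^ 2 / 4" by linarith
    \<comment> \<open>From (|x| - 3)^2 \<ge> 0. Together with the 1/2 above, the exponent is at most
      11/4 - |x|, rounded up to 3 - |x|.\<close>
    moreover have "norm x / 2 - norm x ^ 2 / 4 + norm x \<le> 9 / 4"
      using sum_squares_ge_zero[of "norm x - 3" 0] by (simp add: power2_eq_square algebra_simps)
    ultimately have *: "norm x / 2 + - (norm (x + y))\<^sup>2 / 2 \<le> 3 + - norm x" by linarith
    have "(1 + norm x) ^ m * gauss (x + y) \<le> C * exp (norm x / 2) * exp (- (norm (x + y))\<^sup>2 / 2)"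
      unfolding gauss_def by (intro mult_mono C) (auto simp: dot_square_norm C)
    also have "\<dots> \<le> C * exp (3 + - norm x)"
      using * C by (simp add: mult.assoc flip: exp_add) (intro mult_left_mono; simp)
    finally show ?thesis by (simp only: exp_add mult.assoc)
  qed
  then show ?thesis using C by (intro exI[of _ "C * exp 3"]) auto
qed

text \<open>Mean value theorem on the segment from x to x + y. The derivative of the weight costs
  one more factor 1 + |x|, which is why \<open>gauss_dom\<close> is used with
  \<open>Suc m\<close>.\<close>

lemma gauss_diff_dom:
  "\<exists>C\<ge>0. \<forall>x y :: 'a::euclidean_space. norm y \<le> 1 \<longrightarrow>
     (1 + norm x) ^ m * \<bar>gauss (x + y) - gauss x\<bar> \<le> C * norm y * exp (- norm x)"
proof -
  obtain C where C: "C \<ge> 0" "\<And>x y :: 'a. norm y \<le> 1 \<Longrightarrow>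
     (1 + norm x) ^ Suc m * gauss (x + y) \<le> C * exp (- norm x)"
    using gauss_dom[of "Suc m"] by metis
  have "(1 + norm x) ^ m * \<bar>gauss (x + y) - gauss x\<bar> \<le> C * norm y * exp (- norm x)"
    if y: "norm y \<le> 1" for x y :: 'a
  proof -
    have "((\<lambda>t. gauss (x + t *\<^sub>R y)) has_real_derivative
        - ((x + t *\<^sub>R y) \<bullet> y) * gauss (x + t *\<^sub>R y)) (at t)" for t
    proof -
      have g: "gauss (x + t *\<^sub>R y) = exp (- (x \<bullet> x + 2 * t * (x \<bullet> y) + t\<^sup>2 * (y \<bullet> y)) / 2)" for t
        by (simp add: gauss_def inner_add inner_commute power2_eq_square algebra_simps)
      have "((\<lambda>t. exp (- (x \<bullet> x + 2 * t * (x \<bullet> y) + t\<^sup>2 * (y \<bullet> y)) / 2)) has_real_derivative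
          exp (- (x \<bullet> x + 2 * t * (x \<bullet> y) + t\<^sup>2 * (y \<bullet> y)) / 2) * - (x \<bullet> y + t * (y \<bullet> y))) (at t)"
        by (auto intro!: derivative_eq_intros simp: field_simps)
      then show ?thesis by (simp add: g inner_add mult.commute)
    qed
    then obtain z where z: "0 < z" "z < 1"
      "gauss (x + 1 *\<^sub>R y) - gauss (x + 0 *\<^sub>R y) = (1 - 0) * (- ((x + z *\<^sub>R y) \<bullet> y) * gauss (x + z *\<^sub>R y))"
      using MVT2[of 0 1 "\<lambda>t. gauss (x + t *\<^sub>R y)" "\<lambda>t. - ((x + t *\<^sub>R y) \<bullet> y) * gauss (x + t *\<^sub>R y)"]
      by auto
    have zy: "norm (z *\<^sub>R y) \<le> 1" using z y by (simp add: mult_le_one)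
    have "norm (x + z *\<^sub>R y) \<le> 1 + norm x"
      using norm_triangle_ineq[of x "z *\<^sub>R y"] zy by linarith
    then have "\<bar>(x + z *\<^sub>R y) \<bullet> y\<bar> \<le> (1 + norm x) * norm y"
      by (intro order_trans[OF Cauchy_Schwarz_ineq2] mult_right_mono) auto
    then have "\<bar>gauss (x + y) - gauss x\<bar> \<le> (1 + norm x) * norm y * gauss (x + z *\<^sub>R y)"
      using z(3) by (simp add: abs_mult gauss_nonneg mult_right_mono)
    then have "(1 + norm x) ^ m * \<bar>gauss (x + y) - gauss x\<bar> \<le>
        (1 + norm x) ^ m * ((1 + norm x) * norm y * gauss (x + z *\<^sub>R y))"
      by (intro mult_left_mono) auto
    also have "\<dots> = norm y * ((1 + norm x) ^ Suc m * gauss (x + z *\<^sub>R y))" by simp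
    also have "\<dots> \<le> norm y * (C * exp (- norm x))"
      using C(2)[OF zy, of x] by (intro mult_left_mono) auto
    finally show ?thesis by (simp add: mult_ac)
  qed
  then show ?thesis using C by blast
qed

lemma integrable_by_exp_bound:
  fixes f :: "'a::euclidean_space \<Rightarrow> real"
  assumes "f \<in> borel_measurable borel" and "\<And>x. \<bar>f x\<bar> \<le> C * exp (- norm x)"
  shows "integrable lborel f"
proof (rule Bochner_Integration.integrable_bound)
  show "integrable lborel (\<lambda>x. C * exp (- norm x))"
    by (simp add: integrable_exp_neg_norm)
  show "AE x in lborel. norm (f x) \<le> norm (C * exp (- norm x))"
    using assms(2) by (auto intro: order_trans[OF _ abs_ge_self])
qed (use assms in simp)

lemma integrable_gauss_poly:
  fixes f :: "'a::euclidean_space \<Rightarrow> real"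
  assumes [measurable]: "f \<in> borel_measurable borel" and b: "\<And>x. \<bar>f x\<bar> \<le> K * (1 + norm x) ^ m"
  shows "integrable lborel (\<lambda>x. gauss x * f x)"
proof -
  obtain C where C: "C \<ge> 0" "\<And>x y :: 'a. norm y \<le> 1 \<Longrightarrow> (1 + norm x) ^ m * gauss (x + y) \<le> C * exp (- norm x)"
    using gauss_dom[of m] by metis
  have K: "K \<ge> 0" using order_trans[OF abs_ge_zero b[of 0]] by simp
  have "\<bar>gauss x * f x\<bar> \<le> (K * C) * exp (- norm x)" for x
  proof -
    have "\<bar>gauss x * f x\<bar> \<le> gauss x * (K * (1 + norm x) ^ m)"
      using b[of x] by (simp add: abs_mult gauss_nonneg mult_left_mono)
    also have "\<dots> = K * ((1 + norm x) ^ m * gauss (x + 0))" by simp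
    also have "\<dots> \<le> K * (C * exp (- norm x))"
      using C(2)[of 0 x] K by (intro mult_left_mono) auto
    finally show ?thesis by simp
  qed
  then show ?thesis by (intro integrable_by_exp_bound) auto
qed

lemma lipschitz_growth:
  fixes \<psi> :: "'a::euclidean_space \<Rightarrow> real"
  assumes "L-lipschitz_on UNIV \<psi>"
  obtains K where "K \<ge> 0" "\<And>x. \<bar>\<psi> x\<bar> \<le> K * (1 + norm x)"
proof
  fix x
  have "\<bar>\<psi> x - \<psi> 0\<bar> \<le> L * norm x"
    using lipschitz_onD[OF assms, of x 0] by (simp add: dist_real_def)
  moreover have "L * norm x \<le> (L + \<bar>\<psi> 0\<bar>) * norm x" by (intro mult_right_mono) auto
  ultimately show "\<bar>\<psi> x\<bar> \<le> (L + \<bar>\<psi> 0\<bar>) * (1 + norm x)"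
    using lipschitz_on_nonneg[OF assms] mult_nonneg_nonneg[OF abs_ge_zero[of "\<psi> 0"] norm_ge_zero[of x]]
    unfolding distrib_left distrib_right by linarith
qed (use lipschitz_on_nonneg[OF assms] in auto)

lemma lipschitz_borel:
  fixes \<psi> :: "'a::euclidean_space \<Rightarrow> real"
  assumes "L-lipschitz_on UNIV \<psi>"
  shows "\<psi> \<in> borel_measurable borel"
  using lipschitz_on_continuous_on[OF assms] by (rule borel_measurable_continuous_onI)

text \<open>Splits the increment of the product into the increment of \<psi>, paid for by its
  Lipschitz constant, and the increment of the weight, against which \<psi> grows at most
  linearly.\<close>

lemma gauss_lipschitz_diff_dom:
  fixes \<psi> :: "'a::euclidean_space \<Rightarrow> real"
  assumes "L-lipschitz_on UNIV \<psi>"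
  obtains C where "C \<ge> 0" "\<And>x y. norm y \<le> 1 \<Longrightarrow>
     \<bar>gauss (x + y) * \<psi> (x + y) - gauss x * \<psi> x\<bar> \<le> C * norm y * exp (- norm x)"
proof -
  obtain C0 where C0: "C0 \<ge> 0" "\<And>x y :: 'a. norm y \<le> 1 \<Longrightarrow>
     (1 + norm x) ^ 0 * gauss (x + y) \<le> C0 * exp (- norm x)"
    using gauss_dom[of 0] by metis
  obtain C1 where C1: "C1 \<ge> 0" "\<And>x y :: 'a. norm y \<le> 1 \<Longrightarrow>
     (1 + norm x) ^ 1 * \<bar>gauss (x + y) - gauss x\<bar> \<le> C1 * norm y * exp (- norm x)"
    using gauss_diff_dom[of 1] by metis
  obtain K where K: "K \<ge> 0" "\<And>x. \<bar>\<psi> x\<bar> \<le> K * (1 + norm x)"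
    using lipschitz_growth[OF assms] by blast
  note L = lipschitz_on_nonneg[OF assms]
  show ?thesis
  proof
    show "0 \<le> L * C0 + K * C1" using C0 C1 K L by auto
    fix x y :: 'a assume y: "norm y \<le> 1"
    have "\<bar>\<psi> (x + y) - \<psi> x\<bar> \<le> L * norm y"
      using lipschitz_onD[OF assms, of "x + y" x] by (simp add: dist_norm)
    then have "gauss (x + y) * \<bar>\<psi> (x + y) - \<psi> x\<bar> \<le> gauss (x + y) * (L * norm y)"
      by (intro mult_left_mono) (auto simp: gauss_nonneg)
    also have "\<dots> \<le> (C0 * exp (- norm x)) * (L * norm y)"
      using C0(2)[OF y, of x] L by (intro mult_right_mono) auto
    finally have 1: "gauss (x + y) * \<bar>\<psi> (x + y) - \<psi> x\<bar> \<le> L * C0 * norm y * exp (- norm x)"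
      by (simp add: mult_ac)
    have "\<bar>\<psi> x\<bar> * \<bar>gauss (x + y) - gauss x\<bar> \<le> K * (1 + norm x) * \<bar>gauss (x + y) - gauss x\<bar>"
      using K by (intro mult_right_mono) auto
    also have "\<dots> = K * ((1 + norm x) ^ 1 * \<bar>gauss (x + y) - gauss x\<bar>)" by simp
    also have "\<dots> \<le> K * (C1 * norm y * exp (- norm x))"
      using C1(2)[OF y, of x] K by (intro mult_left_mono) auto
    finally have 2: "\<bar>\<psi> x\<bar> * \<bar>gauss (x + y) - gauss x\<bar> \<le> K * C1 * norm y * exp (- norm x)"
      by (simp add: mult_ac)
    have "gauss (x + y) * \<psi> (x + y) - gauss x * \<psi> x =
        gauss (x + y) * (\<psi> (x + y) - \<psi> x) + \<psi> x * (gauss (x + y) - gauss x)"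
      by (simp add: algebra_simps)
    also have "\<bar>\<dots>\<bar> \<le> gauss (x + y) * \<bar>\<psi> (x + y) - \<psi> x\<bar> + \<bar>\<psi> x\<bar> * \<bar>gauss (x + y) - gauss x\<bar>"
      by (intro order_trans[OF abs_triangle_ineq]) (simp add: abs_mult gauss_nonneg)
    also have "\<dots> \<le> (L * C0 + K * C1) * norm y * exp (- norm x)"
      using 1 2 by (simp add: algebra_simps)
    finally show "\<bar>gauss (x + y) * \<psi> (x + y) - gauss x * \<psi> x\<bar> \<le> (L * C0 + K * C1) * norm y * exp (- norm x)" .
  qed
qed

section \<open>Difference quotients and integration by parts for the Gaussian weight\<close>

lemma integral_translate:
  fixes f :: "'a::euclidean_space \<Rightarrow> real"
  assumes [measurable]: "f \<in> borel_measurable borel"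
  shows "(\<integral>x. f (x + c) \<partial>lborel) = (\<integral>x. f x \<partial>lborel)"
proof -
  have "(\<integral>x. f x \<partial>distr lborel borel ((+) c)) = (\<integral>x. f (c + x) \<partial>lborel)"
    by (rule integral_distr) auto
  then show ?thesis by (simp add: lborel_distr_plus add.commute)
qed

text \<open>Multiplied out, either side consists of four correlations \<open>P y z\<close>, and
  translation invariance makes \<open>P\<close> depend on y - z only. Moving the pair (u, v) by -(u
  + v) turns it into (-v, -u), which exchanges the two increments without differentiating anything
  twice.\<close>

lemma diff_quotient_swap:
  fixes \<psi> \<phi> :: "'a::euclidean_space \<Rightarrow> real"
  assumes \<psi>: "L-lipschitz_on UNIV \<psi>" and \<phi>: "L'-lipschitz_on UNIV \<phi>"
  assumes u: "norm u \<le> 1" and v: "norm v \<le> 1"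
  shows "(\<integral>x. (gauss (x + u) * \<psi> (x + u) - gauss x * \<psi> x) * (\<phi> (x + v) - \<phi> x) \<partial>lborel) =
    (\<integral>x. (gauss (x - v) * \<psi> (x - v) - gauss x * \<psi> x) * (\<phi> (x - u) - \<phi> x) \<partial>lborel)"
proof -
  note [measurable] = lipschitz_borel[OF \<psi>] lipschitz_borel[OF \<phi>]
  obtain K where K: "K \<ge> 0" "\<And>x. \<bar>\<psi> x\<bar> \<le> K * (1 + norm x)"
    using lipschitz_growth[OF \<psi>] by blast
  obtain K' where K': "K' \<ge> 0" "\<And>x. \<bar>\<phi> x\<bar> \<le> K' * (1 + norm x)"
    using lipschitz_growth[OF \<phi>] by blast
  define P where "P y z = (\<integral>x. gauss (x + y) * \<psi> (x + y) * \<phi> (x + z) \<partial>lborel)" for y z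
  obtain C0 where C0: "C0 \<ge> 0" "\<And>x y :: 'a. norm y \<le> 1 \<Longrightarrow>
     (1 + norm x) ^ 2 * gauss (x + y) \<le> C0 * exp (- norm x)"
    using gauss_dom[of 2] by metis
  have int: "integrable lborel (\<lambda>x. gauss (x + y) * \<psi> (x + y) * \<phi> (x + z))"
    if y: "norm y \<le> 1" and z: "norm z \<le> 1" for y z
  proof (rule integrable_by_exp_bound)
    fix x :: 'a
    have a: "1 + norm (x + y) \<le> 2 * (1 + norm x)" if "norm y \<le> 1" for y :: 'a
    proof -
      have "1 + norm (x + y) \<le> 1 + (norm x + 1)" using norm_triangle_ineq[of x y] that by simp
      also have "\<dots> \<le> 2 * (1 + norm x)" by simp
      finally show ?thesis .
    qed
    have "\<bar>gauss (x + y) * \<psi> (x + y) * \<phi> (x + z)\<bar> \<le>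
        gauss (x + y) * (K * (2 * (1 + norm x))) * (K' * (2 * (1 + norm x)))"
      unfolding abs_mult using K K' a[OF y] a[OF z]
      by (intro mult_mono) (auto simp: gauss_nonneg intro!: order_trans[OF K(2)] order_trans[OF K'(2)] mult_left_mono)
    also have "\<dots> = 4 * K * K' * ((1 + norm x) ^ 2 * gauss (x + y))"
      by (simp add: power2_eq_square algebra_simps)
    also have "\<dots> \<le> 4 * K * K' * (C0 * exp (- norm x))"
      using C0(2)[OF y, of x] K K' by (intro mult_left_mono) auto
    finally show "\<bar>gauss (x + y) * \<psi> (x + y) * \<phi> (x + z)\<bar> \<le> (4 * K * K' * C0) * exp (- norm x)"
      by simp
  qed measurable
  have P_shift: "P (y + c) (z + c) = P y z" for y z c
    unfolding P_def using integral_translate[of "\<lambda>x. gauss (x + y) * \<psi> (x + y) * \<phi> (x + z)" c]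
    by (simp add: add_ac)
  have expand: "(\<integral>x. (gauss (x + y) * \<psi> (x + y) - gauss x * \<psi> x) * (\<phi> (x + z) - \<phi> x) \<partial>lborel) =
      P y z - P y 0 - P 0 z + P 0 0" if "norm y \<le> 1" "norm z \<le> 1" for y z
  proof -
    have "(\<integral>x. (gauss (x + y) * \<psi> (x + y) - gauss x * \<psi> x) * (\<phi> (x + z) - \<phi> x) \<partial>lborel) =
      (\<integral>x. gauss (x + y) * \<psi> (x + y) * \<phi> (x + z) - gauss (x + y) * \<psi> (x + y) * \<phi> (x + 0)
        - gauss (x + 0) * \<psi> (x + 0) * \<phi> (x + z) + gauss (x + 0) * \<psi> (x + 0) * \<phi> (x + 0) \<partial>lborel)"
      by (intro Bochner_Integration.integral_cong) (auto simp: algebra_simps)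
    also have "\<dots> = P y z - P y 0 - P 0 z + P 0 0"
      unfolding P_def using that
      by (subst Bochner_Integration.integral_add Bochner_Integration.integral_diff;
          (intro Bochner_Integration.integrable_diff int; simp)?)+ simp
    finally show ?thesis .
  qed
  have "P u v = P (- v) (- u)" "P u 0 = P 0 (- u)" "P 0 v = P (- v) 0"
    using P_shift[of "-v" "u + v" "-u"] P_shift[of 0 u "-u"] P_shift[of "-v" v 0]
    by (simp_all add: algebra_simps)
  then show ?thesis
    using expand[OF u v] expand[of "-v" "-u"] u v by simp
qed

lemma difference_quotient_tendsto:
  fixes f :: "'a::real_normed_vector \<Rightarrow> real"
  assumes "(f has_derivative f') (at x)" "\<And>k. s k \<noteq> 0" "s \<longlonglongrightarrow> 0"
  shows "(\<lambda>k::nat. (f (x + s k *\<^sub>R e) - f x) / s k) \<longlonglongrightarrow> f' e"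
proof -
  have "((\<lambda>t. f (x + t *\<^sub>R e)) has_real_derivative f' e) (at 0)"
  proof -
    have "((\<lambda>t. x + t *\<^sub>R e) has_derivative (\<lambda>t. t *\<^sub>R e)) (at 0)"
      by (auto intro!: derivative_eq_intros)
    moreover have "(f has_derivative f') (at (x + 0 *\<^sub>R e))" using assms(1) by simp
    ultimately have "((\<lambda>t. f (x + t *\<^sub>R e)) has_derivative (\<lambda>t. f' (t *\<^sub>R e))) (at 0)"
      by (rule has_derivative_compose)
    then show ?thesis
      using linear_scale[OF has_derivative_linear[OF assms(1)]]
      by (simp add: has_field_derivative_def mult.commute[of "f' e", abs_def])
  qed
  then have "((\<lambda>h. (f (x + h *\<^sub>R e) - f x) / h) \<longlongrightarrow> f' e) (at 0)"
    by (simp add: DERIV_def)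
  moreover have "filterlim s (at 0) sequentially"
    using assms(2,3) by (simp add: filterlim_at)
  ultimately show ?thesis by (rule filterlim_compose)
qed

lemma lipschitz_gradient_bound:
  fixes f :: "'a::real_normed_vector \<Rightarrow> real"
  assumes "L-lipschitz_on UNIV f" "(f has_derivative f') (at x)"
  shows "\<bar>f' e\<bar> \<le> L * norm e"
proof -
  have "(\<lambda>k::nat. (f (x + inverse (real (Suc k)) *\<^sub>R e) - f x) / inverse (real (Suc k))) \<longlonglongrightarrow> f' e"
    by (rule difference_quotient_tendsto[OF assms(2)])
       (auto intro: LIMSEQ_inverse_real_of_nat simp del: of_nat_Suc)
  then have "(\<lambda>k::nat. \<bar>(f (x + inverse (real (Suc k)) *\<^sub>R e) - f x) / inverse (real (Suc k))\<bar>) \<longlonglongrightarrow> \<bar>f' e\<bar>"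
    by (rule tendsto_rabs)
  moreover have "\<bar>(f (x + s *\<^sub>R e) - f x) / s\<bar> \<le> L * norm e" if "s > 0" for s
  proof -
    have "\<bar>f (x + s *\<^sub>R e) - f x\<bar> \<le> L * (s * norm e)"
      using lipschitz_onD[OF assms(1), of "x + s *\<^sub>R e" x] that by (simp add: dist_norm)
    then show ?thesis using that by (simp add: field_simps)
  qed
  ultimately show ?thesis
    by (intro LIMSEQ_le_const2) (auto simp del: of_nat_Suc)
qed

lemma AE_lborel_nonzero: "AE x in lborel :: 'a::euclidean_space measure. x \<noteq> 0"
  by (rule AE_lborel_singleton)

lemma gauss_has_derivative:
  "(gauss has_derivative (\<lambda>h. - (x \<bullet> h) * gauss x)) (at x)"
  unfolding gauss_def[abs_def]
  by (auto intro!: derivative_eq_intros simp: fun_eq_iff inner_commute algebra_simps)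

text \<open>Dominated convergence; the origin, where \<psi> and \<phi> may fail to be
  differentiable, is a null set.\<close>

lemma diff_quotient_limit:
  fixes \<psi> \<phi> :: "'a::euclidean_space \<Rightarrow> real"
  assumes \<psi>: "L-lipschitz_on UNIV \<psi>" and \<phi>: "L'-lipschitz_on UNIV \<phi>"
    and D\<psi>: "\<And>x. x \<noteq> 0 \<Longrightarrow> (\<psi> has_derivative (\<lambda>h. g\<psi> x \<bullet> h)) (at x)"
    and D\<phi>: "\<And>x. x \<noteq> 0 \<Longrightarrow> (\<phi> has_derivative (\<lambda>h. g\<phi> x \<bullet> h)) (at x)"
    and [measurable]: "g\<psi> \<in> borel_measurable borel" "g\<phi> \<in> borel_measurable borel"
    and e: "norm e \<le> 1" and f: "norm f \<le> 1"
    and s: "\<And>k. s k \<noteq> 0" "\<And>k. \<bar>s k\<bar> \<le> 1" "s \<longlonglongrightarrow> 0"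
  shows "(\<lambda>k::nat. \<integral>x. (gauss (x + s k *\<^sub>R e) * \<psi> (x + s k *\<^sub>R e) - gauss x * \<psi> x) / s k *
      ((\<phi> (x + s k *\<^sub>R f) - \<phi> x) / s k) \<partial>lborel) \<longlonglongrightarrow>
    (\<integral>x. gauss x * (g\<psi> x \<bullet> e - (x \<bullet> e) * \<psi> x) * (g\<phi> x \<bullet> f) \<partial>lborel)"
proof -
  note [measurable] = lipschitz_borel[OF \<psi>] lipschitz_borel[OF \<phi>]
  note L' = lipschitz_on_nonneg[OF \<phi>]
  obtain C where C: "C \<ge> 0" "\<And>x y. norm y \<le> 1 \<Longrightarrow>
     \<bar>gauss (x + y) * \<psi> (x + y) - gauss x * \<psi> x\<bar> \<le> C * norm y * exp (- norm x)"
    using gauss_lipschitz_diff_dom[OF \<psi>] by metis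
  show ?thesis
  proof (rule integral_dominated_convergence)
    show "integrable lborel (\<lambda>x :: 'a. C * L' * exp (- norm x))"
      by (simp add: integrable_exp_neg_norm)
    show "AE x in lborel. (\<lambda>k. (gauss (x + s k *\<^sub>R e) * \<psi> (x + s k *\<^sub>R e) - gauss x * \<psi> x) / s k *
      ((\<phi> (x + s k *\<^sub>R f) - \<phi> x) / s k)) \<longlonglongrightarrow>
      gauss x * (g\<psi> x \<bullet> e - (x \<bullet> e) * \<psi> x) * (g\<phi> x \<bullet> f)"
      using AE_lborel_nonzero
    proof eventually_elim
      fix x :: 'a assume x: "x \<noteq> 0"
      have "((\<lambda>x. gauss x * \<psi> x) has_derivative
          (\<lambda>h. gauss x * (g\<psi> x \<bullet> h) + - (x \<bullet> h) * gauss x * \<psi> x)) (at x)"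
        by (rule has_derivative_mult[OF gauss_has_derivative D\<psi>[OF x]])
      from difference_quotient_tendsto[OF this s(1,3), of e]
        difference_quotient_tendsto[OF D\<phi>[OF x] s(1,3), of f]
      have "(\<lambda>k. (gauss (x + s k *\<^sub>R e) * \<psi> (x + s k *\<^sub>R e) - gauss x * \<psi> x) / s k *
        ((\<phi> (x + s k *\<^sub>R f) - \<phi> x) / s k)) \<longlonglongrightarrow>
        (gauss x * (g\<psi> x \<bullet> e) + - (x \<bullet> e) * gauss x * \<psi> x) * (g\<phi> x \<bullet> f)"
        by (rule tendsto_mult)
      then show "(\<lambda>k. (gauss (x + s k *\<^sub>R e) * \<psi> (x + s k *\<^sub>R e) - gauss x * \<psi> x) / s k *
        ((\<phi> (x + s k *\<^sub>R f) - \<phi> x) / s k)) \<longlonglongrightarrow>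
        gauss x * (g\<psi> x \<bullet> e - (x \<bullet> e) * \<psi> x) * (g\<phi> x \<bullet> f)"
        by (simp add: algebra_simps)
    qed
    fix k
    show "AE x in lborel. norm ((gauss (x + s k *\<^sub>R e) * \<psi> (x + s k *\<^sub>R e) - gauss x * \<psi> x) / s k *
      ((\<phi> (x + s k *\<^sub>R f) - \<phi> x) / s k)) \<le> C * L' * exp (- norm x)"
    proof (rule AE_I2)
      fix x :: 'a
      have "norm (s k *\<^sub>R e) \<le> 1" using s(2)[of k] e by (simp add: mult_le_one)
      then have "\<bar>gauss (x + s k *\<^sub>R e) * \<psi> (x + s k *\<^sub>R e) - gauss x * \<psi> x\<bar> \<le> C * (\<bar>s k\<bar> * norm e) * exp (- norm x)"
        using C(2) by (metis norm_scaleR)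
      also have "\<dots> \<le> C * (\<bar>s k\<bar> * 1) * exp (- norm x)"
        using e C(1) by (intro mult_right_mono mult_left_mono) auto
      finally have 1: "\<bar>(gauss (x + s k *\<^sub>R e) * \<psi> (x + s k *\<^sub>R e) - gauss x * \<psi> x) / s k\<bar> \<le> C * exp (- norm x)"
        using s(1)[of k] by (simp add: field_simps abs_mult)
      have "\<bar>\<phi> (x + s k *\<^sub>R f) - \<phi> x\<bar> \<le> L' * (\<bar>s k\<bar> * norm f)"
        using lipschitz_onD[OF \<phi>, of "x + s k *\<^sub>R f" x] by (simp add: dist_norm)
      also have "\<dots> \<le> L' * (\<bar>s k\<bar> * 1)"
        using f L' by (intro mult_left_mono) auto
      finally have 2: "\<bar>(\<phi> (x + s k *\<^sub>R f) - \<phi> x) / s k\<bar> \<le> L'"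
        using s(1)[of k] by (simp add: field_simps)
      show "norm ((gauss (x + s k *\<^sub>R e) * \<psi> (x + s k *\<^sub>R e) - gauss x * \<psi> x) / s k *
        ((\<phi> (x + s k *\<^sub>R f) - \<phi> x) / s k)) \<le> C * L' * exp (- norm x)"
        using mult_mono[OF 1 2] C(1) by (simp add: abs_mult mult_ac)
    qed
  qed measurable
qed

text \<open>Symmetry of the mixed second derivatives in weak form: it needs only first derivatives of
  \<open>\<psi>\<close> and \<open>\<phi>\<close>, because the two finite difference operators commute.\<close>

lemma gauss_derivatives_commute:
  fixes \<psi> \<phi> :: "'a::euclidean_space \<Rightarrow> real"
  assumes \<psi>: "L-lipschitz_on UNIV \<psi>" and \<phi>: "L'-lipschitz_on UNIV \<phi>"
    and D\<psi>: "\<And>x. x \<noteq> 0 \<Longrightarrow> (\<psi> has_derivative (\<lambda>h. g\<psi> x \<bullet> h)) (at x)"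
    and D\<phi>: "\<And>x. x \<noteq> 0 \<Longrightarrow> (\<phi> has_derivative (\<lambda>h. g\<phi> x \<bullet> h)) (at x)"
    and meas: "g\<psi> \<in> borel_measurable borel" "g\<phi> \<in> borel_measurable borel"
    and e: "norm e \<le> 1" and f: "norm f \<le> 1"
  shows "(\<integral>x. gauss x * (g\<psi> x \<bullet> e - (x \<bullet> e) * \<psi> x) * (g\<phi> x \<bullet> f) \<partial>lborel) =
    (\<integral>x. gauss x * (g\<psi> x \<bullet> f - (x \<bullet> f) * \<psi> x) * (g\<phi> x \<bullet> e) \<partial>lborel)"
proof -
  define s where "s k = inverse (real (Suc k))" for k
  have s: "s k \<noteq> 0" "\<bar>s k\<bar> \<le> 1" "- s k \<noteq> 0" "\<bar>- s k\<bar> \<le> 1" for k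
    by (auto simp: s_def divide_simps)
  have s0: "s \<longlonglongrightarrow> 0" unfolding s_def by (rule LIMSEQ_inverse_real_of_nat)
  then have s0': "(\<lambda>k. - s k) \<longlonglongrightarrow> 0" using tendsto_minus by force
  \<comment> \<open>The exchange reverses the direction of both increments, hence the step -s on the
    right; the two signs in the denominators cancel.\<close>
  have eq: "(\<integral>x. (gauss (x + s k *\<^sub>R e) * \<psi> (x + s k *\<^sub>R e) - gauss x * \<psi> x) / s k *
      ((\<phi> (x + s k *\<^sub>R f) - \<phi> x) / s k) \<partial>lborel) =
    (\<integral>x. (gauss (x + - s k *\<^sub>R f) * \<psi> (x + - s k *\<^sub>R f) - gauss x * \<psi> x) / - s k *
      ((\<phi> (x + - s k *\<^sub>R e) - \<phi> x) / - s k) \<partial>lborel)" for k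
  proof -
    have "norm (s k *\<^sub>R e) \<le> 1" "norm (s k *\<^sub>R f) \<le> 1"
      using s(2)[of k] e f by (simp_all add: mult_le_one)
    from diff_quotient_swap[OF \<psi> \<phi> this] show ?thesis
      by (simp flip: minus_divide_left)
  qed
  show ?thesis
    by (rule LIMSEQ_unique[OF diff_quotient_limit[OF \<psi> \<phi> D\<psi> D\<phi> meas e f s(1,2) s0, unfolded eq]
        diff_quotient_limit[OF \<psi> \<phi> D\<psi> D\<phi> meas f e s(3,4) s0']])
qed

text \<open>Commutation with the linear function x . f', where f' is a unit vector orthogonal to e:
  its derivative is 1 along f' and 0 along e, so one side is the integral in question and the other
  is 0. Dimension at least 2 provides f'.\<close>

lemma gauss_integration_by_parts:
  fixes \<psi> :: "'a::euclidean_space \<Rightarrow> real"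
  assumes dim: "DIM('a) \<ge> 2" and \<psi>: "L-lipschitz_on UNIV \<psi>"
    and D\<psi>: "\<And>x. x \<noteq> 0 \<Longrightarrow> (\<psi> has_derivative (\<lambda>h. g\<psi> x \<bullet> h)) (at x)"
    and meas: "g\<psi> \<in> borel_measurable borel"
  shows "(\<integral>x. gauss x * (g\<psi> x \<bullet> e - (x \<bullet> e) * \<psi> x) \<partial>lborel) = 0"
proof -
  have unit: "(\<integral>x. gauss x * (g\<psi> x \<bullet> e - (x \<bullet> e) * \<psi> x) \<partial>lborel) = 0" if e: "norm e \<le> 1" for e
  proof -
    have "dim {e} \<le> 1" using dim_le_card'[of "{e}"] by simp
    then have "dim {e} < DIM('a)" using dim by simp
    then obtain f where f: "f \<noteq> 0" "\<And>y. y \<in> span {e} \<Longrightarrow> orthogonal f y"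
      using orthogonal_to_subspace_exists by metis
    define f' where "f' = sgn f"
    have f': "norm f' = 1" "f' \<bullet> e = 0" "f' \<bullet> f' = 1"
      using f f(2)[of e] by (simp_all add: f'_def norm_sgn orthogonal_def sgn_div_norm span_base dot_square_norm power2_eq_square)
    have "1-lipschitz_on UNIV (\<lambda>x. x \<bullet> f')"
      using Cauchy_Schwarz_ineq2[of _ f'] f'(1)
      by (intro lipschitz_onI) (auto simp: dist_norm simp flip: inner_diff_left)
    moreover have "((\<lambda>x. x \<bullet> f') has_derivative (\<lambda>h. f' \<bullet> h)) (at x)" for x
      by (auto intro!: derivative_eq_intros simp: inner_commute)
    ultimately show ?thesis
      using gauss_derivatives_commute[OF \<psi> _ D\<psi> _ meas, of 1 "\<lambda>x. x \<bullet> f'" "\<lambda>x. f'" e f'] e f'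
      by simp
  qed
  show ?thesis
  proof (cases "e = 0")
    case False
    have "(\<integral>x. gauss x * (g\<psi> x \<bullet> e - (x \<bullet> e) * \<psi> x) \<partial>lborel) =
        (\<integral>x. norm e * (gauss x * (g\<psi> x \<bullet> sgn e - (x \<bullet> sgn e) * \<psi> x)) \<partial>lborel)"
      using False by (intro Bochner_Integration.integral_cong) (auto simp: sgn_div_norm field_simps)
    also have "\<dots> = 0" using unit[of "sgn e"] by (simp add: norm_sgn)
    finally show ?thesis .
  qed simp
qed

text \<open>Integration by parts for \<psi> x = x . v in the direction v.\<close>

lemma gauss_second_moment:
  fixes v :: "'a::euclidean_space"
  assumes dim: "DIM('a) \<ge> 2"
  shows "(\<integral>x. gauss x * (x \<bullet> v)\<^sup>2 \<partial>lborel) = (v \<bullet> v) * (\<integral>(x::'a). gauss x \<partial>lborel)"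
proof -
  have lip: "(norm v)-lipschitz_on UNIV (\<lambda>x. x \<bullet> v)"
    using Cauchy_Schwarz_ineq2[of _ v]
    by (intro lipschitz_onI) (auto simp: dist_norm mult.commute[of "norm v"] simp flip: inner_diff_left)
  have "(\<integral>x. gauss x * (v \<bullet> v - (x \<bullet> v) * (x \<bullet> v)) \<partial>lborel) = 0"
    by (rule gauss_integration_by_parts[OF dim lip])
       (auto intro!: bounded_linear_imp_has_derivative bounded_linear_inner_left simp: inner_commute)
  moreover have "integrable lborel (\<lambda>x :: 'a. gauss x)"
    using integrable_gauss_poly[of "\<lambda>x::'a. 1" 1 0] by simp
  moreover have "\<bar>(x \<bullet> v)\<^sup>2\<bar> \<le> (norm v)\<^sup>2 * (1 + norm x)\<^sup>2" for x
  proof -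
    have "\<bar>x \<bullet> v\<bar> \<le> norm v * (1 + norm x)"
      by (rule order_trans[OF Cauchy_Schwarz_ineq2]) (simp add: algebra_simps)
    then have "\<bar>x \<bullet> v\<bar>\<^sup>2 \<le> (norm v * (1 + norm x))\<^sup>2" by (intro power_mono) auto
    then show ?thesis by (simp add: power_mult_distrib)
  qed
  then have "integrable lborel (\<lambda>x :: 'a. gauss x * (x \<bullet> v)\<^sup>2)"
    by (intro integrable_gauss_poly[where m = 2]) auto
  ultimately show ?thesis
    by (simp add: right_diff_distrib power2_eq_square mult.commute)
qed

text \<open>By homogeneity the integral of gauss(c x) f(x) is c^(-n) times its value at c = 1.
  Differentiating in c at 1 brings down -|x|^2 on one side and -n on the other. This removes factors
  |x|^2 from integrals of functions of degree 0.\<close>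

lemma gauss_homogeneous_scaling:
  fixes f :: "'a::euclidean_space \<Rightarrow> real"
  assumes [measurable]: "f \<in> borel_measurable borel"
    and bound: "\<And>x. \<bar>f x\<bar> \<le> K" and hom: "\<And>c x. c > 0 \<Longrightarrow> f (c *\<^sub>R x) = f x"
  shows "(\<integral>x. gauss x * ((x \<bullet> x) * f x) \<partial>lborel) = real DIM('a) * (\<integral>x. gauss x * f x \<partial>lborel)"
proof -
  define I where "I = (\<integral>x. gauss x * f x \<partial>lborel)"
  define t where "t k = inverse (real (Suc k))" for k
  have t: "0 < t k" "t k \<le> 1" for k by (auto simp: t_def divide_simps)
  have t0: "t \<longlonglongrightarrow> 0" unfolding t_def by (rule LIMSEQ_inverse_real_of_nat)
  have K: "K \<ge> 0" using order_trans[OF abs_ge_zero bound[of 0]] .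
  have int: "integrable lborel (\<lambda>x. gauss (c *\<^sub>R x) * f x)" if "c \<ge> 1" for c
  proof (rule Bochner_Integration.integrable_bound[OF integrable_gauss_poly[of "\<lambda>x :: 'a. K" K 0]])
    have "gauss (c *\<^sub>R x) \<le> gauss x" for x :: 'a
      using mult_mono[of 1 "c * c" "x \<bullet> x" "x \<bullet> x"] mult_mono[of 1 c 1 c] that
      by (simp add: gauss_def mult.assoc)
    then show "AE x in lborel. norm (gauss (c *\<^sub>R x) * f x) \<le> norm (gauss x * K)"
      using bound K by (auto simp: abs_mult gauss_nonneg intro!: mult_mono)
  qed (use K in auto)
  have scale: "I = c ^ DIM('a) * (\<integral>x. gauss (c *\<^sub>R x) * f x \<partial>lborel)" if "c > 0" for c
  proof -
    have "I = (\<integral>x. gauss x * f x \<partial>density (distr lborel borel (\<lambda>x. 0 + c *\<^sub>R x)) (\<lambda>_. ennreal (\<bar>c\<bar> ^ DIM('a))))"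
      unfolding I_def using that by (subst lborel_affine[of c 0]) auto
    also have "\<dots> = c ^ DIM('a) * (\<integral>x. gauss (c *\<^sub>R x) * f (c *\<^sub>R x) \<partial>lborel)"
      using that by (subst integral_density) (auto simp: integral_distr)
    finally show ?thesis using hom[OF that] by simp
  qed
  have "(\<lambda>k. \<integral>x. (gauss ((1 + t k) *\<^sub>R x) - gauss x) / t k * f x \<partial>lborel) \<longlonglongrightarrow>
      (\<integral>x. - (x \<bullet> x) * gauss x * f x \<partial>lborel)"
  proof (rule integral_dominated_convergence)
    have "\<bar>(x \<bullet> x) * K\<bar> \<le> K * (1 + norm x) ^ 2" for x :: 'a
    proof -
      have "(norm x)\<^sup>2 \<le> (1 + norm x)\<^sup>2" by (intro power_mono) auto
      then show ?thesis using K by (simp add: abs_mult dot_square_norm mult.commute mult_left_mono)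
    qed
    then have "integrable lborel (\<lambda>x :: 'a. gauss x * ((x \<bullet> x) * K))"
      by (intro integrable_gauss_poly[where m = 2]) auto
    then show "integrable lborel (\<lambda>x :: 'a. 2 * (gauss x * ((x \<bullet> x) * K)))" by simp
    show "AE x in lborel. (\<lambda>k. (gauss ((1 + t k) *\<^sub>R x) - gauss x) / t k * f x) \<longlonglongrightarrow> - (x \<bullet> x) * gauss x * f x"
    proof (rule AE_I2)
      fix x :: 'a
      have "(\<lambda>k. (gauss (x + t k *\<^sub>R x) - gauss x) / t k) \<longlonglongrightarrow> - (x \<bullet> x) * gauss x"
        using t(1) t0 by (intro difference_quotient_tendsto[OF gauss_has_derivative]) (auto simp: less_imp_neq[symmetric])
      then show "(\<lambda>k. (gauss ((1 + t k) *\<^sub>R x) - gauss x) / t k * f x) \<longlonglongrightarrow> - (x \<bullet> x) * gauss x * f x"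
        by (intro tendsto_mult tendsto_const) (simp add: scaleR_add_left)
    qed
    fix k
    show "AE x in lborel. norm ((gauss ((1 + t k) *\<^sub>R x) - gauss x) / t k * f x) \<le> 2 * (gauss x * ((x \<bullet> x) * K))"
    proof (rule AE_I2)
      fix x :: 'a
      let ?q = "x \<bullet> x" and ?t = "t k"
      have "(1 + ?t) * (1 + ?t) = 1 + ?t * (2 + ?t)" by (simp add: algebra_simps)
      moreover have "?t * (2 + ?t) \<le> ?t * 3" using t[of k] by (intro mult_left_mono) auto
      ultimately have *: "(1 + ?t) * (1 + ?t) * ?q \<le> ?q + 3 * ?t * ?q" "?q \<le> (1 + ?t) * (1 + ?t) * ?q"
        using mult_right_mono[of "(1 + ?t) * (1 + ?t)" "1 + ?t * 3" ?q] mult_right_mono[of 1 "(1 + ?t) * (1 + ?t)" ?q] t[of k]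
        by (auto simp: algebra_simps)
      have g: "gauss ((1 + ?t) *\<^sub>R x) = exp (- ((1 + ?t) * (1 + ?t) * ?q) / 2)"
        by (simp add: gauss_def mult.assoc)
      have "gauss x - gauss ((1 + ?t) *\<^sub>R x) \<le> gauss x - exp (- ?q / 2 + - (3 * ?t * ?q) / 2)"
        unfolding g using *(1) by (intro diff_left_mono) (simp add: field_simps)
      also have "\<dots> = gauss x * (1 - exp (- (3 * ?t * ?q) / 2))"
        unfolding exp_add by (simp add: gauss_def algebra_simps)
      also have "\<dots> \<le> gauss x * (3 * ?t * ?q / 2)"
        using exp_ge_add_one_self[of "- (3 * ?t * ?q) / 2"] by (intro mult_left_mono) (auto simp: gauss_nonneg)
      also have "\<dots> \<le> gauss x * (2 * ?t * ?q)"
        using t[of k] by (intro mult_left_mono) (auto simp: gauss_nonneg)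
      finally have "gauss x - gauss ((1 + ?t) *\<^sub>R x) \<le> gauss x * (2 * ?t * ?q)" .
      moreover have "gauss ((1 + ?t) *\<^sub>R x) \<le> gauss x"
        unfolding g using *(2) by (simp add: gauss_def)
      ultimately have "\<bar>(gauss ((1 + ?t) *\<^sub>R x) - gauss x) / ?t\<bar> \<le> 2 * gauss x * ?q"
        using t[of k] gauss_nonneg[of x] by (auto simp: field_simps abs_if)
      from mult_mono[OF this bound[of x]]
      show "norm ((gauss ((1 + ?t) *\<^sub>R x) - gauss x) / ?t * f x) \<le> 2 * (gauss x * (?q * K))"
        using t[of k] by (simp add: abs_mult gauss_nonneg mult_ac)
    qed
  qed measurable
  moreover have "(\<integral>x. (gauss ((1 + t k) *\<^sub>R x) - gauss x) / t k * f x \<partial>lborel) =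
      ((inverse ((1 + t k) ^ DIM('a)) - 1) / t k) * I" for k
  proof -
    have "(\<integral>x. (gauss ((1 + t k) *\<^sub>R x) - gauss x) / t k * f x \<partial>lborel) =
        (\<integral>x. inverse (t k) * (gauss ((1 + t k) *\<^sub>R x) * f x - gauss x * f x) \<partial>lborel)"
      by (intro Bochner_Integration.integral_cong) (auto simp: field_simps)
    also have "\<dots> = inverse (t k) * ((\<integral>x. gauss ((1 + t k) *\<^sub>R x) * f x \<partial>lborel) - I)"
      using int[of "1 + t k"] int[of 1] t[of k] by (simp add: I_def)
    also have "(\<integral>x. gauss ((1 + t k) *\<^sub>R x) * f x \<partial>lborel) = inverse ((1 + t k) ^ DIM('a)) * I"
      using scale[of "1 + t k"] t[of k] by (simp add: field_simps)
    finally show ?thesis by (simp add: field_simps)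
  qed
  moreover have "(\<lambda>k. ((inverse ((1 + t k) ^ DIM('a)) - 1) / t k) * I) \<longlonglongrightarrow> - real DIM('a) * I"
  proof -
    have "((\<lambda>c. inverse (c ^ DIM('a))) has_derivative (\<lambda>h. - real DIM('a) * h)) (at (1 :: real))"
      unfolding has_field_derivative_def[symmetric]
      by (auto intro!: derivative_eq_intros)
    from difference_quotient_tendsto[OF this, of t 1] t(1) t0
    show ?thesis by (intro tendsto_mult tendsto_const) (auto simp: less_imp_neq[symmetric])
  qed
  ultimately have "(\<integral>x. - (x \<bullet> x) * gauss x * f x \<partial>lborel) = - real DIM('a) * I"
    by (metis (no_types, lifting) LIMSEQ_unique ext)
  moreover have "(\<integral>x. - (x \<bullet> x) * gauss x * f x \<partial>lborel) = (\<integral>x. - (gauss x * ((x \<bullet> x) * f x)) \<partial>lborel)"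
    by (intro Bochner_Integration.integral_cong) auto
  ultimately show ?thesis by (simp add: I_def)
qed

section \<open>The Poincare inequality for odd functions\<close>

lemma nn_integral_translate:
  fixes f :: "'a::euclidean_space \<Rightarrow> ennreal"
  assumes [measurable]: "f \<in> borel_measurable borel"
  shows "(\<integral>\<^sup>+x. f (x + c) \<partial>lborel) = (\<integral>\<^sup>+x. f x \<partial>lborel)"
proof -
  have "(\<integral>\<^sup>+x. f x \<partial>distr lborel borel ((+) c)) = (\<integral>\<^sup>+x. f (c + x) \<partial>lborel)"
    by (rule nn_integral_distr) auto
  then show ?thesis by (simp add: lborel_distr_plus add.commute)
qed

text \<open>A rotation is a product of three shears, and shears preserve the measure by Fubini.\<close>

lemma nn_integral_rotate_pair:
  fixes k :: "'a::euclidean_space \<Rightarrow> 'a \<Rightarrow> ennreal" and c s :: real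
  assumes k [measurable]: "case_prod k \<in> borel_measurable (borel \<Otimes>\<^sub>M borel)"
    and cs: "c\<^sup>2 + s\<^sup>2 = 1" "s \<noteq> 0"
  shows "(\<integral>\<^sup>+x. \<integral>\<^sup>+y. k (c *\<^sub>R x + s *\<^sub>R y) (- s *\<^sub>R x + c *\<^sub>R y) \<partial>lborel \<partial>lborel) =
    (\<integral>\<^sup>+x. \<integral>\<^sup>+y. k x y \<partial>lborel \<partial>lborel)"
proof -
  have swap: "(\<integral>\<^sup>+x. \<integral>\<^sup>+y. h x y \<partial>lborel \<partial>lborel) = (\<integral>\<^sup>+y. \<integral>\<^sup>+x. h x y \<partial>lborel \<partial>lborel)"
    if "case_prod h \<in> borel_measurable (borel \<Otimes>\<^sub>M borel)" for h :: "'a \<Rightarrow> 'a \<Rightarrow> ennreal"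
    using that by (intro lborel_pair.Fubini') simp
  have meas_lin: "(\<lambda>(x, y). h (a *\<^sub>R x + b *\<^sub>R y) (a' *\<^sub>R x + b' *\<^sub>R y)) \<in> borel_measurable (borel \<Otimes>\<^sub>M borel)"
    if [measurable]: "case_prod h \<in> borel_measurable (borel \<Otimes>\<^sub>M borel)"
    for h :: "'a \<Rightarrow> 'a \<Rightarrow> ennreal" and a b a' b'
  proof -
    have "(\<lambda>(x, y). h (a *\<^sub>R x + b *\<^sub>R y) (a' *\<^sub>R x + b' *\<^sub>R y)) =
      (\<lambda>p. case_prod h (a *\<^sub>R fst p + b *\<^sub>R snd p, a' *\<^sub>R fst p + b' *\<^sub>R snd p))"
      by (auto simp: fun_eq_iff)
    also have "\<dots> \<in> borel_measurable (borel \<Otimes>\<^sub>M borel)" by measurable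
    finally show ?thesis .
  qed
  have sec1: "(\<lambda>x. h x y) \<in> borel_measurable borel"
    if "case_prod h \<in> borel_measurable (borel \<Otimes>\<^sub>M borel)" for h :: "'a \<Rightarrow> 'a \<Rightarrow> ennreal" and y
    using measurable_compose[OF measurable_Pair1' that, of y] measurable_compose[OF measurable_Pair2'[of y borel borel] that]
    by simp
  have sec2: "(\<lambda>y. h x y) \<in> borel_measurable borel"
    if "case_prod h \<in> borel_measurable (borel \<Otimes>\<^sub>M borel)" for h :: "'a \<Rightarrow> 'a \<Rightarrow> ennreal" and x
    using measurable_compose[OF measurable_Pair1'[of x borel borel] that] by simp
  have sh2: "(\<integral>\<^sup>+x. \<integral>\<^sup>+y. h x (b *\<^sub>R x + y) \<partial>lborel \<partial>lborel) = (\<integral>\<^sup>+x. \<integral>\<^sup>+y. h x y \<partial>lborel \<partial>lborel)"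
    if h: "case_prod h \<in> borel_measurable (borel \<Otimes>\<^sub>M borel)" for h :: "'a \<Rightarrow> 'a \<Rightarrow> ennreal" and b
    using nn_integral_translate[OF sec2[OF h]] by (simp add: add.commute[of "b *\<^sub>R _"])
  have sh1: "(\<integral>\<^sup>+x. \<integral>\<^sup>+y. h (x + b *\<^sub>R y) y \<partial>lborel \<partial>lborel) = (\<integral>\<^sup>+x. \<integral>\<^sup>+y. h x y \<partial>lborel \<partial>lborel)"
    if h: "case_prod h \<in> borel_measurable (borel \<Otimes>\<^sub>M borel)" for h :: "'a \<Rightarrow> 'a \<Rightarrow> ennreal" and b
  proof -
    have "(\<integral>\<^sup>+x. \<integral>\<^sup>+y. h (x + b *\<^sub>R y) y \<partial>lborel \<partial>lborel) = (\<integral>\<^sup>+y. \<integral>\<^sup>+x. h (x + b *\<^sub>R y) y \<partial>lborel \<partial>lborel)"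
      using meas_lin[OF h, of 1 b 0 1] by (intro swap) simp
    also have "\<dots> = (\<integral>\<^sup>+y. \<integral>\<^sup>+x. h x y \<partial>lborel \<partial>lborel)"
      using nn_integral_translate[OF sec1[OF h]] by simp
    finally show ?thesis using swap[OF h] by simp
  qed
  \<comment> \<open>With c = cos \<theta> and s = sin \<theta> this is tan (\<theta> / 2): the
    rotation is the shear by a in the first variable, the shear by -s in the second, and the shear
    by a again. The relation a + a c = s below is where c^2 + s^2 = 1 enters.\<close>
  define a where "a = (1 - c) / s"
  have a: "a * s = 1 - c" using cs(2) by (simp add: a_def)
  have a2: "a + a * c = s"
  proof -
    have "s * (a + a * c) = (a * s) * (1 + c)" by (simp add: algebra_simps)
    also have "\<dots> = s * s" unfolding a using cs(1) by (simp add: power2_eq_square algebra_simps)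
    finally show ?thesis using cs(2) by simp
  qed
  let ?k1 = "\<lambda>x y. k (x + a *\<^sub>R y) y"
  let ?k2 = "\<lambda>x y. ?k1 x (- s *\<^sub>R x + y)"
  have k1: "case_prod ?k1 \<in> borel_measurable (borel \<Otimes>\<^sub>M borel)"
    using meas_lin[OF k, of 1 a 0 1] by simp
  have k2: "case_prod ?k2 \<in> borel_measurable (borel \<Otimes>\<^sub>M borel)"
    using meas_lin[OF k1, of 1 0 "- s" 1] by simp
  have "(\<integral>\<^sup>+x. \<integral>\<^sup>+y. k x y \<partial>lborel \<partial>lborel) = (\<integral>\<^sup>+x. \<integral>\<^sup>+y. ?k2 (x + a *\<^sub>R y) y \<partial>lborel \<partial>lborel)"
    using sh1[OF k2, of a] sh2[OF k1, of "- s"] sh1[OF k, of a] by simp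
  also have "\<dots> = (\<integral>\<^sup>+x. \<integral>\<^sup>+y. k (c *\<^sub>R x + s *\<^sub>R y) (- s *\<^sub>R x + c *\<^sub>R y) \<partial>lborel \<partial>lborel)"
  proof -
    have 1: "- s *\<^sub>R (x + a *\<^sub>R y) + y = - s *\<^sub>R x + c *\<^sub>R y" for x y :: 'a
    proof -
      have "- s *\<^sub>R (x + a *\<^sub>R y) + y = - s *\<^sub>R x + (1 - a * s) *\<^sub>R y"
        by (simp add: algebra_simps)
      then show ?thesis using a by simp
    qed
    have 2: "(x + a *\<^sub>R y) + a *\<^sub>R (- s *\<^sub>R x + c *\<^sub>R y) = c *\<^sub>R x + s *\<^sub>R y" for x y :: 'a
    proof -
      have "(x + a *\<^sub>R y) + a *\<^sub>R (- s *\<^sub>R x + c *\<^sub>R y) = (1 - a * s) *\<^sub>R x + (a + a * c) *\<^sub>R y"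
        by (simp add: algebra_simps)
      then show ?thesis using a a2 by simp
    qed
    show ?thesis unfolding 1 2 ..
  qed
  finally show ?thesis ..
qed

text \<open>After a shift, \<open>f\<close> vanishes at \<open>0\<close> and \<open>\<pi>\<close>, and there
  \<open>f'\<^sup>2 - f\<^sup>2 = (f' - f cot)\<^sup>2 + (f\<^sup>2 cot)'\<close>.\<close>

lemma wirtinger_zero:
  fixes f f' :: "real \<Rightarrow> real"
  assumes D: "\<And>t. (f has_real_derivative f' t) (at t)"
    and cont: "continuous_on UNIV f'" and f0: "f 0 = 0" and fpi: "f pi = 0"
  shows "integral {0..pi} (\<lambda>t. (f t)\<^sup>2) \<le> integral {0..pi} (\<lambda>t. (f' t)\<^sup>2)"
proof -
  have contf: "continuous_on UNIV f"
    using D by (meson DERIV_continuous continuous_at_imp_continuous_on)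
  define q where "q t = (f' t)\<^sup>2 - (f t)\<^sup>2" for t
  have contq: "continuous_on X q" for X
    unfolding q_def by (intro continuous_intros continuous_on_subset[OF cont] continuous_on_subset[OF contf]) auto
  have int: "q integrable_on {a..b}" for a b
    by (intro integrable_continuous_interval contq)
  obtain M where M: "M \<ge> 0" "\<And>t. t \<in> {0..pi} \<Longrightarrow> \<bar>f' t\<bar> \<le> M"
  proof -
    have "bounded (f' ` {0..pi})"
      by (intro compact_imp_bounded compact_continuous_image continuous_on_subset[OF cont]) auto
    then obtain B where "\<forall>x\<in>f' ` {0..pi}. norm x \<le> B" unfolding bounded_iff by blast
    then show ?thesis by (intro that[of "max B 0"]) (force simp: le_max_iff_disj)+
  qed
  obtain N where N: "N \<ge> 0" "\<And>t. t \<in> {0..pi} \<Longrightarrow> \<bar>q t\<bar> \<le> N"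
  proof -
    have "bounded (q ` {0..pi})"
      by (intro compact_imp_bounded compact_continuous_image contq) auto
    then obtain B where "\<forall>x\<in>q ` {0..pi}. norm x \<le> B" unfolding bounded_iff by blast
    then show ?thesis by (intro that[of "max B 0"]) (force simp: le_max_iff_disj)+
  qed
  have lip: "\<bar>f a - f b\<bar> \<le> M * \<bar>a - b\<bar>" if "a \<in> {0..pi}" "b \<in> {0..pi}" for a b
    using field_differentiable_bound[of "{0..pi}" f f' M a b, OF _ DERIV_subset[OF D]] M that
    by auto
  \<comment> \<open>cot has poles at 0 and pi, so the identity is integrated over
    [\<epsilon>, pi - \<epsilon>] only. Each boundary term is at most M^2 \<epsilon>, because |f|
    \<le> M \<epsilon> there and \<epsilon> cot \<epsilon> \<le> 1; each of the two end pieces of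
    the integral costs N \<epsilon>.\<close>
  have key: "- (2 * M\<^sup>2 + 2 * N) * \<epsilon> \<le> integral {0..pi} q" if \<epsilon>: "0 < \<epsilon>" "\<epsilon> < 1" for \<epsilon>
  proof -
    have pi: "\<epsilon> < pi - \<epsilon>" using \<epsilon> pi_gt3 by linarith
    define G where "G t = (f t)\<^sup>2 * cot t" for t
    define g where "g t = 2 * f t * f' t * cot t - (f t)\<^sup>2 * (1 + (cot t)\<^sup>2)" for t
    have sin: "sin t > 0" if "t \<in> {\<epsilon>..pi - \<epsilon>}" for t
      using that \<epsilon> by (intro sin_gt_zero) auto
    have "(G has_real_derivative g t) (at t within {\<epsilon>..pi - \<epsilon>})" if "t \<in> {\<epsilon>..pi - \<epsilon>}" for t
    proof -
      have "1 + (cot t)\<^sup>2 = inverse ((sin t)\<^sup>2)"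
        using sin[OF that] sin_cos_squared_add[of t] by (simp add: cot_def field_simps)
      then have "(G has_real_derivative g t) (at t)"
        unfolding G_def g_def
        using DERIV_mult[OF DERIV_power[OF D[of t], of 2] DERIV_cot] sin[OF that]
        by (simp add: algebra_simps)
      then show ?thesis by (rule DERIV_subset) simp
    qed
    then have G: "(g has_integral G (pi - \<epsilon>) - G \<epsilon>) {\<epsilon>..pi - \<epsilon>}"
      using pi by (intro fundamental_theorem_of_calculus)
        (auto simp: has_real_derivative_iff_has_vector_derivative)
    have "g t \<le> q t" for t
    proof -
      have "0 \<le> (f' t - f t * cot t)\<^sup>2" by simp
      also have "\<dots> = q t - g t" by (simp add: q_def g_def power2_eq_square algebra_simps)
      finally show ?thesis by simp
    qed
    then have G_le: "G (pi - \<epsilon>) - G \<epsilon> \<le> integral {\<epsilon>..pi - \<epsilon>} q"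
      using G int by (intro has_integral_le[OF G integrable_integral]) auto
    have "\<epsilon> * cot \<epsilon> \<le> 1"
    proof -
      have "sin \<epsilon> > 0" using \<epsilon> pi_gt3 by (intro sin_gt_zero) auto
      moreover have "\<epsilon> * cos \<epsilon> \<le> sin \<epsilon>"
      proof -
        have "(\<lambda>t. sin t - t * cos t) 0 \<le> (\<lambda>t. sin t - t * cos t) \<epsilon>"
        proof (rule DERIV_nonneg_imp_nondecreasing[where f = "\<lambda>t. sin t - t * cos t"])
          show "0 \<le> \<epsilon>" using \<epsilon> by simp
          fix t assume t: "0 \<le> t" "t \<le> \<epsilon>"
          have "((\<lambda>t. sin t - t * cos t) has_real_derivative t * sin t) (at t)"
            by (auto intro!: derivative_eq_intros)
          moreover have "t * sin t \<ge> 0" using t \<epsilon> pi_gt3 by (intro mult_nonneg_nonneg sin_ge_zero) auto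
          ultimately show "\<exists>y. ((\<lambda>t. sin t - t * cos t) has_real_derivative y) (at t) \<and> 0 \<le> y" by blast
        qed
        then show ?thesis by simp
      qed
      ultimately show ?thesis by (simp add: cot_def field_simps)
    qed
    then have "\<epsilon> * (\<epsilon> * cot \<epsilon>) \<le> \<epsilon>" using \<epsilon> mult_left_mono[of "\<epsilon> * cot \<epsilon>" 1 \<epsilon>] by simp
    have cotpos: "cot \<epsilon> \<ge> 0"
      using \<epsilon> pi_gt3 sin_gt_zero[of \<epsilon>] cos_ge_zero[of \<epsilon>] by (auto simp: cot_def)
    have "(f \<epsilon>)\<^sup>2 \<le> (M * \<epsilon>)\<^sup>2"
      using lip[of \<epsilon> 0] f0 \<epsilon> pi_gt3 power_mono[of "\<bar>f \<epsilon>\<bar>" "M * \<epsilon>" 2] by auto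
    moreover have "(f (pi - \<epsilon>))\<^sup>2 \<le> (M * \<epsilon>)\<^sup>2"
      using lip[of "pi - \<epsilon>" pi] fpi \<epsilon> pi_gt3 power_mono[of "\<bar>f (pi - \<epsilon>)\<bar>" "M * \<epsilon>" 2] by auto
    ultimately have "((f \<epsilon>)\<^sup>2 + (f (pi - \<epsilon>))\<^sup>2) * cot \<epsilon> \<le> (2 * (M * \<epsilon>)\<^sup>2) * cot \<epsilon>"
      using cotpos by (intro mult_right_mono) auto
    also have "\<dots> = 2 * M\<^sup>2 * (\<epsilon> * (\<epsilon> * cot \<epsilon>))" by (simp add: power2_eq_square)
    also have "\<dots> \<le> 2 * M\<^sup>2 * \<epsilon>"
      using \<open>\<epsilon> * (\<epsilon> * cot \<epsilon>) \<le> \<epsilon>\<close> by (intro mult_left_mono) auto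
    moreover have "G (pi - \<epsilon>) - G \<epsilon> = - (((f \<epsilon>)\<^sup>2 + (f (pi - \<epsilon>))\<^sup>2) * cot \<epsilon>)"
      by (simp add: G_def cot_def sin_diff cos_diff algebra_simps)
    moreover have "integral {0..pi} q = integral {0..\<epsilon>} q + integral {\<epsilon>..pi - \<epsilon>} q + integral {pi - \<epsilon>..pi} q"
      using \<epsilon> pi int by (simp add: Henstock_Kurzweil_Integration.integral_combine)
    moreover have "\<bar>integral {0..\<epsilon>} q\<bar> \<le> N * (\<epsilon> - 0)"
      using N \<epsilon> pi by (intro integral_bound[of 0 \<epsilon> q N, unfolded real_norm_def] contq) auto
    moreover have "\<bar>integral {pi - \<epsilon>..pi} q\<bar> \<le> N * (pi - (pi - \<epsilon>))"
      using N \<epsilon> pi by (intro integral_bound[of "pi - \<epsilon>" pi q N, unfolded real_norm_def] contq) auto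
    ultimately show ?thesis using G_le by (simp add: algebra_simps)
  qed
  have "0 \<le> integral {0..pi} q"
  proof (rule tendsto_upperbound)
    show "((\<lambda>\<epsilon>. - (2 * M\<^sup>2 + 2 * N) * \<epsilon>) \<longlongrightarrow> 0) (at_right 0)"
      by (auto intro!: tendsto_eq_intros)
    show "\<forall>\<^sub>F \<epsilon> in at_right 0. - (2 * M\<^sup>2 + 2 * N) * \<epsilon> \<le> integral {0..pi} q"
      unfolding eventually_at_right_field using key by (intro exI[of _ 1]) auto
  qed auto
  moreover have "integral {0..pi} q = integral {0..pi} (\<lambda>t. (f' t)\<^sup>2) - integral {0..pi} (\<lambda>t. (f t)\<^sup>2)"
    unfolding q_def
    by (intro Henstock_Kurzweil_Integration.integral_diff integrable_continuous_interval continuous_intros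
        continuous_on_subset[OF cont] continuous_on_subset[OF contf]) auto
  ultimately show ?thesis by simp
qed

lemma integral_shift_period:
  fixes q :: "real \<Rightarrow> real"
  assumes cont: "continuous_on UNIV q" and per: "\<And>t. q (t + pi) = q t" and a: "0 \<le> a" "a \<le> pi"
  shows "integral {0..pi} (\<lambda>t. q (t + a)) = integral {0..pi} q"
proof -
  have int: "q integrable_on {c..d}" for c d
    by (intro integrable_continuous_interval continuous_on_subset[OF cont]) auto
  have shift: "integral {c..d} (\<lambda>t. q (t + b)) = integral {c + b..d + b} q" for b c d
    by (rule integral_shift[unfolded o_def]) (auto intro: continuous_on_subset[OF cont])
  have "integral {0..pi} (\<lambda>t. q (t + a)) = integral {a..pi + a} q"
    using shift[of 0 pi a] by simp
  also have "\<dots> = integral {a..pi} q + integral {pi..pi + a} q"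
    using a int by (simp add: Henstock_Kurzweil_Integration.integral_combine)
  also have "integral {pi..pi + a} q = integral {0..a} q"
    using shift[of 0 a pi] per by (simp add: add.commute)
  also have "integral {a..pi} q + integral {0..a} q = integral {0..pi} q"
    using a int Henstock_Kurzweil_Integration.integral_combine[of 0 a pi q] by simp
  finally show ?thesis .
qed

text \<open>The values at 0 and pi are opposite, so there is a zero a in [0, pi], and the translate
  by a vanishes at both 0 and pi. Squares are periodic with period pi, so the translation leaves
  both integrals unchanged.\<close>

lemma wirtinger_antiperiodic:
  fixes f f' :: "real \<Rightarrow> real"
  assumes D: "\<And>t. (f has_real_derivative f' t) (at t)"
    and cont: "continuous_on UNIV f'" and anti: "\<And>t. f (t + pi) = - f t"
  shows "integral {0..pi} (\<lambda>t. (f t)\<^sup>2) \<le> integral {0..pi} (\<lambda>t. (f' t)\<^sup>2)"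
proof -
  have contf: "continuous_on UNIV f"
    using D by (meson DERIV_continuous continuous_at_imp_continuous_on)
  have fpi: "f pi = - f 0" using anti[of 0] by simp
  have "\<exists>a. 0 \<le> a \<and> a \<le> pi \<and> f a = 0"
  proof (cases "f 0 \<le> 0")
    case True
    then show ?thesis using fpi
      by (intro IVT') (auto intro: continuous_on_subset[OF contf])
  next
    case False
    then show ?thesis using fpi
      by (intro IVT2') (auto intro: continuous_on_subset[OF contf])
  qed
  then obtain a where a: "0 \<le> a" "a \<le> pi" "f a = 0" by blast
  have anti': "f' (t + pi) = - f' t" for t
  proof -
    have "((\<lambda>t. f (t + pi)) has_real_derivative f' (t + pi)) (at t)"
      using D[of "t + pi"] by (simp add: DERIV_shift)
    moreover have "((\<lambda>t. f (t + pi)) has_real_derivative - f' t) (at t)"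
      unfolding anti using D[of t] by (rule DERIV_minus)
    ultimately show ?thesis by (rule DERIV_unique)
  qed
  have "integral {0..pi} (\<lambda>t. (f (t + a))\<^sup>2) \<le> integral {0..pi} (\<lambda>t. (f' (t + a))\<^sup>2)"
  proof (rule wirtinger_zero)
    show "((\<lambda>t. f (t + a)) has_real_derivative f' (t + a)) (at t)" for t
      using D[of "t + a"] by (simp add: DERIV_shift)
    show "continuous_on UNIV (\<lambda>t. f' (t + a))"
      by (intro continuous_on_compose2[OF cont] continuous_intros) auto
    show "f (0 + a) = 0" "f (pi + a) = 0" using a(3) anti[of a] by (simp_all add: add.commute)
  qed
  moreover have "integral {0..pi} (\<lambda>t. (f (t + a))\<^sup>2) = integral {0..pi} (\<lambda>t. (f t)\<^sup>2)"
    by (rule integral_shift_period) (auto simp: anti a intro!: continuous_intros contf)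
  moreover have "integral {0..pi} (\<lambda>t. (f' (t + a))\<^sup>2) = integral {0..pi} (\<lambda>t. (f' t)\<^sup>2)"
    by (rule integral_shift_period) (auto simp: anti' a intro!: continuous_intros cont)
  ultimately show ?thesis by simp
qed

text \<open>Passes from the gauge integrals of the one-dimensional inequality to the nonnegative
  integrals to which Fubini applies.\<close>

lemma nn_integral_Icc_continuous:
  fixes q :: "real \<Rightarrow> real"
  assumes "continuous_on UNIV q" "\<And>t. 0 \<le> q t"
  shows "(\<integral>\<^sup>+t. ennreal (indicator {a..b} t * q t) \<partial>lborel) = ennreal (integral {a..b} q)"
proof (rule nn_integral_has_integral_lborel)
  have [measurable]: "q \<in> borel_measurable borel"
    using assms(1) by (rule borel_measurable_continuous_onI)
  show "(\<lambda>t. indicator {a..b} t * q t) \<in> borel_measurable borel" by measurable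
  have "(q has_integral integral {a..b} q) {a..b}"
    by (intro integrable_integral integrable_continuous_interval continuous_on_subset[OF assms(1)]) auto
  then have "((\<lambda>t. if t \<in> {a..b} then q t else 0) has_integral integral {a..b} q) UNIV"
    by (simp only: has_integral_restrict_UNIV)
  then show "((\<lambda>t. indicator {a..b} t * q t) has_integral integral {a..b} q) UNIV"
    by (rule has_integral_eq[rotated]) (auto simp: indicator_def)
qed (use assms(2) in auto)

lemma gauss_rotate_pair:
  assumes "c\<^sup>2 + s\<^sup>2 = (1 :: real)"
  shows "gauss (c *\<^sub>R x + s *\<^sub>R y) * gauss (- s *\<^sub>R x + c *\<^sub>R y) = gauss x * gauss y"
proof -
  let ?u = "c *\<^sub>R x + s *\<^sub>R y" and ?v = "- s *\<^sub>R x + c *\<^sub>R y"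
  have "?u \<bullet> ?u + ?v \<bullet> ?v = (c\<^sup>2 + s\<^sup>2) * (x \<bullet> x) + (c\<^sup>2 + s\<^sup>2) * (y \<bullet> y)"
    by (simp add: inner_add_left inner_add_right inner_diff_left inner_diff_right inner_commute power2_eq_square algebra_simps)
  then have "?u \<bullet> ?u + ?v \<bullet> ?v = x \<bullet> x + y \<bullet> y" using assms by simp
  then have "- (?u \<bullet> ?u) / 2 + - (?v \<bullet> ?v) / 2 = - (x \<bullet> x) / 2 + - (y \<bullet> y) / 2"
    by linarith
  then show ?thesis by (simp only: gauss_def flip: exp_add)
qed

text \<open>If x is nonzero and y is off the line through x, the circle cos \<theta> x + sin
  \<theta> y never meets the origin, the one point where no derivative is available. Almost every
  pair has this property.\<close>

lemma AE_not_in_span: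
  fixes x :: "'a::euclidean_space"
  assumes "DIM('a) \<ge> 2"
  shows "AE y in lborel. y \<notin> span {x}"
proof -
  have "dim (span {x}) \<le> 1" using dim_le_card'[of "{x}"] by simp
  then have "negligible (span {x})" using assms by (intro negligible_lowdim) simp
  moreover have "span {x} \<in> sets borel" by (intro borel_closed closed_subspace) simp
  ultimately have "span {x} \<in> null_sets lborel"
    by (simp add: negligible_iff_null_sets null_sets_completion_iff)
  then show ?thesis by (rule AE_not_in)
qed

text \<open>Great circles in the plane of two independent Gaussian vectors \<open>x\<close>, \<open>y\<close>: the pair
  \<open>(cos \<theta> x + sin \<theta> y, - sin \<theta> x + cos \<theta> y)\<close> has the distribution of
  \<open>(x, y)\<close>, and an odd function is antiperiodic in \<open>\<theta>\<close>.\<close>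

theorem gauss_poincare_odd:
  fixes \<psi> :: "'a::euclidean_space \<Rightarrow> real"
  assumes dim: "DIM('a) \<ge> 2" and \<psi>: "L-lipschitz_on UNIV \<psi>"
    and D\<psi>: "\<And>x. x \<noteq> 0 \<Longrightarrow> (\<psi> has_derivative (\<lambda>h. g\<psi> x \<bullet> h)) (at x)"
    and cont: "continuous_on (- {0}) g\<psi>" and odd: "\<And>x. \<psi> (- x) = - \<psi> x"
  shows "(\<integral>x. gauss x * (\<psi> x)\<^sup>2 \<partial>lborel) \<le> (\<integral>x. gauss x * (g\<psi> x \<bullet> g\<psi> x) \<partial>lborel)"
proof -
  note [measurable] = lipschitz_borel[OF \<psi>]
  have g_meas [measurable]: "g\<psi> \<in> borel_measurable borel"
    by (rule borel_measurable_continuous_countable_exceptions[OF _ cont]) simp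
  define X where "X \<theta> x y = cos \<theta> *\<^sub>R x + sin \<theta> *\<^sub>R y" for \<theta> and x y :: 'a
  define Y where "Y \<theta> x y = - sin \<theta> *\<^sub>R x + cos \<theta> *\<^sub>R y" for \<theta> and x y :: 'a
  define I where "I \<theta> = (indicator {0..pi} \<theta> :: real)" for \<theta> :: real
  have [measurable]: "I \<in> borel_measurable borel" unfolding I_def[abs_def] by measurable
  define Z where "Z = (\<integral>(x::'a). gauss x \<partial>lborel)"
  have intZ: "integrable lborel (\<lambda>x :: 'a. gauss x)"
    using integrable_gauss_poly[of "\<lambda>x::'a. 1" 1 0] by simp
  have Z0: "Z > 0"
  proof -
    have "Z \<noteq> 0"
    proof
      assume "Z = 0"
      then have "AE x in lborel :: 'a measure. gauss x = 0"
        using integral_nonneg_eq_0_iff_AE[OF intZ] by (simp add: Z_def gauss_nonneg)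
      then have "AE x in lborel :: 'a measure. False"
        by (rule AE_mp) (auto simp: gauss_pos less_imp_neq[symmetric])
      then show False by (simp add: eventually_False ae_filter_eq_bot_iff)
    qed
    then show ?thesis unfolding Z_def
      by (metis gauss_nonneg integral_nonneg_AE AE_I2 order_le_imp_less_or_eq)
  qed
  define h where "h \<theta> x y = ennreal (I \<theta> * (gauss x * gauss y * (\<psi> (X \<theta> x y))\<^sup>2))" for \<theta> x y
  define h' where "h' \<theta> x y = ennreal (I \<theta> * (gauss x * gauss y * (g\<psi> (X \<theta> x y) \<bullet> Y \<theta> x y)\<^sup>2))" for \<theta> x y
  define A where "A = (\<integral>\<^sup>+x. ennreal (gauss x * (\<psi> x)\<^sup>2) \<partial>lborel)"
  define B where "B = (\<integral>\<^sup>+x. ennreal (gauss x * (g\<psi> x \<bullet> g\<psi> x)) \<partial>lborel)"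
  have nnZ: "(\<integral>\<^sup>+(y::'a). ennreal (gauss y) \<partial>lborel) = ennreal Z"
    unfolding Z_def by (rule nn_integral_eq_integral[OF intZ]) (auto simp: gauss_nonneg)
  have rot: "(\<integral>\<^sup>+x. \<integral>\<^sup>+y. k (X \<theta> x y) (Y \<theta> x y) \<partial>lborel \<partial>lborel) = (\<integral>\<^sup>+x. \<integral>\<^sup>+y. k x y \<partial>lborel \<partial>lborel)"
    if "case_prod k \<in> borel_measurable (borel \<Otimes>\<^sub>M borel)" "0 < \<theta>" "\<theta> < pi" for k \<theta>
    unfolding X_def Y_def using that sin_gt_zero[of \<theta>]
    by (intro nn_integral_rotate_pair) (auto simp: add.commute)
  have gXY: "gauss (X \<theta> x y) * gauss (Y \<theta> x y) = gauss x * gauss y" for \<theta> x y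
    unfolding X_def Y_def by (rule gauss_rotate_pair) simp
  \<comment> \<open>Rotation invariance makes the double integral independent of \<theta>, and the y
    integral then factors out as \<open>Z\<close>.\<close>
  have hA: "(\<integral>\<^sup>+x. \<integral>\<^sup>+y. h \<theta> x y \<partial>lborel \<partial>lborel) = ennreal (I \<theta>) * (A * ennreal Z)"
    if "0 < \<theta>" "\<theta> < pi" for \<theta>
  proof -
    let ?k = "\<lambda>x y :: 'a. ennreal (gauss x * gauss y * (\<psi> x)\<^sup>2)"
    have "(\<integral>\<^sup>+x. \<integral>\<^sup>+y. h \<theta> x y \<partial>lborel \<partial>lborel) = (\<integral>\<^sup>+x. \<integral>\<^sup>+y. ?k (X \<theta> x y) (Y \<theta> x y) \<partial>lborel \<partial>lborel)"
      using that unfolding gXY by (simp add: h_def I_def)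
    also have "\<dots> = (\<integral>\<^sup>+x. \<integral>\<^sup>+y. ?k x y \<partial>lborel \<partial>lborel)"
      using that by (intro rot) measurable
    also have "\<dots> = (\<integral>\<^sup>+x. \<integral>\<^sup>+(y::'a). ennreal (gauss x * (\<psi> x)\<^sup>2) * ennreal (gauss y) \<partial>lborel \<partial>lborel)"
      by (simp add: gauss_nonneg mult_ac flip: ennreal_mult)
    also have "\<dots> = A * ennreal Z"
      by (simp add: nn_integral_cmult nn_integral_multc nnZ A_def)
    finally show ?thesis using that by (simp add: I_def)
  qed
  have hB: "(\<integral>\<^sup>+x. \<integral>\<^sup>+y. h' \<theta> x y \<partial>lborel \<partial>lborel) = ennreal (I \<theta>) * (B * ennreal Z)"
    if "0 < \<theta>" "\<theta> < pi" for \<theta>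
  proof -
    let ?k = "\<lambda>x y :: 'a. ennreal (gauss x * gauss y * (g\<psi> x \<bullet> y)\<^sup>2)"
    have "(\<integral>\<^sup>+x. \<integral>\<^sup>+y. h' \<theta> x y \<partial>lborel \<partial>lborel) = (\<integral>\<^sup>+x. \<integral>\<^sup>+y. ?k (X \<theta> x y) (Y \<theta> x y) \<partial>lborel \<partial>lborel)"
      using that unfolding gXY by (simp add: h'_def I_def)
    also have "\<dots> = (\<integral>\<^sup>+x. \<integral>\<^sup>+y. ?k x y \<partial>lborel \<partial>lborel)"
      using that by (intro rot) measurable
    also have "\<dots> = (\<integral>\<^sup>+x. ennreal (gauss x) * (\<integral>\<^sup>+y. ennreal (gauss y * (y \<bullet> g\<psi> x)\<^sup>2) \<partial>lborel) \<partial>lborel)"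
      by (subst nn_integral_cmult[symmetric])
         (auto simp: gauss_nonneg inner_commute mult_ac simp flip: ennreal_mult)
    \<comment> \<open>The component of a fixed vector along an independent Gaussian y has mean
      square equal to the squared length of the vector. So the derivative along circles averages to
      the full gradient norm.\<close>
    also have "\<dots> = (\<integral>\<^sup>+x. ennreal (gauss x) * ennreal ((g\<psi> x \<bullet> g\<psi> x) * Z) \<partial>lborel)"
    proof (intro nn_integral_cong arg_cong2[of _ _ _ _ "(*)"] refl)
      fix x :: 'a
      have "\<bar>(y \<bullet> g\<psi> x)\<^sup>2\<bar> \<le> (norm (g\<psi> x))\<^sup>2 * (1 + norm y)\<^sup>2" for y
      proof -
        have "\<bar>y \<bullet> g\<psi> x\<bar> \<le> norm (g\<psi> x) * (1 + norm y)"
          by (rule order_trans[OF Cauchy_Schwarz_ineq2]) (simp add: algebra_simps)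
        then have "\<bar>y \<bullet> g\<psi> x\<bar>\<^sup>2 \<le> (norm (g\<psi> x) * (1 + norm y))\<^sup>2" by (intro power_mono) auto
        then show ?thesis by (simp add: power_mult_distrib)
      qed
      then have "integrable lborel (\<lambda>y :: 'a. gauss y * (y \<bullet> g\<psi> x)\<^sup>2)"
        by (intro integrable_gauss_poly[where m = 2]) auto
      then show "(\<integral>\<^sup>+y. ennreal (gauss y * (y \<bullet> g\<psi> x)\<^sup>2) \<partial>lborel) = ennreal ((g\<psi> x \<bullet> g\<psi> x) * Z)"
        unfolding Z_def gauss_second_moment[OF dim, symmetric]
        by (rule nn_integral_eq_integral) (auto simp: gauss_nonneg)
    qed
    also have "\<dots> = (\<integral>\<^sup>+x. ennreal (gauss x * (g\<psi> x \<bullet> g\<psi> x)) * ennreal Z \<partial>lborel)"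
      using Z0 by (simp add: gauss_nonneg mult_ac flip: ennreal_mult)
    also have "\<dots> = B * ennreal Z" by (simp add: nn_integral_multc B_def)
    finally show ?thesis using that by (simp add: I_def)
  qed
  \<comment> \<open>sin \<theta> = 0 at both ends of the interval, where the decomposition into
    shears breaks down; two points are negligible.\<close>
  have in_range: "AE \<theta> in lborel. (0 < \<theta> \<and> \<theta> < pi) \<or> I \<theta> = 0"
    using AE_lborel_singleton[of 0] AE_lborel_singleton[of pi]
    by eventually_elim (auto simp: I_def indicator_def)
  have total: "(\<integral>\<^sup>+\<theta>. \<integral>\<^sup>+x. \<integral>\<^sup>+y. k \<theta> x y \<partial>lborel \<partial>lborel \<partial>lborel) = ennreal pi * (C * ennreal Z)"
    if eq: "\<And>\<theta>. 0 < \<theta> \<Longrightarrow> \<theta> < pi \<Longrightarrow> (\<integral>\<^sup>+x. \<integral>\<^sup>+y. k \<theta> x y \<partial>lborel \<partial>lborel) = ennreal (I \<theta>) * (C * ennreal Z)"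
      and zero: "\<And>\<theta> x y. I \<theta> = 0 \<Longrightarrow> k \<theta> x y = 0" for k and C
  proof -
    have "(\<integral>\<^sup>+\<theta>. \<integral>\<^sup>+x. \<integral>\<^sup>+y. k \<theta> x y \<partial>lborel \<partial>lborel \<partial>lborel) = (\<integral>\<^sup>+\<theta>. ennreal (I \<theta>) * (C * ennreal Z) \<partial>lborel)"
    proof (rule nn_integral_cong_AE)
      show "AE \<theta> in lborel. (\<integral>\<^sup>+x. \<integral>\<^sup>+y. k \<theta> x y \<partial>lborel \<partial>lborel) = ennreal (I \<theta>) * (C * ennreal Z)"
        using in_range by eventually_elim (auto simp: eq zero)
    qed
    also have "\<dots> = (\<integral>\<^sup>+\<theta>. ennreal (I \<theta>) \<partial>lborel) * (C * ennreal Z)"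
      by (rule nn_integral_multc) measurable
    also have "(\<integral>\<^sup>+\<theta>. ennreal (I \<theta>) \<partial>lborel) = ennreal pi"
      by (simp add: I_def ennreal_indicator)
    finally show ?thesis .
  qed
  have swap: "(\<integral>\<^sup>+\<theta>. \<integral>\<^sup>+x. \<integral>\<^sup>+y. k \<theta> x y \<partial>lborel \<partial>lborel \<partial>lborel) =
      (\<integral>\<^sup>+x. \<integral>\<^sup>+y. \<integral>\<^sup>+\<theta>. k \<theta> x y \<partial>lborel \<partial>lborel \<partial>lborel)"
    if k: "(\<lambda>((\<theta>, x), y). k \<theta> x y) \<in> borel_measurable ((borel \<Otimes>\<^sub>M borel) \<Otimes>\<^sub>M borel)"
    for k :: "real \<Rightarrow> 'a \<Rightarrow> 'a \<Rightarrow> ennreal"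
  proof -
    have k2: "(\<lambda>(\<theta>, x). \<integral>\<^sup>+y. k \<theta> x y \<partial>lborel) \<in> borel_measurable (borel \<Otimes>\<^sub>M borel)"
    proof -
      have "(\<lambda>(p, y). (\<lambda>((\<theta>, x), y). k \<theta> x y) (p, y)) \<in> borel_measurable ((borel \<Otimes>\<^sub>M borel) \<Otimes>\<^sub>M lborel)"
        using k by (simp add: case_prod_unfold cong: measurable_cong_sets)
      from lborel.borel_measurable_nn_integral[OF this] show ?thesis
        by (simp add: case_prod_unfold)
    qed
    have k3: "(\<lambda>(\<theta>, y). k \<theta> x y) \<in> borel_measurable (borel \<Otimes>\<^sub>M borel)" for x
    proof -
      have "(\<lambda>(\<theta>, y). ((\<theta>, x), y)) \<in> (borel \<Otimes>\<^sub>M borel) \<rightarrow>\<^sub>M ((borel \<Otimes>\<^sub>M borel) \<Otimes>\<^sub>M borel)"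
        by measurable
      from measurable_compose[OF this k] show ?thesis by (simp add: case_prod_unfold)
    qed
    have "(\<integral>\<^sup>+\<theta>. \<integral>\<^sup>+x. \<integral>\<^sup>+y. k \<theta> x y \<partial>lborel \<partial>lborel \<partial>lborel) =
        (\<integral>\<^sup>+x. \<integral>\<^sup>+\<theta>. \<integral>\<^sup>+y. k \<theta> x y \<partial>lborel \<partial>lborel \<partial>lborel)"
      using k2 by (intro lborel_pair.Fubini') simp
    also have "\<dots> = (\<integral>\<^sup>+x. \<integral>\<^sup>+y. \<integral>\<^sup>+\<theta>. k \<theta> x y \<partial>lborel \<partial>lborel \<partial>lborel)"
      using k3 by (intro nn_integral_cong lborel_pair.Fubini') simp
    finally show ?thesis .
  qed
  have hm: "(\<lambda>((\<theta>, x), y). h \<theta> x y) \<in> borel_measurable ((borel \<Otimes>\<^sub>M borel) \<Otimes>\<^sub>M borel)"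
    unfolding h_def X_def case_prod_unfold by measurable
  have h'm: "(\<lambda>((\<theta>, x), y). h' \<theta> x y) \<in> borel_measurable ((borel \<Otimes>\<^sub>M borel) \<Otimes>\<^sub>M borel)"
    unfolding h'_def X_def Y_def case_prod_unfold by measurable
  have point: "(\<integral>\<^sup>+\<theta>. h \<theta> x y \<partial>lborel) \<le> (\<integral>\<^sup>+\<theta>. h' \<theta> x y \<partial>lborel)"
    if x: "x \<noteq> 0" and y: "y \<notin> span {x}" for x y
  proof -
    have X0: "X \<theta> x y \<noteq> 0" for \<theta>
    proof
      assume X0: "X \<theta> x y = 0"
      show False
      proof (cases "sin \<theta> = 0")
        case True
        then have "cos \<theta> \<noteq> 0" using sin_cos_squared_add[of \<theta>] by auto
        then show False using X0 True x by (simp add: X_def)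
      next
        case False
        have "sin \<theta> *\<^sub>R y = (- cos \<theta>) *\<^sub>R x" using X0 by (simp add: X_def add_eq_0_iff)
        then have "y = (- cos \<theta> / sin \<theta>) *\<^sub>R x"
          using False by (metis (no_types, lifting) divideR_right scaleR_scaleR divide_inverse mult.commute)
        then show False using y by (metis span_base span_scale singletonI)
      qed
    qed
    define f where "f \<theta> = \<psi> (X \<theta> x y)" for \<theta>
    define f' where "f' \<theta> = g\<psi> (X \<theta> x y) \<bullet> Y \<theta> x y" for \<theta>
    have Df: "(f has_real_derivative f' \<theta>) (at \<theta>)" for \<theta>
    proof -
      have "((\<lambda>\<theta>. X \<theta> x y) has_derivative (\<lambda>t. t *\<^sub>R Y \<theta> x y)) (at \<theta>)"
        unfolding X_def Y_def
        by (auto intro!: derivative_eq_intros simp: fun_eq_iff algebra_simps)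
      from has_derivative_compose[OF this D\<psi>[OF X0]]
      show ?thesis unfolding f_def f'_def has_field_derivative_def
        by (simp add: mult.commute[of "_ \<bullet> _", abs_def])
    qed
    have cont_X: "continuous_on UNIV (\<lambda>\<theta>. X \<theta> x y)" and cont_Y: "continuous_on UNIV (\<lambda>\<theta>. Y \<theta> x y)"
      unfolding X_def Y_def by (intro continuous_intros)+
    have cont': "continuous_on UNIV f'"
      unfolding f'_def
      by (intro continuous_intros cont_Y continuous_on_compose2[OF cont cont_X]) (auto simp: X0)
    have contf: "continuous_on UNIV f"
      using Df by (meson DERIV_continuous continuous_at_imp_continuous_on)
    have "f (\<theta> + pi) = - f \<theta>" for \<theta>
      by (simp add: f_def X_def flip: odd)
    from wirtinger_antiperiodic[OF Df cont' this]
    have W: "integral {0..pi} (\<lambda>t. (f t)\<^sup>2) \<le> integral {0..pi} (\<lambda>t. (f' t)\<^sup>2)" .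
    have G: "gauss x * gauss y \<ge> 0" by (simp add: gauss_nonneg)
    have "(\<integral>\<^sup>+\<theta>. h \<theta> x y \<partial>lborel) = ennreal (integral {0..pi} (\<lambda>t. gauss x * gauss y * (f t)\<^sup>2))"
      unfolding h_def I_def f_def[symmetric] using G
      by (intro nn_integral_Icc_continuous continuous_intros contf) auto
    also have "\<dots> \<le> ennreal (integral {0..pi} (\<lambda>t. gauss x * gauss y * (f' t)\<^sup>2))"
      using W G by (intro ennreal_leI) (simp add: mult_left_mono)
    also have "\<dots> = (\<integral>\<^sup>+\<theta>. h' \<theta> x y \<partial>lborel)"
      unfolding h'_def I_def f'_def[symmetric] using G
      by (intro nn_integral_Icc_continuous[symmetric] continuous_intros cont') auto
    finally show ?thesis .
  qed
  \<comment> \<open>The one-dimensional inequality holds on almost every circle. Averaging over (x,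
    y) and cancelling the positive finite factor pi Z leaves A \<le> B.\<close>
  have "ennreal pi * (A * ennreal Z) = (\<integral>\<^sup>+x. \<integral>\<^sup>+y. \<integral>\<^sup>+\<theta>. h \<theta> x y \<partial>lborel \<partial>lborel \<partial>lborel)"
    using swap[OF hm] total[of h, OF hA] by (simp add: h_def)
  also have "\<dots> \<le> (\<integral>\<^sup>+x. \<integral>\<^sup>+y. \<integral>\<^sup>+\<theta>. h' \<theta> x y \<partial>lborel \<partial>lborel \<partial>lborel)"
  proof (rule nn_integral_mono_AE)
    show "AE x in lborel. (\<integral>\<^sup>+y. \<integral>\<^sup>+\<theta>. h \<theta> x y \<partial>lborel \<partial>lborel) \<le> (\<integral>\<^sup>+y. \<integral>\<^sup>+\<theta>. h' \<theta> x y \<partial>lborel \<partial>lborel)"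
      using AE_lborel_nonzero
    proof eventually_elim
      fix x :: 'a assume x: "x \<noteq> 0"
      show "(\<integral>\<^sup>+y. \<integral>\<^sup>+\<theta>. h \<theta> x y \<partial>lborel \<partial>lborel) \<le> (\<integral>\<^sup>+y. \<integral>\<^sup>+\<theta>. h' \<theta> x y \<partial>lborel \<partial>lborel)"
      proof (rule nn_integral_mono_AE)
        show "AE y in lborel. (\<integral>\<^sup>+\<theta>. h \<theta> x y \<partial>lborel) \<le> (\<integral>\<^sup>+\<theta>. h' \<theta> x y \<partial>lborel)"
          using AE_not_in_span[OF dim, of x] by eventually_elim (rule point[OF x])
      qed
    qed
  qed
  also have "\<dots> = ennreal pi * (B * ennreal Z)"
    using swap[OF h'm] total[of h', OF hB] by (simp add: h'_def)
  finally have "(ennreal pi * ennreal Z) * A \<le> (ennreal pi * ennreal Z) * B"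
    by (simp add: mult_ac)
  then have AB: "A \<le> B"
    using Z0 by (subst (asm) ennreal_mult_le_mult_iff) (auto simp: ennreal_mult_eq_top_iff)
  obtain K where K: "K \<ge> 0" "\<And>x. \<bar>\<psi> x\<bar> \<le> K * (1 + norm x)"
    using lipschitz_growth[OF \<psi>] by blast
  have "\<bar>(\<psi> x)\<^sup>2\<bar> \<le> K\<^sup>2 * (1 + norm x)\<^sup>2" for x
    using power_mono[OF K(2)[of x], of 2] by (simp add: power_mult_distrib)
  then have "integrable lborel (\<lambda>x. gauss x * (\<psi> x)\<^sup>2)"
    by (intro integrable_gauss_poly[where m = 2]) auto
  then have A: "A = ennreal (\<integral>x. gauss x * (\<psi> x)\<^sup>2 \<partial>lborel)"
    unfolding A_def by (intro nn_integral_eq_integral) (auto simp: gauss_nonneg)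
  have "AE x in lborel. norm (gauss x * (g\<psi> x \<bullet> g\<psi> x)) \<le> norm (gauss x * L\<^sup>2)"
    using AE_lborel_nonzero
  proof eventually_elim
    fix x :: 'a assume "x \<noteq> 0"
    have "norm (g\<psi> x) * norm (g\<psi> x) \<le> L * norm (g\<psi> x)"
      using lipschitz_gradient_bound[OF \<psi> D\<psi>[OF \<open>x \<noteq> 0\<close>], of "g\<psi> x"]
      by (simp add: dot_square_norm power2_eq_square)
    then have "norm (g\<psi> x) \<le> L"
      using lipschitz_on_nonneg[OF \<psi>] by (cases "g\<psi> x = 0") auto
    then have "(norm (g\<psi> x))\<^sup>2 \<le> L\<^sup>2" by (intro power_mono) auto
    then show "norm (gauss x * (g\<psi> x \<bullet> g\<psi> x)) \<le> norm (gauss x * L\<^sup>2)"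
      by (simp add: abs_mult gauss_nonneg dot_square_norm mult_left_mono)
  qed
  then have "integrable lborel (\<lambda>x. gauss x * (g\<psi> x \<bullet> g\<psi> x))"
  proof (rule Bochner_Integration.integrable_bound[rotated 2])
    show "integrable lborel (\<lambda>x :: 'a. gauss x * L\<^sup>2)" using intZ by (rule integrable_mult_left)
  qed measurable
  then have B: "B = ennreal (\<integral>x. gauss x * (g\<psi> x \<bullet> g\<psi> x) \<partial>lborel)"
    unfolding B_def by (intro nn_integral_eq_integral) (auto simp: gauss_nonneg)
  show ?thesis
    using AB unfolding A B by (subst (asm) ennreal_le_iff) (auto intro!: integral_nonneg_AE simp: gauss_nonneg)
qed

section \<open>Functions homogeneous of degree 0\<close>

definition outer :: "real^'n \<Rightarrow> real^'n \<Rightarrow> real^'n^'n" where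
  "outer a b = (\<chi> i j. a $ i * b $ j)"

lemma outer_mult_vec: "outer a b *v h = (b \<bullet> h) *\<^sub>R a"
  by (simp add: vec_eq_iff outer_def matrix_vector_mult_def inner_vec_def sum_distrib_left mult_ac)

lemma trace_outer: "trace (outer a b) = a \<bullet> b"
  by (simp add: trace_def outer_def inner_vec_def)

lemma trace_scaleR: "trace (c *\<^sub>R A) = c * trace A" for A :: "real^'n^'n"
  by (simp add: trace_def sum_distrib_left)

lemma matrix_norm_square: "(norm A)\<^sup>2 = (\<Sum>i\<in>UNIV. \<Sum>j\<in>UNIV. (A $ i $ j)\<^sup>2)" for A :: "real^'n^'m"
  unfolding power2_norm_eq_inner by (simp add: inner_vec_def power2_eq_square)

lemma norm_outer: "norm (outer a b) = norm a * norm b"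
proof -
  have "(norm (outer a b))\<^sup>2 = (\<Sum>i\<in>UNIV. (a $ i)\<^sup>2) * (\<Sum>j\<in>UNIV. (b $ j)\<^sup>2)"
    by (simp add: matrix_norm_square outer_def power_mult_distrib sum_product)
  also have "\<dots> = (norm a * norm b)\<^sup>2"
    unfolding power_mult_distrib power2_norm_eq_inner by (simp add: inner_vec_def power2_eq_square)
  finally show ?thesis by (simp add: power2_eq_iff_nonneg)
qed

lemma continuous_outer [continuous_intros]:
  "continuous_on X f \<Longrightarrow> continuous_on X g \<Longrightarrow> continuous_on X (\<lambda>x. outer (f x) (g x))"
  unfolding outer_def by (intro continuous_intros)

lemma inner_matrix_vector: "x \<bullet> (A *v y) = (x v* A) \<bullet> y" for A :: "real^'n^'m"
  by (metis dot_lmul_matrix)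

text \<open>The mixed second difference is the increment in direction a of an increment of F in
  direction b. The mean value theorem handles direction a; the resulting increment of G is compared
  with that of its linear part M at x, which is the source of the error e.\<close>

lemma second_difference_estimate:
  fixes F :: "'a::real_inner \<Rightarrow> real"
  assumes D: "\<And>y. dist y x < r \<Longrightarrow> (F has_derivative (\<lambda>h. G y \<bullet> h)) (at y)"
    and G: "\<And>k. norm k < r \<Longrightarrow> norm (G (x + k) - G x - M k) \<le> e * norm k"
    and M: "linear M" and s: "s > 0" "s * (norm a + norm b) < r" and e: "e \<ge> 0"
  shows "\<bar>F (x + s *\<^sub>R a + s *\<^sub>R b) - F (x + s *\<^sub>R a) - F (x + s *\<^sub>R b) + F x - s\<^sup>2 * (M b \<bullet> a)\<bar>
    \<le> 2 * e * s\<^sup>2 * (norm a + norm b)\<^sup>2"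
proof -
  define \<phi> where "\<phi> t = F (x + s *\<^sub>R b + (t * s) *\<^sub>R a) - F (x + (t * s) *\<^sub>R a)" for t
  have small: "norm ((t * s) *\<^sub>R a) \<le> s * norm a" "norm (s *\<^sub>R b + (t * s) *\<^sub>R a) \<le> s * (norm a + norm b)"
    "norm ((t * s) *\<^sub>R a) < r" "norm (s *\<^sub>R b + (t * s) *\<^sub>R a) < r"
    if "0 \<le> t" "t \<le> 1" for t
  proof -
    show 1: "norm ((t * s) *\<^sub>R a) \<le> s * norm a"
      using that s(1) by (simp add: mult_left_le_one_le mult.assoc)
    then show 2: "norm (s *\<^sub>R b + (t * s) *\<^sub>R a) \<le> s * (norm a + norm b)"
      using norm_triangle_ineq[of "s *\<^sub>R b" "(t * s) *\<^sub>R a"] s(1) by (simp add: algebra_simps)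
    show "norm (s *\<^sub>R b + (t * s) *\<^sub>R a) < r" using 2 s(2) by linarith
    have "0 \<le> s * norm b" using s(1) by simp
    then show "norm ((t * s) *\<^sub>R a) < r" using 1 s(2) by (simp only: distrib_left)
  qed
  have "(\<phi> has_real_derivative
      s * ((G (x + s *\<^sub>R b + (t * s) *\<^sub>R a) - G (x + (t * s) *\<^sub>R a)) \<bullet> a)) (at t)"
    if t: "0 \<le> t" "t \<le> 1" for t
  proof -
    have D1: "((\<lambda>t. z + (t * s) *\<^sub>R a) has_derivative (\<lambda>h. (h * s) *\<^sub>R a)) (at t)" for z
      by (auto intro!: derivative_eq_intros)
    have "((\<lambda>t. F (x + s *\<^sub>R b + (t * s) *\<^sub>R a)) has_derivative
        (\<lambda>h. G (x + s *\<^sub>R b + (t * s) *\<^sub>R a) \<bullet> ((h * s) *\<^sub>R a))) (at t)"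
      using small(4)[OF t] by (intro has_derivative_compose[OF D1 D]) (simp add: dist_norm add.assoc)
    moreover have "((\<lambda>t. F (x + (t * s) *\<^sub>R a)) has_derivative
        (\<lambda>h. G (x + (t * s) *\<^sub>R a) \<bullet> ((h * s) *\<^sub>R a))) (at t)"
      using small(3)[OF t] by (intro has_derivative_compose[OF D1 D]) (simp add: dist_norm)
    ultimately have "(\<phi> has_derivative (\<lambda>h. G (x + s *\<^sub>R b + (t * s) *\<^sub>R a) \<bullet> ((h * s) *\<^sub>R a) -
        G (x + (t * s) *\<^sub>R a) \<bullet> ((h * s) *\<^sub>R a))) (at t)"
      unfolding \<phi>_def by (rule has_derivative_diff)
    then show ?thesis
      unfolding has_field_derivative_def
      by (rule has_derivative_eq_rhs) (auto simp: fun_eq_iff inner_diff_left algebra_simps)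
  qed
  then obtain t where t: "0 < t" "t < 1"
    "\<phi> 1 - \<phi> 0 = (1 - 0) * (s * ((G (x + s *\<^sub>R b + (t * s) *\<^sub>R a) - G (x + (t * s) *\<^sub>R a)) \<bullet> a))"
    using MVT2[of 0 1 \<phi> "\<lambda>t. s * ((G (x + s *\<^sub>R b + (t * s) *\<^sub>R a) - G (x + (t * s) *\<^sub>R a)) \<bullet> a)"]
    by auto
  define k1 where "k1 = s *\<^sub>R b + (t * s) *\<^sub>R a"
  define k2 where "k2 = (t * s) *\<^sub>R a"
  define R1 where "R1 = G (x + k1) - G x - M k1"
  define R2 where "R2 = G (x + k2) - G x - M k2"
  have R1: "norm R1 \<le> e * (s * (norm a + norm b))"
    unfolding R1_def using G[of k1] small[of t] t e
    by (auto simp: k1_def intro: order_trans mult_left_mono)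
  have "norm R2 \<le> e * (s * norm a)"
    unfolding R2_def using G[of k2] small[of t] t e
    by (auto simp: k2_def intro: order_trans mult_left_mono)
  also have "\<dots> \<le> e * (s * (norm a + norm b))" using e s(1) by (intro mult_left_mono) auto
  finally have R2: "norm R2 \<le> e * (s * (norm a + norm b))" .
  have "M k1 - M k2 = s *\<^sub>R M b"
    using linear_diff[OF M, of k1 k2] linear_scale[OF M, of s b] by (simp add: k1_def k2_def)
  then have "G (x + k1) - G (x + k2) = s *\<^sub>R M b + (R1 - R2)" by (simp add: R1_def R2_def algebra_simps)
  moreover have "\<phi> 1 - \<phi> 0 = s * ((G (x + k1) - G (x + k2)) \<bullet> a)"
    using t(3) by (simp add: k1_def k2_def add.assoc)
  ultimately have "\<phi> 1 - \<phi> 0 = s\<^sup>2 * (M b \<bullet> a) + s * ((R1 - R2) \<bullet> a)"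
    by (simp add: inner_add_left power2_eq_square distrib_left)
  moreover have "\<phi> 1 - \<phi> 0 = F (x + s *\<^sub>R a + s *\<^sub>R b) - F (x + s *\<^sub>R a) - F (x + s *\<^sub>R b) + F x"
    by (simp add: \<phi>_def add_ac)
  ultimately have "\<bar>F (x + s *\<^sub>R a + s *\<^sub>R b) - F (x + s *\<^sub>R a) - F (x + s *\<^sub>R b) + F x - s\<^sup>2 * (M b \<bullet> a)\<bar>
      = s * \<bar>(R1 - R2) \<bullet> a\<bar>" using s(1) by (simp add: abs_mult)
  also have "\<dots> \<le> s * ((2 * (e * (s * (norm a + norm b)))) * (norm a + norm b))"
  proof (rule mult_left_mono)
    have "\<bar>(R1 - R2) \<bullet> a\<bar> \<le> norm (R1 - R2) * norm a" by (rule Cauchy_Schwarz_ineq2)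
    also have "\<dots> \<le> (2 * (e * (s * (norm a + norm b)))) * (norm a + norm b)"
      using norm_triangle_ineq4[of R1 R2] R1 R2 e s(1) by (intro mult_mono mult_nonneg_nonneg) auto
    finally show "\<bar>(R1 - R2) \<bullet> a\<bar> \<le> (2 * (e * (s * (norm a + norm b)))) * (norm a + norm b)" .
  qed (use s in simp)
  finally show ?thesis by (simp add: power2_eq_square mult_ac)
qed

text \<open>The mixed second difference is symmetric in a and b, and divided by s^2 it is
  arbitrarily close both to \<open>M b \<bullet> a\<close> and to
  \<open>M a \<bullet> b\<close>.\<close>

lemma second_derivative_symmetric:
  fixes F :: "'a::real_inner \<Rightarrow> real"
  assumes r: "r > 0" and D: "\<And>y. dist y x < r \<Longrightarrow> (F has_derivative (\<lambda>h. G y \<bullet> h)) (at y)"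
    and DG: "(G has_derivative M) (at x)"
  shows "M b \<bullet> a = M a \<bullet> b"
proof -
  define c where "c = norm a + norm b"
  have lin: "linear M" by (rule has_derivative_linear[OF DG])
  have "\<bar>M b \<bullet> a - M a \<bullet> b\<bar> \<le> 0 + e" if e: "e > 0" for e
  proof -
    \<comment> \<open>Two estimates of size 2 e' s^2 c^2 will be added; c^2 + 1 instead of c^2 keeps
      the denominator positive when a = b = 0.\<close>
    define e' where "e' = e / (4 * (c\<^sup>2 + 1))"
    have c1: "c\<^sup>2 + 1 > 0" by (smt (verit) zero_le_power2)
    have e': "e' > 0" using e c1 by (simp add: e'_def)
    from DG[unfolded has_derivative_at_alt] e' obtain d where d: "d > 0"
      "\<And>y. norm (y - x) < d \<Longrightarrow> norm (G y - G x - M (y - x)) \<le> e' * norm (y - x)" by blast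
    define r' where "r' = min r d"
    have r': "r' > 0" "r' \<le> r" "r' \<le> d" using r d by (auto simp: r'_def)
    define s where "s = r' / (2 * (c + 1))"
    have c: "c \<ge> 0" by (simp add: c_def)
    have s: "s > 0" using r' c by (simp add: s_def)
    have "s * c \<le> s * (c + 1)" using s by simp
    also have "\<dots> = r' / 2" using c by (simp add: s_def divide_simps)
    finally have sc: "s * c < r'" using r' by simp
    have G: "norm (G (x + k) - G x - M k) \<le> e' * norm k" if "norm k < r'" for k
      using d(2)[of "x + k"] that r' by simp
    have D': "(F has_derivative (\<lambda>h. G y \<bullet> h)) (at y)" if "dist y x < r'" for y
      using D that r' by simp
    note est = second_difference_estimate[of x r' F G M e', OF D' G lin s]
    have "\<bar>F (x + s *\<^sub>R a + s *\<^sub>R b) - F (x + s *\<^sub>R a) - F (x + s *\<^sub>R b) + F x - s\<^sup>2 * (M b \<bullet> a)\<bar>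
        \<le> 2 * e' * s\<^sup>2 * c\<^sup>2"
      using est[of a b] sc e' by (simp add: c_def)
    moreover have "\<bar>F (x + s *\<^sub>R a + s *\<^sub>R b) - F (x + s *\<^sub>R a) - F (x + s *\<^sub>R b) + F x - s\<^sup>2 * (M a \<bullet> b)\<bar>
        \<le> 2 * e' * s\<^sup>2 * c\<^sup>2"
      using est[of b a] sc e' by (simp add: c_def add_ac)
    ultimately have "\<bar>s\<^sup>2 * (M b \<bullet> a) - s\<^sup>2 * (M a \<bullet> b)\<bar> \<le> s\<^sup>2 * (4 * e' * c\<^sup>2)" by (simp add: mult_ac)
    then have "s\<^sup>2 * \<bar>M b \<bullet> a - M a \<bullet> b\<bar> \<le> s\<^sup>2 * (4 * e' * c\<^sup>2)"
      by (simp add: abs_mult flip: right_diff_distrib)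
    then have "\<bar>M b \<bullet> a - M a \<bullet> b\<bar> \<le> 4 * e' * c\<^sup>2" using s by simp
    also have "\<dots> \<le> 4 * e' * (c\<^sup>2 + 1)" using e' by simp
    also have "\<dots> = e" using c1 by (simp add: e'_def divide_simps)
    finally show ?thesis by simp
  qed
  then have "\<bar>M b \<bullet> a - M a \<bullet> b\<bar> \<le> 0" by (rule field_le_epsilon)
  then show ?thesis by simp
qed

text \<open>The gradient is homogeneous of degree 0, hence bounded by a bound B on the sphere.
  Segments avoiding the origin are handled by the mean value inequality. If the segment contains the
  origin, the distance of its ends is |x| + |y|, and |\<psi> x| \<le> B |x| by Euler's relation
  \<psi> x = g x . x.\<close>

lemma homogeneous_lipschitz:
  fixes \<psi> :: "'a::euclidean_space \<Rightarrow> real"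
  assumes hom: "\<And>c x. c > 0 \<Longrightarrow> \<psi> (c *\<^sub>R x) = c * \<psi> x"
    and D: "\<And>x. x \<noteq> 0 \<Longrightarrow> (\<psi> has_derivative (\<lambda>h. g x \<bullet> h)) (at x)"
    and cont: "continuous_on (- {0}) g"
  obtains L where "L-lipschitz_on UNIV \<psi>"
proof -
  have ghom: "g (c *\<^sub>R x) = g x" if "c > 0" "x \<noteq> 0" for c x
  proof -
    have "((\<lambda>y. c *\<^sub>R y) has_derivative (\<lambda>h. c *\<^sub>R h)) (at x)" by (auto intro!: derivative_eq_intros)
    moreover have "(\<psi> has_derivative (\<lambda>h. g (c *\<^sub>R x) \<bullet> h)) (at (c *\<^sub>R x))" using D that by simp
    ultimately have "((\<lambda>y. \<psi> (c *\<^sub>R y)) has_derivative (\<lambda>h. g (c *\<^sub>R x) \<bullet> (c *\<^sub>R h))) (at x)"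
      by (rule has_derivative_compose)
    moreover have "((\<lambda>y. \<psi> (c *\<^sub>R y)) has_derivative (\<lambda>h. c * (g x \<bullet> h))) (at x)"
      unfolding hom[OF that(1)] by (rule has_derivative_mult_right[OF D[OF that(2)]])
    ultimately have "(\<lambda>h. g (c *\<^sub>R x) \<bullet> (c *\<^sub>R h)) = (\<lambda>h. c * (g x \<bullet> h))"
      by (rule has_derivative_unique)
    note eq = this
    have "g (c *\<^sub>R x) \<bullet> h = g x \<bullet> h" for h
      using fun_cong[OF eq, of h] that(1) by simp
    then show ?thesis using vector_eq_rdot by blast
  qed
  have "bounded (g ` sphere 0 1)"
    by (intro compact_imp_bounded compact_continuous_image continuous_on_subset[OF cont]) auto
  then obtain B where "\<forall>y\<in>g ` sphere 0 1. norm y \<le> B"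
    unfolding bounded_iff by blast
  then have gB: "norm (g x) \<le> B" if "x \<noteq> 0" for x
  proof -
    have "inverse (norm x) *\<^sub>R x \<in> sphere 0 1" using that by simp
    then have "norm (g (inverse (norm x) *\<^sub>R x)) \<le> B" using \<open>\<forall>y\<in>g ` sphere 0 1. norm y \<le> B\<close> by blast
    then show ?thesis using ghom[of "inverse (norm x)" x] that by simp
  qed
  obtain x0 :: 'a where "x0 \<in> Basis" using nonempty_Basis by blast
  then have B0: "B \<ge> 0" using order_trans[OF norm_ge_zero gB[of x0]] nonzero_Basis by blast
  have \<psi>0: "\<psi> 0 = 0" using hom[of 2 0] by simp
  have \<psi>B: "\<bar>\<psi> x\<bar> \<le> B * norm x" for x
  proof (cases "x = 0")
    case False
    have "((\<lambda>t. \<psi> (t *\<^sub>R x)) has_derivative (\<lambda>t. g (1 *\<^sub>R x) \<bullet> (t *\<^sub>R x))) (at 1)"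
    proof (rule has_derivative_compose[of "\<lambda>t. t *\<^sub>R x" "\<lambda>t. t *\<^sub>R x" 1 UNIV \<psi>])
      show "((\<lambda>t. t *\<^sub>R x) has_derivative (\<lambda>t. t *\<^sub>R x)) (at 1)" by (auto intro!: derivative_eq_intros)
      show "(\<psi> has_derivative (\<bullet>) (g (1 *\<^sub>R x))) (at (1 *\<^sub>R x))" using D[OF False] by simp
    qed
    moreover have "((\<lambda>t. \<psi> (t *\<^sub>R x)) has_derivative (\<lambda>t. t * \<psi> x)) (at 1)"
    proof (rule has_derivative_transform_within_open[of "\<lambda>t. t * \<psi> x" _ _ _ "{0<..}"])
      show "((\<lambda>t. t * \<psi> x) has_derivative (\<lambda>t. t * \<psi> x)) (at 1)" by (auto intro!: derivative_eq_intros)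
    qed (use hom in auto)
    ultimately have "(\<lambda>t. g (1 *\<^sub>R x) \<bullet> (t *\<^sub>R x)) = (\<lambda>t. t * \<psi> x)" by (rule has_derivative_unique)
    then have "\<psi> x = g x \<bullet> x" by (metis mult_1 scaleR_one)
    then show ?thesis
      using Cauchy_Schwarz_ineq2[of "g x" x] gB[OF False] mult_right_mono[of "norm (g x)" B "norm x"] by simp
  qed (simp add: \<psi>0)
  have "B-lipschitz_on UNIV \<psi>"
  proof (rule lipschitz_onI)
    fix x y
    show "dist (\<psi> x) (\<psi> y) \<le> B * dist x y"
    proof (cases "0 \<in> closed_segment x y")
      case True
      then have "dist x y = norm x + norm y"
        using between_mem_segment[of x y 0] between[of x y 0] by simp
      then show ?thesis
        using \<psi>B[of x] \<psi>B[of y] by (simp add: dist_real_def distrib_left)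
    next
      case False
      have "norm (\<psi> x - \<psi> y) \<le> B * norm (x - y)"
      proof (rule differentiable_bound[of "closed_segment x y" \<psi> "\<lambda>z h. g z \<bullet> h"])
        fix z assume z: "z \<in> closed_segment x y"
        then have "z \<noteq> 0" using False by auto
        then show "(\<psi> has_derivative (\<lambda>h. g z \<bullet> h)) (at z within closed_segment x y)"
          by (rule has_derivative_at_withinI[OF D])
        have "norm (g z \<bullet> h) \<le> B * norm h" for h
          by (rule order_trans[OF _ mult_right_mono[OF gB[OF \<open>z \<noteq> 0\<close>] norm_ge_zero]])
            (simp add: Cauchy_Schwarz_ineq2)
        then show "onorm (\<lambda>h. g z \<bullet> h) \<le> B" by (rule onorm_le)
      qed auto
      then show ?thesis by (simp add: dist_norm)
    qed
  qed (rule B0)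
  then show ?thesis by (rule that)
qed

lemma has_derivative_scale_arg:
  assumes "(f has_derivative f') (at (c *\<^sub>R x))"
  shows "((\<lambda>y. f (c *\<^sub>R y)) has_derivative (\<lambda>h. f' (c *\<^sub>R h))) (at x)"
proof -
  have "((\<lambda>y. c *\<^sub>R y) has_derivative (\<lambda>h. c *\<^sub>R h)) (at x)" by (auto intro!: derivative_eq_intros)
  from has_derivative_compose[OF this assms] show ?thesis .
qed

lemma has_derivative_radial:
  fixes x :: "'a::real_normed_vector"
  assumes "(f has_derivative f') (at x)"
  shows "((\<lambda>t. f (t *\<^sub>R x)) has_derivative (\<lambda>t. f' (t *\<^sub>R x))) (at 1)"
proof -
  have "((\<lambda>t. t *\<^sub>R x) has_derivative (\<lambda>t. t *\<^sub>R x)) (at 1)" by (auto intro!: derivative_eq_intros)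
  moreover have "(f has_derivative f') (at (1 *\<^sub>R x))" using assms by simp
  ultimately show ?thesis by (rule has_derivative_compose)
qed

lemma homogeneous_bounded:
  fixes f :: "'a::euclidean_space \<Rightarrow> 'b::real_normed_vector"
  assumes hom: "\<And>c x. c > 0 \<Longrightarrow> f (c *\<^sub>R x) = f x" and cont: "continuous_on (- {0}) f"
  obtains K where "K \<ge> 0" "\<And>x. norm (f x) \<le> K"
proof -
  have "bounded (f ` sphere 0 1)"
    by (intro compact_imp_bounded compact_continuous_image continuous_on_subset[OF cont]) auto
  then obtain B where B: "\<forall>y\<in>f ` sphere 0 1. norm y \<le> B" unfolding bounded_iff by blast
  have "norm (f x) \<le> max B (norm (f 0))" for x
  proof (cases "x = 0")
    case False
    then have "inverse (norm x) *\<^sub>R x \<in> sphere 0 1" by simp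
    then have "norm (f (inverse (norm x) *\<^sub>R x)) \<le> B" using B by blast
    then show ?thesis using hom[of "inverse (norm x)" x] False by simp
  qed simp
  then show ?thesis using that[of "max B (norm (f 0))"] by (meson max.coboundedI2 norm_ge_zero)
qed

text \<open>Gradient and Hessian are parameters of their own, so that they can be instantiated both
  with \<open>gradient\<close> and \<open>hessian\<close> and, for the ball, with 0. Nothing is
  required of them at the origin, which no integral sees.\<close>

locale zero_homogeneous =
  fixes \<Phi> :: "real^'n \<Rightarrow> real" and g :: "real^'n \<Rightarrow> real^'n" and H :: "real^'n \<Rightarrow> real^'n^'n"
  assumes hom: "\<And>c x. c > 0 \<Longrightarrow> \<Phi> (c *\<^sub>R x) = \<Phi> x"
    and D_\<Phi>: "\<And>x. x \<noteq> 0 \<Longrightarrow> (\<Phi> has_derivative (\<lambda>h. g x \<bullet> h)) (at x)"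
    and D_g: "\<And>x. x \<noteq> 0 \<Longrightarrow> (g has_derivative (\<lambda>h. H x *v h)) (at x)"
    and cont_H: "continuous_on (- {0}) H"
begin

text \<open>Differentiate \<Phi> (c x) = \<Phi> x: the gradient has degree -1. The same argument
  applied to g gives degree -2 for the Hessian.\<close>

lemma g_hom:
  assumes "c > 0" "x \<noteq> 0"
  shows "c *\<^sub>R g (c *\<^sub>R x) = g x"
proof -
  have "((\<lambda>y. \<Phi> (c *\<^sub>R y)) has_derivative (\<lambda>h. g (c *\<^sub>R x) \<bullet> (c *\<^sub>R h))) (at x)"
    using assms by (intro has_derivative_scale_arg D_\<Phi>) simp
  then have "(\<Phi> has_derivative (\<lambda>h. g (c *\<^sub>R x) \<bullet> (c *\<^sub>R h))) (at x)"
    unfolding hom[OF assms(1)] .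
  note eq = has_derivative_unique[OF this D_\<Phi>[OF assms(2)]]
  have "(c *\<^sub>R g (c *\<^sub>R x)) \<bullet> h = g x \<bullet> h" for h
    using fun_cong[OF eq, of h] by simp
  then show ?thesis using vector_eq_rdot by blast
qed

lemma g_radial:
  assumes "x \<noteq> 0"
  shows "g x \<bullet> x = 0"
proof -
  have "((\<lambda>t. \<Phi> (t *\<^sub>R x)) has_derivative (\<lambda>t. 0)) (at 1)"
    by (rule has_derivative_transform_within_open[of "\<lambda>t. \<Phi> x" _ _ _ "{0<..}"]) (auto simp: hom)
  from has_derivative_unique[OF has_derivative_radial[OF D_\<Phi>[OF assms]] this]
  show ?thesis by (metis scaleR_one)
qed

lemma H_hom:
  assumes "c > 0" "x \<noteq> 0"
  shows "(c * c) *\<^sub>R H (c *\<^sub>R x) = H x"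
proof -
  have "((\<lambda>y. c *\<^sub>R g (c *\<^sub>R y)) has_derivative (\<lambda>h. c *\<^sub>R (H (c *\<^sub>R x) *v (c *\<^sub>R h)))) (at x)"
    using assms by (intro has_derivative_scaleR_right has_derivative_scale_arg D_g) simp
  moreover have "((\<lambda>y. c *\<^sub>R g (c *\<^sub>R y)) has_derivative (\<lambda>h. H x *v h)) (at x)"
    by (rule has_derivative_transform_within_open[OF D_g[OF assms(2)], of "- {0}"])
       (use assms g_hom in auto)
  ultimately have eq: "(\<lambda>h. c *\<^sub>R (H (c *\<^sub>R x) *v (c *\<^sub>R h))) = (\<lambda>h. H x *v h)"
    by (rule has_derivative_unique)
  have "((c * c) *\<^sub>R H (c *\<^sub>R x)) *v h = H x *v h" for h
    using fun_cong[OF eq, of h]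
    by (simp add: matrix_vector_mult_scaleR scaleR_matrix_vector_assoc[symmetric])
  then show ?thesis by (simp add: matrix_eq)
qed

text \<open>Euler's relation for g, which has degree -1.\<close>

lemma H_radial:
  assumes "x \<noteq> 0"
  shows "H x *v x = - g x"
proof -
  have "((\<lambda>t. g (t *\<^sub>R x)) has_derivative (\<lambda>t. - t *\<^sub>R g x)) (at 1)"
  proof (rule has_derivative_transform_within_open[of "\<lambda>t. inverse t *\<^sub>R g x" _ _ _ "{0<..}"])
    show "((\<lambda>t. inverse t *\<^sub>R g x) has_derivative (\<lambda>t. - t *\<^sub>R g x)) (at 1)"
      by (auto intro!: derivative_eq_intros)
    fix t :: real assume "t \<in> {0<..}"
    then show "inverse t *\<^sub>R g x = g (t *\<^sub>R x)"
      using g_hom[of t x] assms by (metis greaterThan_iff less_irrefl scaleR_left_imp_eq scaleR_scaleR right_inverse scaleR_one)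
  qed auto
  from has_derivative_unique[OF has_derivative_radial[OF D_g[OF assms]] this]
  show ?thesis by (metis scaleR_one scaleR_minus1_left)
qed

text \<open>Obtained by differentiating g y . y = 0, and so independent of the symmetry of H, which
  is established afterwards.\<close>

lemma H_radial_left:
  assumes "x \<noteq> 0"
  shows "x v* H x = - g x"
proof -
  have "((\<lambda>y. g y \<bullet> y) has_derivative (\<lambda>h. g x \<bullet> h + (H x *v h) \<bullet> x)) (at x)"
    by (rule has_derivative_inner[OF D_g[OF assms] has_derivative_ident])
  moreover have "((\<lambda>y. g y \<bullet> y) has_derivative (\<lambda>h. 0)) (at x)"
    by (rule has_derivative_transform_within_open[of "\<lambda>_. 0" _ _ _ "- {0}"])
       (use assms g_radial in auto)
  ultimately have eq: "(\<lambda>h. g x \<bullet> h + (H x *v h) \<bullet> x) = (\<lambda>h. 0)"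
    by (rule has_derivative_unique)
  have "(x v* H x) \<bullet> h = (- g x) \<bullet> h" for h
    using fun_cong[OF eq, of h] inner_matrix_vector[of x "H x" h] by (simp add: inner_commute)
  then show ?thesis using vector_eq_rdot by blast
qed

lemma H_sym:
  assumes "x \<noteq> 0"
  shows "H x $ i $ j = H x $ j $ i"
proof -
  have "(H x *v axis j 1) \<bullet> axis i 1 = (H x *v axis i 1) \<bullet> axis j 1"
  proof (rule second_derivative_symmetric[of "norm x"])
    show "(\<Phi> has_derivative (\<lambda>h. g y \<bullet> h)) (at y)" if "dist y x < norm x" for y
      using that by (intro D_\<Phi>) auto
  qed (use assms D_g in auto)
  then show ?thesis by (simp add: matrix_vector_mult_basis inner_axis column_def)
qed

lemma cont_\<Phi>: "continuous_on (- {0}) \<Phi>"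
  by (auto intro!: continuous_at_imp_continuous_on has_derivative_continuous[OF D_\<Phi>])

lemma cont_g: "continuous_on (- {0}) g"
  by (auto intro!: continuous_at_imp_continuous_on has_derivative_continuous[OF D_g])

text \<open>Gradient and Hessian of \<open>\<lambda>x. (x \<bullet> x) * \<Phi> x\<close>, which is homogeneous of degree 2.\<close>

definition G2 :: "real^'n \<Rightarrow> real^'n" where
  "G2 x = (2 * \<Phi> x) *\<^sub>R x + (x \<bullet> x) *\<^sub>R g x"

definition M2 :: "real^'n \<Rightarrow> real^'n^'n" where
  "M2 x = (2 * \<Phi> x) *\<^sub>R mat 1 + 2 *\<^sub>R outer x (g x) + 2 *\<^sub>R outer (g x) x + (x \<bullet> x) *\<^sub>R H x"

lemma D_G2:
  assumes "x \<noteq> 0"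
  shows "(G2 has_derivative (\<lambda>h. M2 x *v h)) (at x)"
proof -
  have "(G2 has_derivative (\<lambda>h. (2 * \<Phi> x) *\<^sub>R h + (2 * (g x \<bullet> h)) *\<^sub>R x +
      ((x \<bullet> x) *\<^sub>R (H x *v h) + (x \<bullet> h + h \<bullet> x) *\<^sub>R g x))) (at x)"
    unfolding G2_def[abs_def]
    by (intro has_derivative_add has_derivative_scaleR has_derivative_mult_right D_\<Phi> D_g
        has_derivative_inner has_derivative_ident assms)
  then show ?thesis
    by (rule has_derivative_eq_rhs)
       (auto simp: fun_eq_iff M2_def matrix_vector_mult_add_rdistrib outer_mult_vec
          scaleR_matrix_vector_assoc[symmetric] inner_commute algebra_simps simp flip: scaleR_2)
qed

lemma D_G2_component:
  assumes "x \<noteq> 0"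
  shows "((\<lambda>x. G2 x $ i) has_derivative (\<lambda>h. M2 x $ i \<bullet> h)) (at x)"
  using bounded_linear.has_derivative[OF bounded_linear_vec_nth D_G2[OF assms], of i]
  by (simp add: matrix_vector_mul_component)

lemma G2_hom: "c > 0 \<Longrightarrow> G2 (c *\<^sub>R x) = c *\<^sub>R G2 x"
  using g_hom[of c x, symmetric] hom[of c x]
  by (cases "x = 0") (auto simp: G2_def scaleR_add_right mult_ac)

lemma M2_hom: "c > 0 \<Longrightarrow> M2 (c *\<^sub>R x) = M2 x"
proof (cases "x = 0")
  case False
  assume c: "c > 0"
  have "outer (c *\<^sub>R x) (g (c *\<^sub>R x)) = outer x (c *\<^sub>R g (c *\<^sub>R x))"
    "outer (g (c *\<^sub>R x)) (c *\<^sub>R x) = outer (c *\<^sub>R g (c *\<^sub>R x)) x"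
    by (simp_all add: outer_def vec_eq_iff)
  then show ?thesis
    using g_hom[OF c False] H_hom[OF c False] hom[OF c]
    by (simp add: M2_def mult_ac) (metis mult.commute scaleR_scaleR)
qed simp

lemma M2_sym: "x \<noteq> 0 \<Longrightarrow> M2 x $ i $ j = M2 x $ j $ i"
  using H_sym[of x i j] by (simp add: M2_def outer_def mat_def mult.commute)

text \<open>Euler's relation for \<open>G2\<close>, which has degree 1. In the Bochner identity it
  turns the term coming from the derivative of the weight into |G2|^2.\<close>

lemma M2_radial:
  assumes "x \<noteq> 0"
  shows "M2 x *v x = G2 x"
  using assms
  by (simp add: M2_def G2_def matrix_vector_mult_add_rdistrib outer_mult_vec H_radial g_radial
      scaleR_matrix_vector_assoc[symmetric])
     (simp add: vec_eq_iff algebra_simps)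

lemma M2_radial_left:
  assumes "x \<noteq> 0"
  shows "(\<Sum>i\<in>UNIV. x $ i * M2 x $ i $ j) = G2 x $ j"
proof -
  have "(\<Sum>i\<in>UNIV. x $ i * M2 x $ i $ j) = (M2 x *v x) $ j"
    using M2_sym[OF assms] by (simp add: matrix_vector_mult_def mult.commute)
  then show ?thesis by (simp add: M2_radial assms)
qed

lemma G2_inner: "x \<noteq> 0 \<Longrightarrow> x \<bullet> G2 x = 2 * (x \<bullet> x) * \<Phi> x"
  using g_radial[of x] by (simp add: G2_def inner_add_right inner_commute)

lemma G2_square:
  assumes "x \<noteq> 0"
  shows "G2 x \<bullet> G2 x = (x \<bullet> x) * (4 * (\<Phi> x)\<^sup>2 + (x \<bullet> x) * (g x \<bullet> g x))"
  using g_radial[OF assms]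
  by (simp add: G2_def inner_add_right inner_add_left inner_commute power2_eq_square algebra_simps)

lemma cont_M2: "continuous_on (- {0}) M2"
  unfolding M2_def[abs_def] by (intro continuous_intros cont_\<Phi> cont_g cont_H)

lemma meas [measurable]: "\<Phi> \<in> borel_measurable borel" "g \<in> borel_measurable borel" "M2 \<in> borel_measurable borel"
  by (rule borel_measurable_continuous_countable_exceptions[of "{0}"]; simp add: cont_\<Phi> cont_g cont_M2)+

lemma M2_nth_meas [measurable]: "(\<lambda>x. M2 x $ i) \<in> borel_measurable borel"
  by (rule measurable_compose[OF meas(3)]) (intro borel_measurable_continuous_onI continuous_intros)

lemma M2_nth_nth_meas [measurable]: "(\<lambda>x. M2 x $ i $ j) \<in> borel_measurable borel"
  by (rule measurable_compose[OF M2_nth_meas]) (intro borel_measurable_continuous_onI continuous_intros)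

lemma trace_meas [measurable]: "(\<lambda>x. trace (M2 x)) \<in> borel_measurable borel"
  unfolding trace_def by (intro borel_measurable_sum M2_nth_nth_meas)

lemma G2_meas [measurable]: "G2 \<in> borel_measurable borel"
  unfolding G2_def[abs_def] by measurable

text \<open>Degree 1 is the reason for the factor |x|^2 in front of \<Phi>: the components of the
  gradient belong to the Lipschitz class for which commutation and the Poincare inequality are
  proved.\<close>

lemma G2_lipschitz: obtains L where "L-lipschitz_on UNIV (\<lambda>x. G2 x $ i)"
  by (rule homogeneous_lipschitz[of "\<lambda>x. G2 x $ i" "\<lambda>x. M2 x $ i"])
     (auto simp: G2_hom D_G2_component intro!: continuous_intros cont_M2)

lemma G2_nth_meas [measurable]: "(\<lambda>x. G2 x $ i) \<in> borel_measurable borel"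
  by (rule measurable_compose[OF G2_meas]) (intro borel_measurable_continuous_onI continuous_intros)

lemma M2_bounded: obtains K where "K \<ge> 0" "\<And>x. norm (M2 x) \<le> K"
  using homogeneous_bounded[of M2, OF M2_hom cont_M2] by blast

lemma \<Phi>_bounded: obtains K where "K \<ge> 0" "\<And>x. \<bar>\<Phi> x\<bar> \<le> K"
  using homogeneous_bounded[of \<Phi>, OF hom cont_\<Phi>] unfolding real_norm_def by blast

lemma g_square_hom: "c > 0 \<Longrightarrow> ((c *\<^sub>R x) \<bullet> (c *\<^sub>R x)) * (g (c *\<^sub>R x) \<bullet> g (c *\<^sub>R x)) = (x \<bullet> x) * (g x \<bullet> g x)"
  using g_hom[of c x, symmetric] by (cases "x = 0") (auto simp: mult_ac)

lemma g_square_bounded: obtains K where "K \<ge> 0" "\<And>x. \<bar>(x \<bullet> x) * (g x \<bullet> g x)\<bar> \<le> K"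
proof -
  have "continuous_on (- {0}) (\<lambda>x. (x \<bullet> x) * (g x \<bullet> g x))"
    by (intro continuous_intros cont_g)
  from homogeneous_bounded[of "\<lambda>x. (x \<bullet> x) * (g x \<bullet> g x)", OF g_square_hom this]
  show ?thesis using that unfolding real_norm_def by blast
qed

lemma trace_bounded: obtains K where "K \<ge> 0" "\<And>x. \<bar>trace (M2 x)\<bar> \<le> K"
proof -
  have "continuous_on (- {0}) (\<lambda>x. trace (M2 x))"
    unfolding trace_def by (intro continuous_intros cont_M2)
  from homogeneous_bounded[of "\<lambda>x. trace (M2 x)", OF _ this]
  show ?thesis using that M2_hom unfolding real_norm_def by metis
qed

lemma G2_bounded: obtains K where "K \<ge> 0" "\<And>x. norm (G2 x) \<le> K * (1 + norm x)"
proof -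
  obtain K where K: "K \<ge> 0" "\<And>x. norm (M2 x) \<le> K" using M2_bounded by blast
  obtain K1 where K1: "K1 \<ge> 0" "\<And>x. \<bar>\<Phi> x\<bar> \<le> K1" using \<Phi>_bounded by blast
  obtain K2 where K2: "K2 \<ge> 0" "\<And>x. \<bar>(x \<bullet> x) * (g x \<bullet> g x)\<bar> \<le> K2" using g_square_bounded by blast
  have "norm (G2 x) \<le> (2 * K1 + sqrt K2) * (1 + norm x)" for x
  proof -
    have "(norm x * norm (g x))\<^sup>2 \<le> K2"
      using K2(2)[of x] by (simp add: power_mult_distrib dot_square_norm)
    then have "norm x * norm (g x) \<le> sqrt K2" by (rule real_le_rsqrt)
    then have "norm x * (norm x * norm (g x)) \<le> norm x * sqrt K2" by (rule mult_left_mono) simp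
    moreover have "norm (G2 x) \<le> 2 * \<bar>\<Phi> x\<bar> * norm x + norm x * (norm x * norm (g x))"
      unfolding G2_def by (rule order_trans[OF norm_triangle_ineq]) (simp add: dot_square_norm power2_eq_square abs_mult)
    moreover have "2 * \<bar>\<Phi> x\<bar> * norm x \<le> 2 * K1 * norm x"
      using K1(2)[of x] by (intro mult_right_mono) auto
    ultimately have "norm (G2 x) \<le> (2 * K1 + sqrt K2) * norm x" by (simp add: algebra_simps)
    also have "\<dots> \<le> (2 * K1 + sqrt K2) * (1 + norm x)" using K1 K2 by (intro mult_left_mono) auto
    finally show ?thesis .
  qed
  then show ?thesis using that[of "2 * K1 + sqrt K2"] K1 K2 by auto
qed

section \<open>Gaussian integrals of \<Phi>, its gradient and its Hessian\<close>

abbreviation E :: "(real^'n \<Rightarrow> real) \<Rightarrow> real" where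
  "E f \<equiv> (\<integral>x. gauss x * f x \<partial>lborel)"

lemma E_cong:
  assumes "f \<in> borel_measurable borel" "f' \<in> borel_measurable borel" "\<And>x. x \<noteq> 0 \<Longrightarrow> f x = f' x"
  shows "E f = E f'"
proof (rule integral_cong_AE)
  show "AE x in lborel. gauss x * f x = gauss x * f' x"
    using AE_lborel_nonzero by eventually_elim (simp add: assms(3))
qed (use assms in simp_all)

lemma int_0:
  assumes "f \<in> borel_measurable borel" "\<And>x. \<bar>f x\<bar> \<le> K"
  shows "integrable lborel (\<lambda>x. gauss x * f x)"
  using integrable_gauss_poly[of f K 0] assms by simp

lemma int_2:
  fixes f :: "real^'n \<Rightarrow> real"
  assumes [measurable]: "f \<in> borel_measurable borel" and b: "\<And>x. \<bar>f x\<bar> \<le> K"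
  shows "integrable lborel (\<lambda>x. gauss x * ((x \<bullet> x) * f x))"
proof (rule integrable_gauss_poly[where m = 2 and K = K])
  fix x :: "real^'n"
  have "(norm x)\<^sup>2 \<le> (1 + norm x)\<^sup>2" by (intro power_mono) auto
  then show "\<bar>(x \<bullet> x) * f x\<bar> \<le> K * (1 + norm x)\<^sup>2"
    using b[of x] mult_mono[of "(norm x)\<^sup>2" "(1 + norm x)\<^sup>2" "\<bar>f x\<bar>" K]
    by (simp add: abs_mult dot_square_norm mult.commute)
qed measurable

lemma scaling:
  assumes [measurable]: "f \<in> borel_measurable borel" and b: "\<And>x. \<bar>f x\<bar> \<le> K"
    and h: "\<And>c x. c > 0 \<Longrightarrow> f (c *\<^sub>R x) = f x"
  shows "E (\<lambda>x. (x \<bullet> x) * f x) = real CARD('n) * E f"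
  using gauss_homogeneous_scaling[of f K] assms by simp

text \<open>Collects the integrability facts used whenever E is split. Factors of degree 0 are
  bounded; an extra |x|^2 has polynomial growth and, by \<open>scaling\<close>, contributes the
  factor n.\<close>

lemma int_\<Phi>2: "integrable lborel (\<lambda>x. gauss x * (\<Phi> x)\<^sup>2)"
  and int_M: "integrable lborel (\<lambda>x. gauss x * (norm (M2 x))\<^sup>2)"
  and int_t2: "integrable lborel (\<lambda>x. gauss x * (trace (M2 x))\<^sup>2)"
  and int_\<Phi>t: "integrable lborel (\<lambda>x. gauss x * (\<Phi> x * trace (M2 x)))"
  and int_g2: "integrable lborel (\<lambda>x. gauss x * ((x \<bullet> x) * (g x \<bullet> g x)))"
  and int_x\<Phi>2: "integrable lborel (\<lambda>x. gauss x * ((x \<bullet> x) * (\<Phi> x)\<^sup>2))"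
  and int_x\<Phi>t: "integrable lborel (\<lambda>x. gauss x * ((x \<bullet> x) * (\<Phi> x * trace (M2 x))))"
  and int_G: "integrable lborel (\<lambda>x. gauss x * (G2 x \<bullet> G2 x))"
  and E_x\<Phi>2: "E (\<lambda>x. (x \<bullet> x) * (\<Phi> x)\<^sup>2) = real CARD('n) * E (\<lambda>x. (\<Phi> x)\<^sup>2)"
  and E_x\<Phi>t: "E (\<lambda>x. (x \<bullet> x) * (\<Phi> x * trace (M2 x))) = real CARD('n) * E (\<lambda>x. \<Phi> x * trace (M2 x))"
  and E_G: "E (\<lambda>x. G2 x \<bullet> G2 x) = real CARD('n) * (4 * E (\<lambda>x. (\<Phi> x)\<^sup>2) + E (\<lambda>x. (x \<bullet> x) * (g x \<bullet> g x)))"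
proof -
  obtain K where K: "K \<ge> 0" "\<And>x. norm (M2 x) \<le> K" using M2_bounded by blast
  obtain K1 where K1: "K1 \<ge> 0" "\<And>x. \<bar>\<Phi> x\<bar> \<le> K1" using \<Phi>_bounded by blast
  obtain K2 where K2: "K2 \<ge> 0" "\<And>x. \<bar>(x \<bullet> x) * (g x \<bullet> g x)\<bar> \<le> K2" using g_square_bounded by blast
  obtain K3 where K3: "K3 \<ge> 0" "\<And>x. \<bar>trace (M2 x)\<bar> \<le> K3" using trace_bounded by blast
  obtain K4 where K4: "K4 \<ge> 0" "\<And>x. norm (G2 x) \<le> K4 * (1 + norm x)" using G2_bounded by blast
  have b\<Phi>2: "\<bar>(\<Phi> x)\<^sup>2\<bar> \<le> K1\<^sup>2" for x
    using power_mono[OF K1(2)[of x], of 2] by simp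
  have b\<Phi>t: "\<bar>\<Phi> x * trace (M2 x)\<bar> \<le> K1 * K3" for x
    unfolding abs_mult by (intro mult_mono K1 K3) auto
  have tr_hom: "c > 0 \<Longrightarrow> \<Phi> (c *\<^sub>R x) * trace (M2 (c *\<^sub>R x)) = \<Phi> x * trace (M2 x)" for c x
    by (simp add: hom M2_hom)
  show 1: "integrable lborel (\<lambda>x. gauss x * (\<Phi> x)\<^sup>2)"
    by (rule int_0[OF _ b\<Phi>2]) measurable
  show "integrable lborel (\<lambda>x. gauss x * (norm (M2 x))\<^sup>2)"
    using power_mono[OF K(2), of _ 2] by (intro int_0[of _ "K\<^sup>2"]) auto
  show "integrable lborel (\<lambda>x. gauss x * (trace (M2 x))\<^sup>2)"
    using power_mono[OF K3(2), of _ 2] by (intro int_0[of _ "K3\<^sup>2"]) auto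
  show "integrable lborel (\<lambda>x. gauss x * (\<Phi> x * trace (M2 x)))"
    by (rule int_0[OF _ b\<Phi>t]) measurable
  show 2: "integrable lborel (\<lambda>x. gauss x * ((x \<bullet> x) * (g x \<bullet> g x)))"
    by (rule int_0[OF _ K2(2)]) measurable
  show "integrable lborel (\<lambda>x. gauss x * ((x \<bullet> x) * (\<Phi> x)\<^sup>2))"
    by (rule int_2[OF _ b\<Phi>2]) measurable
  show "integrable lborel (\<lambda>x. gauss x * ((x \<bullet> x) * (\<Phi> x * trace (M2 x))))"
    by (rule int_2[OF _ b\<Phi>t]) measurable
  show "integrable lborel (\<lambda>x. gauss x * (G2 x \<bullet> G2 x))"
  proof (rule integrable_gauss_poly[where m = 2 and K = "K4\<^sup>2"])
    show "\<bar>G2 x \<bullet> G2 x\<bar> \<le> K4\<^sup>2 * (1 + norm x)\<^sup>2" for x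
      using power_mono[OF K4(2)[of x], of 2] by (simp add: dot_square_norm power_mult_distrib)
  qed measurable
  show "E (\<lambda>x. (x \<bullet> x) * (\<Phi> x)\<^sup>2) = real CARD('n) * E (\<lambda>x. (\<Phi> x)\<^sup>2)"
    by (rule scaling[OF _ b\<Phi>2]) (auto simp: hom)
  show "E (\<lambda>x. (x \<bullet> x) * (\<Phi> x * trace (M2 x))) = real CARD('n) * E (\<lambda>x. \<Phi> x * trace (M2 x))"
    by (rule scaling[OF _ b\<Phi>t]) (use tr_hom in auto)
  have "E (\<lambda>x. G2 x \<bullet> G2 x) = E (\<lambda>x. (x \<bullet> x) * (4 * (\<Phi> x)\<^sup>2 + (x \<bullet> x) * (g x \<bullet> g x)))"
    by (rule E_cong) (auto simp: G2_square)
  also have "\<dots> = real CARD('n) * E (\<lambda>x. 4 * (\<Phi> x)\<^sup>2 + (x \<bullet> x) * (g x \<bullet> g x))"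
  proof (rule scaling)
    show "\<bar>4 * (\<Phi> x)\<^sup>2 + (x \<bullet> x) * (g x \<bullet> g x)\<bar> \<le> 4 * K1\<^sup>2 + K2" for x
      using b\<Phi>2[of x] K2(2)[of x] by linarith
    show "4 * (\<Phi> (c *\<^sub>R x))\<^sup>2 + ((c *\<^sub>R x) \<bullet> (c *\<^sub>R x)) * (g (c *\<^sub>R x) \<bullet> g (c *\<^sub>R x)) =
        4 * (\<Phi> x)\<^sup>2 + (x \<bullet> x) * (g x \<bullet> g x)" if "c > 0" for c x
      unfolding g_square_hom[OF that] hom[OF that] ..
  qed measurable
  also have "E (\<lambda>x. 4 * (\<Phi> x)\<^sup>2 + (x \<bullet> x) * (g x \<bullet> g x)) =
      (\<integral>x. 4 * (gauss x * (\<Phi> x)\<^sup>2) + gauss x * ((x \<bullet> x) * (g x \<bullet> g x)) \<partial>lborel)"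
    by (intro Bochner_Integration.integral_cong) (auto simp: algebra_simps)
  also have "\<dots> = 4 * E (\<lambda>x. (\<Phi> x)\<^sup>2) + E (\<lambda>x. (x \<bullet> x) * (g x \<bullet> g x))"
    using 1 2 by simp
  finally show "E (\<lambda>x. G2 x \<bullet> G2 x) = real CARD('n) * (4 * E (\<lambda>x. (\<Phi> x)\<^sup>2) + E (\<lambda>x. (x \<bullet> x) * (g x \<bullet> g x)))" .
qed

lemma integrable_components:
  "integrable lborel (\<lambda>x. gauss x * (M2 x $ j $ i - x $ i * G2 x $ j) * M2 x $ k $ l)"
proof -
  obtain K where K: "K \<ge> 0" "\<And>x. norm (M2 x) \<le> K" using M2_bounded by blast
  obtain K4 where K4: "K4 \<ge> 0" "\<And>x. norm (G2 x) \<le> K4 * (1 + norm x)" using G2_bounded by blast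
  have MK: "\<bar>M2 x $ i $ j\<bar> \<le> K" for x i j
    using K(2)[of x] by (metis Finite_Cartesian_Product.norm_nth_le component_le_norm_cart order_trans)
  have "integrable lborel (\<lambda>x. gauss x * ((M2 x $ j $ i - x $ i * G2 x $ j) * M2 x $ k $ l))"
  proof (rule integrable_gauss_poly[where m = 2 and K = "(K + K4) * K"])
    fix x :: "real^'n"
    have n1: "1 \<le> (1 + norm x)\<^sup>2" by (simp add: power2_eq_square algebra_simps)
    have "\<bar>x $ i * G2 x $ j\<bar> \<le> norm x * (K4 * (1 + norm x))"
      unfolding abs_mult
      by (intro mult_mono component_le_norm_cart order_trans[OF component_le_norm_cart K4(2)]) auto
    also have "\<dots> \<le> (1 + norm x) * (K4 * (1 + norm x))"
      using K4(1) by (intro mult_right_mono) auto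
    also have "\<dots> = K4 * (1 + norm x)\<^sup>2" by (simp add: power2_eq_square)
    finally have "\<bar>M2 x $ j $ i - x $ i * G2 x $ j\<bar> \<le> K * (1 + norm x)\<^sup>2 + K4 * (1 + norm x)\<^sup>2"
      using MK[of x j i] mult_left_mono[OF n1 K(1)] by linarith
    then have "\<bar>(M2 x $ j $ i - x $ i * G2 x $ j) * M2 x $ k $ l\<bar> \<le> ((K + K4) * (1 + norm x)\<^sup>2) * K"
      unfolding abs_mult using K K4 by (intro mult_mono MK) (auto simp: distrib_right)
    then show "\<bar>(M2 x $ j $ i - x $ i * G2 x $ j) * M2 x $ k $ l\<bar> \<le> (K + K4) * K * (1 + norm x)\<^sup>2"
      by (simp add: mult_ac)
  next
    show "(\<lambda>x. (M2 x $ j $ i - x $ i * G2 x $ j) * M2 x $ k $ l) \<in> borel_measurable borel"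
      by measurable
  qed
  then show ?thesis by (simp add: mult.assoc)
qed

text \<open>Commute the derivatives in directions i and j for the components j and i of
  \<open>G2\<close>, and sum. On the left the derivative of the weight pairs x with M2 and G2, which
  is |G2|^2 by \<open>M2_radial_left\<close>. On the right the sum is (trace M2 - x . G2) trace M2
  with x . G2 = 2 |x|^2 \<Phi>, and scaling replaces |x|^2 by n. No third derivative of \<Phi>
  appears.\<close>

lemma bochner_identity:
  "E (\<lambda>x. (norm (M2 x))\<^sup>2) - E (\<lambda>x. G2 x \<bullet> G2 x) =
   E (\<lambda>x. (trace (M2 x))\<^sup>2) - 2 * real CARD('n) * E (\<lambda>x. \<Phi> x * trace (M2 x))"
proof -
  have comm: "(\<integral>x. gauss x * (M2 x $ j $ i - x $ i * G2 x $ j) * M2 x $ i $ j \<partial>lborel) =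
      (\<integral>x. gauss x * (M2 x $ j $ j - x $ j * G2 x $ j) * M2 x $ i $ i \<partial>lborel)" for i j
  proof -
    obtain L where L: "L-lipschitz_on UNIV (\<lambda>x. G2 x $ j)" using G2_lipschitz by blast
    obtain L' where L': "L'-lipschitz_on UNIV (\<lambda>x. G2 x $ i)" using G2_lipschitz by blast
    from gauss_derivatives_commute[OF L L' D_G2_component D_G2_component M2_nth_meas M2_nth_meas, of "axis i 1" "axis j 1"]
    show ?thesis by (simp add: inner_axis)
  qed
  have "E (\<lambda>x. (norm (M2 x))\<^sup>2) - E (\<lambda>x. G2 x \<bullet> G2 x) = E (\<lambda>x. (norm (M2 x))\<^sup>2 - G2 x \<bullet> G2 x)"
    using int_M int_G by (simp add: right_diff_distrib)
  also have "\<dots> = E (\<lambda>x. \<Sum>i\<in>UNIV. \<Sum>j\<in>UNIV. (M2 x $ j $ i - x $ i * G2 x $ j) * M2 x $ i $ j)"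
  proof (rule E_cong)
    fix x :: "real^'n" assume x: "x \<noteq> 0"
    have "(\<Sum>i\<in>UNIV. \<Sum>j\<in>UNIV. (M2 x $ j $ i - x $ i * G2 x $ j) * M2 x $ i $ j) =
        (\<Sum>i\<in>UNIV. \<Sum>j\<in>UNIV. (M2 x $ i $ j)\<^sup>2) - (\<Sum>i\<in>UNIV. \<Sum>j\<in>UNIV. G2 x $ j * (x $ i * M2 x $ i $ j))"
      using M2_sym[OF x] by (simp add: left_diff_distrib right_diff_distrib sum_subtractf power2_eq_square mult_ac)
    also have "(\<Sum>i\<in>UNIV. \<Sum>j\<in>UNIV. G2 x $ j * (x $ i * M2 x $ i $ j)) =
        (\<Sum>j\<in>UNIV. G2 x $ j * (\<Sum>i\<in>UNIV. x $ i * M2 x $ i $ j))"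
      by (subst sum.swap) (simp add: sum_distrib_left)
    also have "\<dots> = G2 x \<bullet> G2 x"
      unfolding M2_radial_left[OF x] by (simp add: inner_vec_def)
    finally show "(norm (M2 x))\<^sup>2 - G2 x \<bullet> G2 x =
        (\<Sum>i\<in>UNIV. \<Sum>j\<in>UNIV. (M2 x $ j $ i - x $ i * G2 x $ j) * M2 x $ i $ j)"
      by (simp add: matrix_norm_square)
  next
    show "(\<lambda>x. \<Sum>i\<in>UNIV. \<Sum>j\<in>UNIV. (M2 x $ j $ i - x $ i * G2 x $ j) * M2 x $ i $ j) \<in> borel_measurable borel"
      by (intro borel_measurable_sum borel_measurable_times borel_measurable_diff M2_nth_nth_meas G2_nth_meas
          borel_measurable_continuous_onI continuous_intros)
  qed measurable
  also have "\<dots> = (\<integral>x. (\<Sum>i\<in>UNIV. \<Sum>j\<in>UNIV. gauss x * (M2 x $ j $ i - x $ i * G2 x $ j) * M2 x $ i $ j) \<partial>lborel)"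
    by (simp add: sum_distrib_left mult.assoc)
  also have "\<dots> = (\<Sum>i\<in>UNIV. \<Sum>j\<in>UNIV. \<integral>x. gauss x * (M2 x $ j $ i - x $ i * G2 x $ j) * M2 x $ i $ j \<partial>lborel)"
    by (subst Bochner_Integration.integral_sum; (intro Bochner_Integration.integrable_sum integrable_components)?)+ simp
  also have "\<dots> = (\<Sum>i\<in>UNIV. \<Sum>j\<in>UNIV. \<integral>x. gauss x * (M2 x $ j $ j - x $ j * G2 x $ j) * M2 x $ i $ i \<partial>lborel)"
    by (intro sum.cong refl comm)
  also have "\<dots> = (\<integral>x. (\<Sum>i\<in>UNIV. \<Sum>j\<in>UNIV. gauss x * (M2 x $ j $ j - x $ j * G2 x $ j) * M2 x $ i $ i) \<partial>lborel)"
    by (subst Bochner_Integration.integral_sum; (intro Bochner_Integration.integrable_sum integrable_components)?)+ simp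
  also have "\<dots> = E (\<lambda>x. \<Sum>i\<in>UNIV. \<Sum>j\<in>UNIV. (M2 x $ j $ j - x $ j * G2 x $ j) * M2 x $ i $ i)"
    by (simp add: sum_distrib_left mult.assoc)
  also have "\<dots> = E (\<lambda>x. (trace (M2 x))\<^sup>2 - 2 * ((x \<bullet> x) * (\<Phi> x * trace (M2 x))))"
  proof (rule E_cong)
    fix x :: "real^'n" assume x: "x \<noteq> 0"
    have "(\<Sum>i\<in>UNIV. \<Sum>j\<in>UNIV. (M2 x $ j $ j - x $ j * G2 x $ j) * M2 x $ i $ i) =
        (trace (M2 x) - x \<bullet> G2 x) * trace (M2 x)"
      by (subst sum.swap) (simp add: trace_def inner_vec_def sum_product sum_subtractf flip: sum_distrib_left sum_distrib_right)
    then show "(\<Sum>i\<in>UNIV. \<Sum>j\<in>UNIV. (M2 x $ j $ j - x $ j * G2 x $ j) * M2 x $ i $ i) =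
        (trace (M2 x))\<^sup>2 - 2 * ((x \<bullet> x) * (\<Phi> x * trace (M2 x)))"
      by (simp add: G2_inner[OF x] power2_eq_square algebra_simps)
  next
    show "(\<lambda>x. \<Sum>i\<in>UNIV. \<Sum>j\<in>UNIV. (M2 x $ j $ j - x $ j * G2 x $ j) * M2 x $ i $ i) \<in> borel_measurable borel"
      by (intro borel_measurable_sum borel_measurable_times borel_measurable_diff M2_nth_nth_meas G2_nth_meas
          borel_measurable_continuous_onI continuous_intros)
  qed measurable
  also have "\<dots> = E (\<lambda>x. (trace (M2 x))\<^sup>2) - 2 * E (\<lambda>x. (x \<bullet> x) * (\<Phi> x * trace (M2 x)))"
    using int_t2 int_x\<Phi>t by (simp add: right_diff_distrib mult.left_commute[of _ 2])
  finally show ?thesis using E_x\<Phi>t by simp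
qed

text \<open>Gaussian divergence theorem for the field \<Phi> G2, one coordinate at a time;
  \<open>V i\<close> is the gradient of its i-th component. As g is orthogonal to x, the term G2 . g
  reduces to |x|^2 |g|^2.\<close>

lemma gradient_identity:
  assumes dim: "CARD('n) \<ge> 2"
  shows "E (\<lambda>x. (x \<bullet> x) * (g x \<bullet> g x)) = 2 * real CARD('n) * E (\<lambda>x. (\<Phi> x)\<^sup>2) - E (\<lambda>x. \<Phi> x * trace (M2 x))"
proof -
  define V where "V i x = \<Phi> x *\<^sub>R M2 x $ i + (G2 x $ i) *\<^sub>R g x" for i x
  have V_meas [measurable]: "V i \<in> borel_measurable borel" for i
    unfolding V_def[abs_def] by measurable
  have zero: "(\<integral>x. gauss x * (V i x $ i - x $ i * (\<Phi> x * G2 x $ i)) \<partial>lborel) = 0"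
    and int: "integrable lborel (\<lambda>x. gauss x * (V i x $ i - x $ i * (\<Phi> x * G2 x $ i)))" for i
  proof -
    have D: "((\<lambda>x. \<Phi> x * G2 x $ i) has_derivative (\<lambda>h. V i x \<bullet> h)) (at x)" if "x \<noteq> 0" for x
      using has_derivative_mult[OF D_\<Phi>[OF that] D_G2_component[OF that, of i]]
      by (rule has_derivative_eq_rhs) (simp add: V_def inner_add_left algebra_simps fun_eq_iff)
    have cont: "continuous_on (- {0}) (V i)"
      unfolding V_def[abs_def] G2_def by (intro continuous_intros cont_\<Phi> cont_g cont_M2)
    obtain L where L: "L-lipschitz_on UNIV (\<lambda>x. \<Phi> x * G2 x $ i)"
      by (rule homogeneous_lipschitz[of "\<lambda>x. \<Phi> x * G2 x $ i" "V i", OF _ D cont])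
         (auto simp: hom G2_hom)
    from gauss_integration_by_parts[OF _ L D V_meas, of "axis i 1"] dim
    show "(\<integral>x. gauss x * (V i x $ i - x $ i * (\<Phi> x * G2 x $ i)) \<partial>lborel) = 0"
      by (simp add: inner_axis)
    obtain K where K: "K \<ge> 0" "\<And>x. \<bar>\<Phi> x * G2 x $ i\<bar> \<le> K * (1 + norm x)"
      using lipschitz_growth[OF L] by blast
    have "integrable lborel (\<lambda>x. gauss x * (x $ i * (\<Phi> x * G2 x $ i)))"
    proof (rule integrable_gauss_poly[where m = 2 and K = K])
      show "\<bar>x $ i * (\<Phi> x * G2 x $ i)\<bar> \<le> K * (1 + norm x)\<^sup>2" for x
      proof -
        have "\<bar>x $ i * (\<Phi> x * G2 x $ i)\<bar> \<le> (1 + norm x) * (K * (1 + norm x))"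
          unfolding abs_mult[of "x $ i"] using component_le_norm_cart[of x i]
          by (intro mult_mono K(2)) auto
        then show ?thesis by (simp add: power2_eq_square mult_ac)
      qed
    next
      show "(\<lambda>x. x $ i * (\<Phi> x * G2 x $ i)) \<in> borel_measurable borel"
        by (intro borel_measurable_times meas G2_nth_meas borel_measurable_continuous_onI continuous_intros)
    qed
    moreover have "integrable lborel (\<lambda>x. gauss x * V i x $ i)"
    proof (rule Bochner_Integration.integrable_bound)
      show "integrable lborel (\<lambda>x :: real^'n. gauss x * L)"
        using integrable_gauss_poly[of "\<lambda>x :: real^'n. L" "\<bar>L\<bar>" 0] by simp
      show "AE x in lborel. norm (gauss x * V i x $ i) \<le> norm (gauss x * L)"
        using AE_lborel_nonzero
      proof eventually_elim
        fix x :: "real^'n" assume "x \<noteq> 0"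
        from lipschitz_gradient_bound[OF L D[OF this], of "axis i 1"] lipschitz_on_nonneg[OF L]
        show "norm (gauss x * V i x $ i) \<le> norm (gauss x * L)"
          by (simp add: inner_axis abs_mult gauss_nonneg mult_left_mono)
      qed
      show "(\<lambda>x. gauss x * V i x $ i) \<in> borel_measurable lborel"
        by measurable (rule measurable_compose[OF V_meas], intro borel_measurable_continuous_onI continuous_intros)
    qed
    ultimately show "integrable lborel (\<lambda>x. gauss x * (V i x $ i - x $ i * (\<Phi> x * G2 x $ i)))"
      by (simp add: right_diff_distrib)
  qed
  have "0 = (\<Sum>i\<in>UNIV. \<integral>x. gauss x * (V i x $ i - x $ i * (\<Phi> x * G2 x $ i)) \<partial>lborel)"
    using zero by simp
  also have "\<dots> = (\<integral>x. (\<Sum>i\<in>UNIV. gauss x * (V i x $ i - x $ i * (\<Phi> x * G2 x $ i))) \<partial>lborel)"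
    by (rule Bochner_Integration.integral_sum[symmetric]) (rule int)
  also have "\<dots> = E (\<lambda>x. \<Sum>i\<in>UNIV. V i x $ i - x $ i * (\<Phi> x * G2 x $ i))"
    by (simp add: sum_distrib_left)
  also have "\<dots> = E (\<lambda>x. \<Phi> x * trace (M2 x) + (x \<bullet> x) * (g x \<bullet> g x) - 2 * ((x \<bullet> x) * (\<Phi> x)\<^sup>2))"
  proof (rule E_cong)
    fix x :: "real^'n" assume x: "x \<noteq> 0"
    have "(\<Sum>i\<in>UNIV. V i x $ i - x $ i * (\<Phi> x * G2 x $ i)) =
        \<Phi> x * trace (M2 x) + G2 x \<bullet> g x - \<Phi> x * (x \<bullet> G2 x)"
      by (simp add: V_def trace_def inner_vec_def sum_subtractf sum.distrib sum_distrib_left mult_ac)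
    moreover have "G2 x \<bullet> g x = (x \<bullet> x) * (g x \<bullet> g x)"
      using g_radial[OF x] by (simp add: G2_def inner_add_left inner_add_right inner_commute)
    ultimately show "(\<Sum>i\<in>UNIV. V i x $ i - x $ i * (\<Phi> x * G2 x $ i)) =
        \<Phi> x * trace (M2 x) + (x \<bullet> x) * (g x \<bullet> g x) - 2 * ((x \<bullet> x) * (\<Phi> x)\<^sup>2)"
      by (simp add: G2_inner[OF x] power2_eq_square mult_ac)
  next
    show "(\<lambda>x. \<Sum>i\<in>UNIV. V i x $ i - x $ i * (\<Phi> x * G2 x $ i)) \<in> borel_measurable borel"
      by (intro borel_measurable_sum borel_measurable_diff borel_measurable_times meas G2_nth_meas
          measurable_compose[OF V_meas] borel_measurable_continuous_onI continuous_intros)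
  qed measurable
  also have "\<dots> = E (\<lambda>x. \<Phi> x * trace (M2 x)) + E (\<lambda>x. (x \<bullet> x) * (g x \<bullet> g x)) - 2 * E (\<lambda>x. (x \<bullet> x) * (\<Phi> x)\<^sup>2)"
    using int_\<Phi>t int_g2 int_x\<Phi>2
    by (simp add: right_diff_distrib distrib_left mult.left_commute[of _ 2])
  finally show ?thesis using E_x\<Phi>2 by simp
qed

text \<open>Evenness of \<Phi> makes each component of its degree 2 multiple's gradient
  \<open>G2\<close> odd, so the Poincare inequality applies to every component, with the rows of
  \<open>M2\<close> as gradients.\<close>

lemma poincare_G2:
  assumes dim: "CARD('n) \<ge> 2" and even: "\<And>x. \<Phi> (- x) = \<Phi> x"
  shows "E (\<lambda>x. G2 x \<bullet> G2 x) \<le> E (\<lambda>x. (norm (M2 x))\<^sup>2)"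
proof -
  have g_odd: "g (- x) = - g x" if "x \<noteq> 0" for x
  proof -
    have "((\<lambda>y. \<Phi> ((-1) *\<^sub>R y)) has_derivative (\<lambda>h. g (- x) \<bullet> ((-1) *\<^sub>R h))) (at x)"
      using that by (intro has_derivative_scale_arg) (simp add: D_\<Phi>)
    then have "(\<Phi> has_derivative (\<lambda>h. g (- x) \<bullet> ((-1) *\<^sub>R h))) (at x)" by (simp add: even)
    note eq = has_derivative_unique[OF this D_\<Phi>[OF that]]
    have "g (- x) \<bullet> h = (- g x) \<bullet> h" for h using fun_cong[OF eq, of h] by simp
    then show ?thesis using vector_eq_rdot by blast
  qed
  have G_odd: "G2 (- x) = - G2 x" for x
    by (cases "x = 0") (auto simp: G2_def even g_odd)
  have MK: "integrable lborel (\<lambda>x. gauss x * (M2 x $ i \<bullet> M2 x $ i))"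
    and GK: "integrable lborel (\<lambda>x. gauss x * (G2 x $ i)\<^sup>2)" for i
  proof -
    show "integrable lborel (\<lambda>x. gauss x * (M2 x $ i \<bullet> M2 x $ i))"
    proof (rule Bochner_Integration.integrable_bound[OF int_M])
      show "AE x in lborel. norm (gauss x * (M2 x $ i \<bullet> M2 x $ i)) \<le> norm (gauss x * (norm (M2 x))\<^sup>2)"
      proof (rule AE_I2)
        fix x
        have "(norm (M2 x $ i))\<^sup>2 \<le> (norm (M2 x))\<^sup>2"
          using Finite_Cartesian_Product.norm_nth_le by (intro power_mono) auto
        then show "norm (gauss x * (M2 x $ i \<bullet> M2 x $ i)) \<le> norm (gauss x * (norm (M2 x))\<^sup>2)"
          by (simp add: abs_mult gauss_nonneg dot_square_norm mult_left_mono)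
      qed
    qed measurable
    show "integrable lborel (\<lambda>x. gauss x * (G2 x $ i)\<^sup>2)"
    proof (rule Bochner_Integration.integrable_bound[OF int_G])
      show "AE x in lborel. norm (gauss x * (G2 x $ i)\<^sup>2) \<le> norm (gauss x * (G2 x \<bullet> G2 x))"
      proof (rule AE_I2)
        fix x
        have "\<bar>G2 x $ i\<bar>\<^sup>2 \<le> (norm (G2 x))\<^sup>2"
          using component_le_norm_cart by (intro power_mono) auto
        then show "norm (gauss x * (G2 x $ i)\<^sup>2) \<le> norm (gauss x * (G2 x \<bullet> G2 x))"
          by (simp add: abs_mult gauss_nonneg dot_square_norm mult_left_mono)
      qed
    qed measurable
  qed
  have "E (\<lambda>x. G2 x \<bullet> G2 x) = (\<integral>x. (\<Sum>i\<in>UNIV. gauss x * (G2 x $ i)\<^sup>2) \<partial>lborel)"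
    by (simp add: inner_vec_def power2_eq_square sum_distrib_left)
  also have "\<dots> = (\<Sum>i\<in>UNIV. E (\<lambda>x. (G2 x $ i)\<^sup>2))"
    by (rule Bochner_Integration.integral_sum) (rule GK)
  also have "\<dots> \<le> (\<Sum>i\<in>UNIV. E (\<lambda>x. M2 x $ i \<bullet> M2 x $ i))"
  proof (rule sum_mono)
    fix i
    obtain L where L: "L-lipschitz_on UNIV (\<lambda>x. G2 x $ i)" using G2_lipschitz by blast
    show "E (\<lambda>x. (G2 x $ i)\<^sup>2) \<le> E (\<lambda>x. M2 x $ i \<bullet> M2 x $ i)"
      by (rule gauss_poincare_odd[OF _ L D_G2_component])
         (use dim in \<open>auto simp: G_odd intro!: continuous_intros cont_M2\<close>)
  qed
  also have "\<dots> = (\<integral>x. (\<Sum>i\<in>UNIV. gauss x * (M2 x $ i \<bullet> M2 x $ i)) \<partial>lborel)"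
    by (rule Bochner_Integration.integral_sum[symmetric]) (rule MK)
  also have "\<dots> = E (\<lambda>x. (norm (M2 x))\<^sup>2)"
    by (simp add: power2_norm_eq_inner inner_vec_def sum_distrib_left)
  finally show ?thesis .
qed

text \<open>q is the spherical Laplacian of \<Phi>, extended with degree 0: the trace of
  \<open>M2\<close> is 2 n \<Phi> + |x|^2 \<Delta>\<Phi>, the cross terms vanishing since g is
  orthogonal to x. Nonnegativity for suitable a and b takes the place of the Cauchy-Schwarz
  inequality between q and \<Phi>.\<close>

lemma quadratic_form_nonneg:
  assumes q_def: "q = (\<lambda>x. trace (M2 x) - 2 * real CARD('n) * \<Phi> x)"
  shows "integrable lborel (\<lambda>x. gauss x * (a * q x + b * \<Phi> x)\<^sup>2)"
    and "E (\<lambda>x. (a * q x + b * \<Phi> x)\<^sup>2) =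
      a\<^sup>2 * E (\<lambda>x. (q x)\<^sup>2) + 2 * a * b * E (\<lambda>x. \<Phi> x * q x) + b\<^sup>2 * E (\<lambda>x. (\<Phi> x)\<^sup>2)"
    and "0 \<le> E (\<lambda>x. (a * q x + b * \<Phi> x)\<^sup>2)"
    and "E (\<lambda>x. (q x)\<^sup>2) = E (\<lambda>x. (trace (M2 x))\<^sup>2) - 4 * real CARD('n) * E (\<lambda>x. \<Phi> x * trace (M2 x))
      + 4 * (real CARD('n))\<^sup>2 * E (\<lambda>x. (\<Phi> x)\<^sup>2)"
    and "E (\<lambda>x. \<Phi> x * q x) = E (\<lambda>x. \<Phi> x * trace (M2 x)) - 2 * real CARD('n) * E (\<lambda>x. (\<Phi> x)\<^sup>2)"
proof -
  have [measurable]: "q \<in> borel_measurable borel" unfolding q_def by measurable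
  let ?n = "real CARD('n)"
  have q2: "gauss x * (q x)\<^sup>2 = gauss x * (trace (M2 x))\<^sup>2 - 4 * ?n * (gauss x * (\<Phi> x * trace (M2 x)))
      + 4 * ?n\<^sup>2 * (gauss x * (\<Phi> x)\<^sup>2)" for x
    by (simp add: q_def power2_eq_square algebra_simps)
  have \<Phi>q: "gauss x * (\<Phi> x * q x) = gauss x * (\<Phi> x * trace (M2 x)) - 2 * ?n * (gauss x * (\<Phi> x)\<^sup>2)" for x
    by (simp add: q_def power2_eq_square algebra_simps)
  have int_q2: "integrable lborel (\<lambda>x. gauss x * (q x)\<^sup>2)"
    unfolding q2 using int_t2 int_\<Phi>t int_\<Phi>2 by simp
  have int_\<Phi>q: "integrable lborel (\<lambda>x. gauss x * (\<Phi> x * q x))"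
    unfolding \<Phi>q using int_\<Phi>t int_\<Phi>2 by simp
  have sq: "gauss x * (a * q x + b * \<Phi> x)\<^sup>2 = a\<^sup>2 * (gauss x * (q x)\<^sup>2) + 2 * a * b * (gauss x * (\<Phi> x * q x))
      + b\<^sup>2 * (gauss x * (\<Phi> x)\<^sup>2)" for x
    by (simp add: power2_eq_square algebra_simps)
  show "integrable lborel (\<lambda>x. gauss x * (a * q x + b * \<Phi> x)\<^sup>2)"
    unfolding sq using int_q2 int_\<Phi>q int_\<Phi>2 by simp
  show "E (\<lambda>x. (a * q x + b * \<Phi> x)\<^sup>2) =
      a\<^sup>2 * E (\<lambda>x. (q x)\<^sup>2) + 2 * a * b * E (\<lambda>x. \<Phi> x * q x) + b\<^sup>2 * E (\<lambda>x. (\<Phi> x)\<^sup>2)"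
    unfolding sq using int_q2 int_\<Phi>q int_\<Phi>2 by simp
  show "0 \<le> E (\<lambda>x. (a * q x + b * \<Phi> x)\<^sup>2)"
    by (intro integral_nonneg_AE) (simp add: gauss_nonneg)
  show "E (\<lambda>x. (q x)\<^sup>2) = E (\<lambda>x. (trace (M2 x))\<^sup>2) - 4 * ?n * E (\<lambda>x. \<Phi> x * trace (M2 x))
      + 4 * ?n\<^sup>2 * E (\<lambda>x. (\<Phi> x)\<^sup>2)"
    unfolding q2 using int_t2 int_\<Phi>t int_\<Phi>2 by simp
  show "E (\<lambda>x. \<Phi> x * q x) = E (\<lambda>x. \<Phi> x * trace (M2 x)) - 2 * ?n * E (\<lambda>x. (\<Phi> x)\<^sup>2)"
    unfolding \<Phi>q using int_\<Phi>t int_\<Phi>2 by simp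
qed

text \<open>On even functions the first nonzero eigenvalue of \<open>- \<Delta>\<close> on the sphere is
  \<open>2 n > lam\<close>, hence \<open>\<Delta> + lam\<close> is bounded below and beats a small right-hand side.\<close>

theorem rigidity:
  assumes dim: "CARD('n) \<ge> 2" and even: "\<And>x. \<Phi> (- x) = \<Phi> x"
    and lam: "1 \<le> lam" "lam \<le> 2 * real CARD('n) - 2"
    and eps: "0 \<le> \<epsilon>" "48 * (real CARD('n))^3 * \<epsilon>\<^sup>2 \<le> 1"
    and eq: "\<And>x. x \<noteq> 0 \<Longrightarrow> \<bar>trace (M2 x) - 2 * real CARD('n) * \<Phi> x + lam * \<Phi> x\<bar> \<le> \<epsilon> * norm (M2 x)"
    and x: "x \<noteq> 0"
  shows "\<Phi> x = 0"
proof -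
  define q where "q = (\<lambda>x. trace (M2 x) - 2 * real CARD('n) * \<Phi> x)"
  define n where "n = real CARD('n)"
  have n: "n \<ge> 2" using dim by (simp add: n_def)
  define P where "P = E (\<lambda>x. (\<Phi> x)\<^sup>2)"
  define Q where "Q = E (\<lambda>x. (q x)\<^sup>2)"
  define R where "R = E (\<lambda>x. \<Phi> x * q x)"
  define M where "M = E (\<lambda>x. (norm (M2 x))\<^sup>2)"
  define G where "G = E (\<lambda>x. G2 x \<bullet> G2 x)"
  define T where "T = E (\<lambda>x. (trace (M2 x))\<^sup>2)"
  define U where "U = E (\<lambda>x. \<Phi> x * trace (M2 x))"
  note quad = quadratic_form_nonneg[OF q_def]
  have form: "0 \<le> a\<^sup>2 * Q + 2 * a * b * R + b\<^sup>2 * P" for a b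
    using quad(3)[of a b] unfolding quad(2) Q_def R_def P_def .
  have P0: "0 \<le> P" using form[of 0 1] by simp
  have M0: "0 \<le> M" unfolding M_def by (intro integral_nonneg_AE) (simp add: gauss_nonneg)
  have QT: "Q = T - 4 * n * U + 4 * n\<^sup>2 * P" and RU: "R = U - 2 * n * P"
    using quad(4,5) unfolding Q_def T_def U_def P_def R_def n_def by auto
  have B: "M - G = T - 2 * n * U"
    using bochner_identity unfolding M_def G_def T_def U_def n_def .
  have GM: "G \<le> M"
    using poincare_G2[OF dim even] unfolding G_def M_def .
  have GP: "G = n * (4 * P + (2 * n * P - U))"
    using E_G gradient_identity[OF dim] unfolding G_def P_def U_def n_def by simp
  have T_eq: "T = Q + 4 * n * (R + 2 * n * P) - 4 * n\<^sup>2 * P" and U_eq: "U = R + 2 * n * P"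
    using QT RU by simp_all
  \<comment> \<open>P, Q and -R are the Gaussian versions of the squared L2 norms of \<Phi>, of
    \<Delta>\<Phi> and of the spherical gradient. The aim is to express the full Hessian by these
    three.\<close>
  have "M = n * (4 * P + (2 * n * P - U)) + T - 2 * n * U" using B GP by linarith
  also have "\<dots> = Q + n * R + 4 * n * P"
    unfolding T_eq U_eq by (simp add: power2_eq_square algebra_simps)
  finally have f1: "M = Q + n * R + 4 * n * P" .
  \<comment> \<open>The spectral gap: if -\<Delta>\<Phi> = \<mu> \<Phi>, it reads \<mu>^2 - 2 n
    \<mu> \<ge> 0.\<close>
  have "0 \<le> T - 2 * n * U" using B GM by linarith
  also have "\<dots> = Q + 2 * n * R"
    unfolding T_eq U_eq by (simp add: power2_eq_square algebra_simps)
  finally have f2: "0 \<le> Q + 2 * n * R" .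
  \<comment> \<open>The squared norm of (\<Delta> + lam) \<Phi>, small by hypothesis.\<close>
  define N where "N = Q + 2 * lam * R + lam\<^sup>2 * P"
  have N_eq: "N = E (\<lambda>x. (1 * q x + lam * \<Phi> x)\<^sup>2)"
    unfolding quad(2) by (simp add: N_def Q_def R_def P_def)
  have NM: "N \<le> \<epsilon>\<^sup>2 * M"
  proof -
    have "N \<le> E (\<lambda>x. \<epsilon>\<^sup>2 * (norm (M2 x))\<^sup>2)"
      unfolding N_eq
    proof (rule integral_mono_AE)
      show "integrable lborel (\<lambda>x. gauss x * (1 * q x + lam * \<Phi> x)\<^sup>2)" by (rule quad(1))
      show "integrable lborel (\<lambda>x. gauss x * (\<epsilon>\<^sup>2 * (norm (M2 x))\<^sup>2))"
        unfolding mult.left_commute[of "gauss _"] by (rule integrable_mult_right[OF int_M])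
      show "AE x in lborel. gauss x * (1 * q x + lam * \<Phi> x)\<^sup>2 \<le> gauss x * (\<epsilon>\<^sup>2 * (norm (M2 x))\<^sup>2)"
        using AE_lborel_nonzero
      proof eventually_elim
        fix x :: "real^'n" assume "x \<noteq> 0"
        from power_mono[OF eq[OF this], of 2]
        have "(1 * q x + lam * \<Phi> x)\<^sup>2 \<le> \<epsilon>\<^sup>2 * (norm (M2 x))\<^sup>2"
          by (simp add: q_def power_mult_distrib)
        then show "gauss x * (1 * q x + lam * \<Phi> x)\<^sup>2 \<le> gauss x * (\<epsilon>\<^sup>2 * (norm (M2 x))\<^sup>2)"
          by (intro mult_left_mono) (auto simp: gauss_nonneg)
      qed
    qed
    also have "\<dots> = \<epsilon>\<^sup>2 * M" unfolding M_def mult.left_commute[of "gauss _"] by simp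
    finally show ?thesis .
  qed
  have lam0: "0 \<le> lam * (Q + 2 * n * R)" using f2 lam by (intro mult_nonneg_nonneg) auto
  have Q0: "0 \<le> Q" using form[of 1 0] by simp
  have "2 * Q \<le> (2 * n - lam) * Q"
    using lam Q0 by (intro mult_right_mono) (auto simp: n_def)
  then have "2 * Q \<le> 2 * n * (Q + lam * R)" using lam0 by (simp add: algebra_simps)
  \<comment> \<open>This is the integrated square of q - n (q + lam \<Phi>). With the gap 2 n - lam
    \<ge> 2 used just before, it bounds \<Delta>\<Phi> by (\<Delta> + lam) \<Phi>.\<close>
  moreover have "0 \<le> Q - 2 * n * (Q + lam * R) + n\<^sup>2 * N"
    using form[of "1 - n" "- n * lam"] by (simp add: N_def power2_eq_square algebra_simps)
  ultimately have QN: "Q \<le> n\<^sup>2 * N" by linarith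
  also have "\<dots> \<le> n\<^sup>2 * (\<epsilon>\<^sup>2 * M)" using NM by (intro mult_left_mono) auto
  finally have QM: "Q \<le> n\<^sup>2 * (\<epsilon>\<^sup>2 * M)" .
  have "P \<le> lam\<^sup>2 * P"
    using P0 lam mult_right_mono[of 1 "lam\<^sup>2" P] by (simp add: one_le_power)
  \<comment> \<open>The difference of the two sides is the integrated square of 2 q + lam
    \<Phi>.\<close>
  moreover have "lam\<^sup>2 * P \<le> 2 * N + 2 * Q"
    using form[of 2 lam] by (simp add: N_def power2_eq_square algebra_simps)
  ultimately have PM: "P \<le> 2 * (\<epsilon>\<^sup>2 * M) + 2 * Q" using NM by linarith
  have e0: "0 \<le> \<epsilon>\<^sup>2 * M" using M0 by simp
  have "2 * R \<le> P + Q" using form[of 1 "-1"] by simp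
  then have "n * (2 * R) \<le> n * (P + Q)" using n by (intro mult_left_mono) auto
  then have "2 * M \<le> 2 * Q + n * Q + 9 * (n * P)" using f1 by (simp add: algebra_simps)
  also have "n * P \<le> n * (2 * (\<epsilon>\<^sup>2 * M) + 2 * Q)" using PM n by (intro mult_left_mono) auto
  finally have "2 * M \<le> (2 + 19 * n) * Q + 18 * (n * (\<epsilon>\<^sup>2 * M))" by (simp add: algebra_simps)
  also have "(2 + 19 * n) * Q \<le> (20 * n) * (n\<^sup>2 * (\<epsilon>\<^sup>2 * M))"
    using QM Q0 n by (intro mult_mono) auto
  finally have "2 * M \<le> 20 * (n^3 * (\<epsilon>\<^sup>2 * M)) + 18 * (n * (\<epsilon>\<^sup>2 * M))"
    by (simp add: power2_eq_square power3_eq_cube algebra_simps)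
  also have "n * (\<epsilon>\<^sup>2 * M) \<le> n^3 * (\<epsilon>\<^sup>2 * M)"
    using n e0 power_increasing[of 1 3 n] by (intro mult_right_mono) auto
  finally have "2 * M \<le> 38 * (n^3 * (\<epsilon>\<^sup>2 * M))" by simp
  \<comment> \<open>Since 38 / 48 < 2, this bound and the previous one are compatible only for M =
    0.\<close>
  moreover have "48 * (n^3 * (\<epsilon>\<^sup>2 * M)) \<le> M"
    using mult_right_mono[OF eps(2) M0] by (simp add: n_def mult_ac)
  ultimately have "M = 0" using M0 by linarith
  then have "P \<le> 0" using PM QM by simp
  then have "P = 0" using P0 by simp
  then have "AE x in lborel. gauss x * (\<Phi> x)\<^sup>2 = 0"
    using integral_nonneg_eq_0_iff_AE[OF int_\<Phi>2] by (simp add: P_def gauss_nonneg)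
  then have ae: "AE x in lborel. \<Phi> x = 0"
    by eventually_elim (simp add: gauss_pos less_imp_neq[symmetric])
  \<comment> \<open>\<Phi> vanishes almost everywhere; off the origin its nonvanishing set is open
    and negligible, hence empty.\<close>
  have "open (- {0} \<inter> \<Phi> -` (- {0}))"
    by (rule continuous_open_preimage[OF cont_\<Phi>]) auto
  moreover have "negligible (- {0} \<inter> \<Phi> -` (- {0}))"
  proof -
    from ae obtain S where "S \<in> null_sets lborel" "{x. \<Phi> x \<noteq> 0} \<subseteq> S"
      by (auto simp: eventually_ae_filter)
    then have "S \<in> null_sets lebesgue" by (intro null_sets_completionI)
    then have "negligible S" by (simp add: negligible_iff_null_sets)
    then show ?thesis by (rule negligible_subset) (use \<open>{x. \<Phi> x \<noteq> 0} \<subseteq> S\<close> in blast)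
  qed
  ultimately have "- {0} \<inter> \<Phi> -` (- {0}) = {}" using open_not_negligible by blast
  then show ?thesis using x by auto
qed

end

section \<open>Linearization at the ball\<close>

text \<open>The terms i = 0 and i = 1 of \<open>esym_tangent_proj_add\<close> are the constant and
  the trace; those with i \<ge> 2 are O(|B|^2) because |B| \<le> 1.\<close>

lemma esym_expansion:
  assumes m: "1 \<le> m" "m < CARD('n)"
  shows "\<exists>C\<ge>0. \<forall>u (B :: real^'n^'n). norm u = 1 \<longrightarrow> u v* B = 0 \<longrightarrow> norm B \<le> 1 \<longrightarrow>
    \<bar>esym m (tangent_proj u + B) - real ((CARD('n) - 1) choose m)
      - real ((CARD('n) - 2) choose (m - 1)) * trace B\<bar> \<le> C * (norm B)\<^sup>2"
proof -
  obtain c where c: "\<And>i. c i \<ge> 0" "\<And>i (A :: real^'n^'n). \<bar>esym i A\<bar> \<le> c i * norm A ^ i"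
    using esym_bound[where 'n = 'n] by metis
  define C where "C = (\<Sum>i\<in>{2..m}. real ((CARD('n) - 1 - i) choose (m - i)) * c i)"
  have "C \<ge> 0" unfolding C_def using c(1) by (intro sum_nonneg mult_nonneg_nonneg) auto
  moreover have "\<bar>esym m (tangent_proj u + B) - real ((CARD('n) - 1) choose m)
      - real ((CARD('n) - 2) choose (m - 1)) * trace B\<bar> \<le> C * (norm B)\<^sup>2"
    if u: "norm u = 1" "u v* B = 0" "norm B \<le> 1" for u and B :: "real^'n^'n"
  proof -
    let ?f = "\<lambda>i. real ((CARD('n) - 1 - i) choose (m - i)) * esym i B"
    have "{..m} = {0, 1} \<union> {2..m}" using m by auto
    then have "(\<Sum>i\<le>m. ?f i) = ?f 0 + ?f 1 + (\<Sum>i\<in>{2..m}. ?f i)"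
      by (simp add: sum.union_disjoint del: One_nat_def)
    then have "esym m (tangent_proj u + B) - real ((CARD('n) - 1) choose m)
      - real ((CARD('n) - 2) choose (m - 1)) * trace B = (\<Sum>i\<in>{2..m}. ?f i)"
      unfolding esym_tangent_proj_add[OF u(1,2) m(2)] esym_0 esym_1
      by (simp add: numeral_2_eq_2)
    also have "\<bar>\<dots>\<bar> \<le> (\<Sum>i\<in>{2..m}. real ((CARD('n) - 1 - i) choose (m - i)) * c i * (norm B)\<^sup>2)"
    proof (rule order_trans[OF sum_abs sum_mono])
      fix i assume "i \<in> {2..m}"
      then have "norm B ^ i \<le> (norm B)\<^sup>2" using u(3) by (intro power_decreasing) auto
      then have "\<bar>esym i B\<bar> \<le> c i * (norm B)\<^sup>2"
        using c(2)[of i B] mult_left_mono[OF _ c(1)[of i]] by (meson order_trans)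
      then show "\<bar>?f i\<bar> \<le> real ((CARD('n) - 1 - i) choose (m - i)) * c i * (norm B)\<^sup>2"
        by (simp add: abs_mult mult.assoc mult_left_mono)
    qed
    finally show ?thesis by (simp add: C_def sum_distrib_right)
  qed
  ultimately show ?thesis by blast
qed

text \<open>The upper bound is Bernoulli's inequality, a case of Young's. The lower bound writes (1
  - x)^a as (1 - x) / (1 - x)^(1 - a) and applies Bernoulli with exponent 1 - a to the
  denominator.\<close>

lemma powr_one_minus_expansion:
  fixes a x :: real
  assumes a: "0 < a" "a \<le> 1" and x: "\<bar>x\<bar> \<le> 1 / 2"
  shows "\<bar>(1 - x) powr a - (1 - a * x)\<bar> \<le> 2 * x\<^sup>2"
proof -
  have bern: "(1 - x) powr b \<le> 1 - b * x" if b: "0 \<le> b" "b \<le> 1" for b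
  proof -
    have "1 powr (1 - b) * (1 - x) powr b \<le> (1 - b) * 1 + b * (1 - x)"
      using b x by (intro Youngs_inequality_0) auto
    then show ?thesis by (simp add: algebra_simps)
  qed
  have up: "(1 - x) powr a \<le> 1 - a * x" using bern[of a] a by simp
  have d: "1 / 2 \<le> 1 - (1 - a) * x"
  proof -
    have "(1 - a) * x \<le> (1 - a) * (1 / 2)" using a x by (intro mult_left_mono) auto
    also have "\<dots> \<le> 1 / 2" using a by simp
    finally have "(1 - a) * x \<le> 1 / 2" .
    then show ?thesis by simp
  qed
  have "(1 - x) / (1 - (1 - a) * x) \<le> (1 - x) / ((1 - x) powr (1 - a))"
    using bern[of "1 - a"] a x d by (intro divide_left_mono mult_pos_pos) auto
  also have "\<dots> = (1 - x) powr a"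
    using x by (simp add: powr_diff)
  finally have low: "(1 - x) / (1 - (1 - a) * x) \<le> (1 - x) powr a" .
  have "1 - a * x - (1 - x) / (1 - (1 - a) * x) = (a * x - a * a * x) * x / (1 - (1 - a) * x)"
    using d by (simp add: divide_simps) (simp add: algebra_simps)
  also have "\<dots> \<le> 2 * x\<^sup>2"
  proof -
    have "a * x * x - a * a * x * x \<le> x * x"
    proof -
      have "a * (1 - a) * (x * x) \<le> 1 * 1 * (x * x)" using a by (intro mult_right_mono mult_mono) auto
      then show ?thesis by (simp add: algebra_simps)
    qed
    also have "x * x \<le> 2 * (x * x) * (1 - (1 - a) * x)"
      using mult_left_mono[OF d, of "2 * (x * x)"] by simp
    finally show ?thesis using d by (simp add: divide_simps power2_eq_square) (simp add: algebra_simps)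
  qed
  finally show ?thesis using up low by linarith
qed

section \<open>Frobenius norm, rank one matrices and tangent projections\<close>

lemma norm_matrix_vector_le: "norm (A *v x) \<le> norm A * norm x" for A :: "real^'n^'m"
proof -
  have "(norm (A *v x))\<^sup>2 = (\<Sum>i\<in>UNIV. (A $ i \<bullet> x)\<^sup>2)"
    unfolding power2_norm_eq_inner by (simp add: inner_vec_def matrix_vector_mult_def power2_eq_square)
  also have "\<dots> \<le> (\<Sum>i\<in>UNIV. (norm (A $ i))\<^sup>2 * (norm x)\<^sup>2)"
  proof (rule sum_mono)
    fix i
    have "\<bar>A $ i \<bullet> x\<bar>\<^sup>2 \<le> (norm (A $ i) * norm x)\<^sup>2"
      by (intro power_mono Cauchy_Schwarz_ineq2) auto
    then show "(A $ i \<bullet> x)\<^sup>2 \<le> (norm (A $ i))\<^sup>2 * (norm x)\<^sup>2" by (simp add: power_mult_distrib)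
  qed
  also have "\<dots> = (norm A * norm x)\<^sup>2"
    by (simp add: power_mult_distrib power2_norm_eq_inner inner_vec_def sum_distrib_right)
  finally show ?thesis by (rule power2_le_imp_le) simp
qed

lemma norm_mat_1_le: "norm (mat 1 :: real^'n^'n) \<le> real CARD('n)"
proof -
  have "(norm (mat 1 :: real^'n^'n))\<^sup>2 = (\<Sum>i\<in>UNIV. \<Sum>j\<in>(UNIV :: 'n set). if i = j then 1 else 0)"
    unfolding matrix_norm_square mat_def by (intro sum.cong) auto
  also have "\<dots> = real CARD('n)" by simp
  also have "\<dots> \<le> (real CARD('n))\<^sup>2"
    using zero_less_card_finite[where 'a = 'n] by (simp add: power2_eq_square)
  finally show ?thesis by (rule power2_le_imp_le) simp
qed

lemma abs_trace_le: "\<bar>trace A\<bar> \<le> real CARD('n) * norm A" for A :: "real^'n^'n"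
proof -
  have "\<bar>trace A\<bar> \<le> (\<Sum>i\<in>(UNIV :: 'n set). norm A)"
    unfolding trace_def by (rule order_trans[OF sum_abs sum_mono]) (rule component_le_norm_matrix)
  then show ?thesis by simp
qed

lemma tangent_proj_eq: "tangent_proj u = mat 1 - outer u u"
  by (simp add: tangent_proj_def outer_def)

lemma norm_tangent_proj_le: "norm u = 1 \<Longrightarrow> norm (tangent_proj u) \<le> real CARD('n) + 1" for u :: "real^'n"
  unfolding tangent_proj_eq
  using norm_triangle_ineq4[of "mat 1 :: real^'n^'n" "outer u u"] norm_mat_1_le[where 'n = 'n]
  by (simp add: norm_outer)

lemma outer_left: "v v* outer a b = (v \<bullet> a) *\<^sub>R b"
  by (simp add: vec_eq_iff vector_matrix_mult_def outer_def inner_vec_def sum_distrib_left sum_distrib_right mult_ac)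

lemma left_tangent_proj: "norm u = 1 \<Longrightarrow> u v* tangent_proj u = 0"
  unfolding tangent_proj_eq
  by (simp add: vector_matrix_mult_diff_rdistrib outer_left norm_eq_1 vector_matrix_mul_rid)

lemma trace_tangent_proj: "norm u = 1 \<Longrightarrow> trace (tangent_proj u) = real CARD('n) - 1" for u :: "real^'n"
  unfolding tangent_proj_eq by (simp add: trace_sub trace_I trace_outer norm_eq_1)

lemma outer_mult_matrix: "outer a b ** A = outer a (b v* A)" for A :: "real^'n^'n"
  by (simp add: vec_eq_iff matrix_matrix_mult_def outer_def vector_matrix_mult_def sum_distrib_left mult_ac)

lemma matrix_mult_outer: "A ** outer a b = outer (A *v a) b" for A :: "real^'n^'n"
  by (simp add: vec_eq_iff matrix_matrix_mult_def outer_def matrix_vector_mult_def sum_distrib_left mult_ac)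

lemma matrix_diff_ldistrib: "A ** (B - C) = A ** B - A ** C" for A :: "real^'n^'m" and B C :: "real^'k^'n"
  by (simp add: vec_eq_iff matrix_matrix_mult_def right_diff_distrib sum_subtractf)

lemma matrix_diff_rdistrib: "(B - C) ** A = B ** A - C ** A" for A :: "real^'k^'n" and B C :: "real^'n^'m"
  by (simp add: vec_eq_iff matrix_matrix_mult_def left_diff_distrib sum_subtractf)

text \<open>With P the projection, B = -(S + \<phi> P) is the deviation of the Hessian of the
  support function from P. The equation reads (1 - \<phi>)^a (c0 + c1 trace B + R) = c0. Its linear
  part c1 trace B - a c0 \<phi> is -c1 times trace S + lam \<phi> with lam = (n - 1)(1 + a / m),
  because trace B = -(trace S + (n - 1) \<phi>) and m c0 = (n - 1) c1.\<close>

lemma linearized_equation: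
  fixes a :: real
  assumes m: "1 \<le> m" "m < CARD('n)" and a: "0 < a" "a \<le> 1"
  shows "\<exists>C\<ge>0. \<forall>u (S :: real^'n^'n) \<phi>. norm u = 1 \<longrightarrow> u v* S = 0 \<longrightarrow>
    norm (- (S + \<phi> *\<^sub>R tangent_proj u)) \<le> 1 \<longrightarrow> \<bar>\<phi>\<bar> \<le> 1 / 2 \<longrightarrow>
    (1 - \<phi>) powr a * esym m (tangent_proj u + - (S + \<phi> *\<^sub>R tangent_proj u)) = real ((CARD('n) - 1) choose m) \<longrightarrow>
    \<bar>trace S + (real CARD('n) - 1) * (1 + a / real m) * \<phi>\<bar>
      \<le> C * (norm (- (S + \<phi> *\<^sub>R tangent_proj u)) + \<bar>\<phi>\<bar>)\<^sup>2"
proof -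
  define c0 where "c0 = real ((CARD('n) - 1) choose m)"
  define c1 where "c1 = real ((CARD('n) - 2) choose (m - 1))"
  let ?n = "real CARD('n)"
  have c1: "c1 \<ge> 1"
  proof -
    have "0 < (CARD('n) - 2) choose (m - 1)" using m by (simp add: zero_less_binomial_iff)
    then show ?thesis unfolding c1_def by linarith
  qed
  have c0: "c0 \<ge> 0" by (simp add: c0_def)
  have c01: "real m * c0 = (?n - 1) * c1"
  proof -
    have "m * ((CARD('n) - 1) choose m) = (CARD('n) - 1) * ((CARD('n) - 2) choose (m - 1))"
      using times_binomial_minus1_eq[of m "CARD('n) - 1"] m by (simp add: numeral_2_eq_2)
    then have "real m * c0 = real (CARD('n) - 1) * c1"
      unfolding c0_def c1_def by (metis of_nat_mult)
    then show ?thesis using m by (simp add: of_nat_diff)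
  qed
  obtain C where C: "C \<ge> 0" "\<And>u (B :: real^'n^'n). norm u = 1 \<Longrightarrow> u v* B = 0 \<Longrightarrow> norm B \<le> 1 \<Longrightarrow>
    \<bar>esym m (tangent_proj u + B) - c0 - c1 * trace B\<bar> \<le> C * (norm B)\<^sup>2"
    using esym_expansion[OF m] unfolding c0_def c1_def by metis
  define C' where "C' = 2 * C + 2 * (c0 + c1 * ?n) + c1 * ?n"
  have C': "C' \<ge> 0" using C c0 c1 by (simp add: C'_def)
  have "\<bar>trace S + (?n - 1) * (1 + a / real m) * \<phi>\<bar> \<le> C' * (norm B + \<bar>\<phi>\<bar>)\<^sup>2"
    if u: "norm u = 1" and S: "u v* S = 0" and B_def: "B = - (S + \<phi> *\<^sub>R tangent_proj u)" and B: "norm B \<le> 1"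
      and \<phi>: "\<bar>\<phi>\<bar> \<le> 1 / 2" and eq: "(1 - \<phi>) powr a * esym m (tangent_proj u + B) = c0"
    for u and S B :: "real^'n^'n" and \<phi>
  proof -
    define \<tau> where "\<tau> = trace B"
    define R where "R = esym m (tangent_proj u + B) - c0 - c1 * \<tau>"
    define w where "w = (1 - \<phi>) powr a"
    define \<rho> where "\<rho> = w - (1 - a * \<phi>)"
    have uB: "u v* B = 0"
    proof -
      have "u v* B = - (u v* S) - \<phi> *\<^sub>R (u v* tangent_proj u)"
        by (simp add: B_def vec_eq_iff vector_matrix_mult_def sum_negf sum_subtractf sum_distrib_left algebra_simps)
      then show ?thesis using S left_tangent_proj[OF u] by simp
    qed
    have R: "\<bar>R\<bar> \<le> C * (norm B)\<^sup>2" unfolding R_def \<tau>_def using C(2)[OF u uB B] .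
    have \<rho>: "\<bar>\<rho>\<bar> \<le> 2 * \<phi>\<^sup>2" unfolding \<rho>_def w_def by (rule powr_one_minus_expansion[OF a \<phi>])
    have w0: "w \<ge> 0" by (simp add: w_def)
    have w2: "w \<le> 2"
    proof -
      have "\<phi>\<^sup>2 \<le> (1 / 2)\<^sup>2" using power_mono[OF \<phi>, of 2] by simp
      moreover have "\<bar>a * \<phi>\<bar> \<le> 1 * (1 / 2)" unfolding abs_mult using a \<phi> by (intro mult_mono) auto
      ultimately show ?thesis using \<rho> unfolding \<rho>_def by (simp add: power2_eq_square)
    qed
    have \<tau>: "\<bar>\<tau>\<bar> \<le> ?n * norm B" unfolding \<tau>_def by (rule abs_trace_le)
    have \<tau>_eq: "\<tau> = - (trace S + (?n - 1) * \<phi>)"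
    proof -
      have "B = (- 1) *\<^sub>R S + (- \<phi>) *\<^sub>R tangent_proj u" by (simp add: B_def)
      then show ?thesis
        unfolding \<tau>_def by (simp only: trace_add trace_scaleR trace_tangent_proj[OF u]) (simp add: algebra_simps)
    qed
    have "w * (c0 + c1 * \<tau> + R) = c0" using eq by (simp add: w_def R_def)
    \<comment> \<open>Beyond the linear part there remain R, the error \<rho> of the power, and one
      product of two first order terms; all are quadratically small.\<close>
    then have key: "c1 * \<tau> - a * c0 * \<phi> = - (R * w + \<rho> * (c0 + c1 * \<tau>) - a * \<phi> * (c1 * \<tau>))"
      unfolding \<rho>_def by (simp add: algebra_simps)
    have "c1 * (trace S + (?n - 1) * (1 + a / real m) * \<phi>) = - (c1 * \<tau> - a * c0 * \<phi>)"
    proof -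
      have "c1 * ((?n - 1) * (a / real m)) = a * c0"
      proof -
        have "c1 * ((?n - 1) * (a / real m)) = (real m * c0) * (a / real m)" unfolding c01 by simp
        then show ?thesis using m(1) by simp
      qed
      then have "c1 * ((?n - 1) * (a / real m)) * \<phi> = a * c0 * \<phi>" by simp
      then show ?thesis unfolding \<tau>_eq by (simp add: algebra_simps)
    qed
    then have "c1 * \<bar>trace S + (?n - 1) * (1 + a / real m) * \<phi>\<bar> = \<bar>R * w + \<rho> * (c0 + c1 * \<tau>) - a * \<phi> * (c1 * \<tau>)\<bar>"
      using c1 unfolding key by (metis abs_minus_cancel abs_mult abs_of_nonneg minus_minus order_trans zero_le_one)
    also have "\<dots> \<le> \<bar>R * w\<bar> + \<bar>\<rho> * (c0 + c1 * \<tau>)\<bar> + \<bar>a * \<phi> * (c1 * \<tau>)\<bar>" by linarith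
    also have "\<dots> \<le> C * (norm B)\<^sup>2 * 2 + 2 * \<phi>\<^sup>2 * (c0 + c1 * ?n) + 1 * \<bar>\<phi>\<bar> * (c1 * (?n * norm B))"
    proof (intro add_mono)
      show "\<bar>R * w\<bar> \<le> C * (norm B)\<^sup>2 * 2"
        unfolding abs_mult using R w0 w2 C(1) by (intro mult_mono) auto
      have "\<bar>\<tau>\<bar> \<le> ?n" using \<tau> mult_left_mono[OF B, of ?n] by linarith
      then have "\<bar>c1 * \<tau>\<bar> \<le> c1 * ?n" unfolding abs_mult using c1 by (intro mult_mono) auto
      then have "\<bar>c0 + c1 * \<tau>\<bar> \<le> c0 + c1 * ?n" using c0 by linarith
      then show "\<bar>\<rho> * (c0 + c1 * \<tau>)\<bar> \<le> 2 * \<phi>\<^sup>2 * (c0 + c1 * ?n)"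
        unfolding abs_mult using \<rho> by (intro mult_mono) auto
      show "\<bar>a * \<phi> * (c1 * \<tau>)\<bar> \<le> 1 * \<bar>\<phi>\<bar> * (c1 * (?n * norm B))"
        unfolding abs_mult using a c1 \<tau> by (intro mult_mono) auto
    qed
    also have "\<dots> \<le> C' * (norm B + \<bar>\<phi>\<bar>)\<^sup>2"
    proof -
      have 1: "(norm B)\<^sup>2 \<le> (norm B + \<bar>\<phi>\<bar>)\<^sup>2" by (intro power_mono) auto
      have 2: "\<phi>\<^sup>2 \<le> (norm B + \<bar>\<phi>\<bar>)\<^sup>2"
        using power_mono[of "\<bar>\<phi>\<bar>" "norm B + \<bar>\<phi>\<bar>" 2] by simp
      have 3: "\<bar>\<phi>\<bar> * norm B \<le> (norm B + \<bar>\<phi>\<bar>)\<^sup>2"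
        unfolding power2_eq_square by (intro mult_mono) auto
      have "c0 + c1 * ?n \<ge> 0" "c1 * ?n \<ge> 0" using c0 c1 by auto
      then have "2 * C * (norm B)\<^sup>2 + 2 * (c0 + c1 * ?n) * \<phi>\<^sup>2 + c1 * ?n * (\<bar>\<phi>\<bar> * norm B) \<le>
          2 * C * (norm B + \<bar>\<phi>\<bar>)\<^sup>2 + 2 * (c0 + c1 * ?n) * (norm B + \<bar>\<phi>\<bar>)\<^sup>2 + c1 * ?n * (norm B + \<bar>\<phi>\<bar>)\<^sup>2"
        using 1 2 3 C(1) by (intro add_mono mult_left_mono) auto
      then show ?thesis by (simp add: C'_def algebra_simps)
    qed
    finally show ?thesis
      using c1 mult_right_mono[OF c1, of "\<bar>trace S + (?n - 1) * (1 + a / real m) * \<phi>\<bar>"] by simp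
  qed
  then show ?thesis using C' unfolding c0_def by (intro exI[of _ C']) blast
qed

context zero_homogeneous
begin

text \<open>\<open>sphere_hessian\<close> of the function whose degree 0 extension is \<Phi>. It
  depends on H alone, hence the form \<open>zero_homogeneous.S2 H\<close> outside the
  locale.\<close>

definition S2 :: "real^'n \<Rightarrow> real^'n^'n" where
  "S2 u = tangent_proj u ** H u ** tangent_proj u"

lemma unit_nonzero: "norm u = 1 \<Longrightarrow> u \<noteq> (0 :: real^'n)" by auto

text \<open>By Euler's relations H maps u to -g u from either side, so the two projections leave
  only two rank one corrections.\<close>

lemma S2_eq:
  assumes u: "norm u = 1"
  shows "S2 u = H u + outer u (g u) + outer (g u) u"
proof -
  note u0 = unit_nonzero[OF u]
  have neg: "outer (- a) b = - outer a b" "outer a (- b) = - outer a b" for a b :: "real^'n"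
    by (simp_all add: outer_def vec_eq_iff)
  have z: "outer 0 b = 0" "outer b 0 = 0" for b :: "real^'n"
    by (simp_all add: outer_def vec_eq_iff)
  have gu: "g u \<bullet> u = 0" using g_radial[OF u0] .
  have "tangent_proj u ** H u = H u + outer u (g u)"
    unfolding tangent_proj_eq by (simp add: matrix_diff_rdistrib outer_mult_matrix H_radial_left[OF u0] neg)
  then show ?thesis
    unfolding S2_def tangent_proj_eq
    by (simp add: matrix_diff_ldistrib matrix_mult_outer matrix_vector_mult_add_rdistrib H_radial[OF u0]
        outer_mult_vec gu neg)
qed

lemma M2_unit:
  assumes u: "norm u = 1"
  shows "M2 u = S2 u + outer u (g u) + outer (g u) u + (2 * \<Phi> u) *\<^sub>R mat 1"
  using u by (simp add: vec_eq_iff S2_eq[OF u] M2_def norm_eq_1 algebra_simps)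

lemma S2_left: "norm u = 1 \<Longrightarrow> u v* S2 u = 0"
  using g_radial[OF unit_nonzero, of u]
  by (simp add: S2_eq vector_matrix_mult_add_rdistrib H_radial_left[OF unit_nonzero] outer_left norm_eq_1 inner_commute)

lemma trace_S2: "norm u = 1 \<Longrightarrow> trace (S2 u) = trace (M2 u) - 2 * real CARD('n) * \<Phi> u"
  using g_radial[OF unit_nonzero, of u]
  by (simp add: M2_unit trace_add trace_scaleR trace_I trace_outer inner_commute)

text \<open>Everything is recovered from \<open>M2\<close>: \<Phi> from u . M2 u = 2 \<Phi>, then g
  from M2 u = 2 \<Phi> u + g, then S2 by subtraction at the cost 1 + 3 + 3 + 2 n. The linearization
  error can thus be measured by |M2| alone, as \<open>rigidity\<close> demands.\<close>

lemma unit_bounds: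
  assumes u: "norm u = 1"
  shows "\<bar>\<Phi> u\<bar> \<le> norm (M2 u)" "norm (S2 u) \<le> (2 * real CARD('n) + 7) * norm (M2 u)"
proof -
  note u0 = unit_nonzero[OF u]
  have Mu: "norm (M2 u *v u) \<le> norm (M2 u)" using norm_matrix_vector_le[of "M2 u" u] u by simp
  have "2 * \<Phi> u = u \<bullet> (M2 u *v u)"
    using G2_inner[OF u0] u by (simp add: M2_radial[OF u0] norm_eq_1)
  then have "2 * \<bar>\<Phi> u\<bar> \<le> norm u * norm (M2 u *v u)"
    using Cauchy_Schwarz_ineq2[of u "M2 u *v u"] by simp
  then show \<Phi>: "\<bar>\<Phi> u\<bar> \<le> norm (M2 u)" using Mu u by simp
  have "g u = M2 u *v u - (2 * \<Phi> u) *\<^sub>R u"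
    using u by (simp add: M2_radial[OF u0] G2_def norm_eq_1)
  then have "norm (g u) \<le> norm (M2 u *v u) + 2 * \<bar>\<Phi> u\<bar>"
    using norm_triangle_ineq4[of "M2 u *v u" "(2 * \<Phi> u) *\<^sub>R u"] u by (simp add: abs_mult)
  then have g: "norm (g u) \<le> 3 * norm (M2 u)" using Mu \<Phi> by linarith
  have "S2 u = M2 u - (outer u (g u) + outer (g u) u + (2 * \<Phi> u) *\<^sub>R mat 1)"
    by (simp add: M2_unit[OF u])
  then have "norm (S2 u) \<le> norm (M2 u) + norm (outer u (g u) + outer (g u) u + (2 * \<Phi> u) *\<^sub>R (mat 1 :: real^'n^'n))"
    by (metis norm_triangle_ineq4)
  also have "\<dots> \<le> norm (M2 u) + (norm (outer u (g u)) + norm (outer (g u) u) + norm ((2 * \<Phi> u) *\<^sub>R (mat 1 :: real^'n^'n)))"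
    by (intro add_left_mono norm_triangle_le add_mono order_refl)
  also have "\<dots> \<le> norm (M2 u) + (3 * norm (M2 u) + 3 * norm (M2 u) + 2 * norm (M2 u) * real CARD('n))"
  proof (intro add_mono order_refl)
    show "norm (outer u (g u)) \<le> 3 * norm (M2 u)" "norm (outer (g u) u) \<le> 3 * norm (M2 u)"
      using g u by (simp_all add: norm_outer)
    have "2 * \<bar>\<Phi> u\<bar> * norm (mat 1 :: real^'n^'n) \<le> 2 * norm (M2 u) * real CARD('n)"
      using \<Phi> norm_mat_1_le[where 'n = 'n] by (intro mult_mono) auto
    then show "norm ((2 * \<Phi> u) *\<^sub>R (mat 1 :: real^'n^'n)) \<le> 2 * norm (M2 u) * real CARD('n)"
      by (simp add: abs_mult)
  qed
  finally show "norm (S2 u) \<le> (2 * real CARD('n) + 7) * norm (M2 u)" by (simp add: algebra_simps)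
qed

end

text \<open>The linearization error is C b^2 with b the size of the deviation. One factor b is at
  most K \<eta> by smallness in C2, the other at most K |M2|; \<eta> is chosen so that the product
  is at most \<epsilon> |M2|.\<close>

theorem rigidity_esym:
  fixes a :: real
  assumes m: "1 \<le> m" "m < CARD('n)" and a: "0 < a" "a \<le> 1"
  shows "\<exists>\<eta>>0. \<forall>\<Phi> g (H :: real^'n \<Rightarrow> real^'n^'n). zero_homogeneous \<Phi> g H \<longrightarrow> (\<forall>x. \<Phi> (- x) = \<Phi> x) \<longrightarrow>
    (\<forall>u. norm u = 1 \<longrightarrow> \<bar>\<Phi> u\<bar> \<le> \<eta> \<and> norm (g u) \<le> \<eta> \<and> norm (zero_homogeneous.S2 H u) \<le> \<eta>) \<longrightarrow>
    (\<forall>u. norm u = 1 \<longrightarrow> (1 - \<Phi> u) powr a *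
       esym m (tangent_proj u + - (zero_homogeneous.S2 H u + \<Phi> u *\<^sub>R tangent_proj u)) =
       real ((CARD('n) - 1) choose m)) \<longrightarrow>
    (\<forall>x. x \<noteq> 0 \<longrightarrow> \<Phi> x = 0)"
proof -
  let ?n = "real CARD('n)"
  define lam where "lam = (?n - 1) * (1 + a / real m)"
  obtain C where C: "C \<ge> 0" "\<And>u (S :: real^'n^'n) \<phi>. norm u = 1 \<Longrightarrow> u v* S = 0 \<Longrightarrow>
    norm (- (S + \<phi> *\<^sub>R tangent_proj u)) \<le> 1 \<Longrightarrow> \<bar>\<phi>\<bar> \<le> 1 / 2 \<Longrightarrow>
    (1 - \<phi>) powr a * esym m (tangent_proj u + - (S + \<phi> *\<^sub>R tangent_proj u)) = real ((CARD('n) - 1) choose m) \<Longrightarrow>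
    \<bar>trace S + lam * \<phi>\<bar> \<le> C * (norm (- (S + \<phi> *\<^sub>R tangent_proj u)) + \<bar>\<phi>\<bar>)\<^sup>2"
    using linearized_equation[OF m a] unfolding lam_def by metis
  have n2: "?n \<ge> 2" using m by linarith
  have lam: "1 \<le> lam" "lam \<le> 2 * ?n - 2"
  proof -
    have "1 * 1 \<le> lam" unfolding lam_def using n2 a m by (intro mult_mono) auto
    then show "1 \<le> lam" by simp
    have "a / real m \<le> 1" using a m by (simp add: divide_le_eq)
    then have "lam \<le> (?n - 1) * (1 + 1)" unfolding lam_def using n2 by (intro mult_left_mono) auto
    then show "lam \<le> 2 * ?n - 2" by simp
  qed
  \<comment> \<open>7^2 = 49 exceeds the 48 of \<open>rigidity\<close>, and n^3 matches the power
    there.\<close>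
  define \<epsilon> where "\<epsilon> = 1 / (7 * ?n ^ 3)"
  have n31: "1 \<le> ?n ^ 3" using n2 by (intro one_le_power) auto
  have eps: "0 < \<epsilon>" using n31 by (simp add: \<epsilon>_def)
  have eps2: "48 * ?n ^ 3 * \<epsilon>\<^sup>2 \<le> 1"
  proof -
    have "48 * N * (1 / (7 * N))\<^sup>2 \<le> 1" if "N \<ge> 1" for N :: real
      using that mult_left_mono[of 1 N N] by (simp add: power2_eq_square divide_simps)
    then show ?thesis using n31 unfolding \<epsilon>_def by blast
  qed
  \<comment> \<open>The three summands bound S2, \<Phi> times the projection, and \<Phi> in terms of
    |M2|. The same K exceeds n + 3, the factor of \<eta> in the bound of b by smallness.\<close>
  define K where "K = (2 * ?n + 7) + (?n + 1) + 1"
  have K: "K \<ge> 1" using n2 by (simp add: K_def)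
  define \<eta> where "\<eta> = \<epsilon> / (2 * K * K * (C + 1))"
  have \<eta>: "\<eta> > 0" using eps K C(1) by (simp add: \<eta>_def)
  have \<eta>K: "(C + 1) * (K * K) * \<eta> \<le> \<epsilon>"
    using K C(1) eps by (simp add: \<eta>_def)
  have \<epsilon>1: "\<epsilon> \<le> 1 / 2" unfolding \<epsilon>_def by (rule frac_le) (use n31 in linarith)+
  have K\<eta>: "K * \<eta> \<le> \<epsilon>"
  proof -
    have "1 * (1 * K) * \<eta> \<le> (C + 1) * (K * K) * \<eta>"
      using K C(1) \<eta> by (intro mult_right_mono mult_mono) auto
    then show ?thesis using \<eta>K by simp
  qed
  have "1 * \<eta> \<le> K * \<eta>" using K \<eta> by (intro mult_right_mono) auto
  then have \<eta>\<epsilon>: "\<eta> \<le> \<epsilon>" using K\<eta> by linarith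
  show ?thesis
  proof (intro exI[of _ \<eta>] conjI allI impI \<eta>)
    fix \<Phi> g and H :: "real^'n \<Rightarrow> real^'n^'n" and x :: "real^'n"
    assume zh: "zero_homogeneous \<Phi> g H" and even: "\<forall>x. \<Phi> (- x) = \<Phi> x"
      and small: "\<forall>u. norm u = 1 \<longrightarrow> \<bar>\<Phi> u\<bar> \<le> \<eta> \<and> norm (g u) \<le> \<eta> \<and> norm (zero_homogeneous.S2 H u) \<le> \<eta>"
      and pde: "\<forall>u. norm u = 1 \<longrightarrow> (1 - \<Phi> u) powr a *
       esym m (tangent_proj u + - (zero_homogeneous.S2 H u + \<Phi> u *\<^sub>R tangent_proj u)) =
       real ((CARD('n) - 1) choose m)" and x: "x \<noteq> 0"
    interpret zero_homogeneous \<Phi> g H by (rule zh)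
    have unit: "\<bar>trace (M2 u) - 2 * ?n * \<Phi> u + lam * \<Phi> u\<bar> \<le> \<epsilon> * norm (M2 u)" if u: "norm u = 1" for u
    proof -
      define b where "b = norm (- (S2 u + \<Phi> u *\<^sub>R tangent_proj u)) + \<bar>\<Phi> u\<bar>"
      have bS: "b \<le> norm (S2 u) + \<bar>\<Phi> u\<bar> * (?n + 1) + \<bar>\<Phi> u\<bar>"
      proof -
        have "norm (- (S2 u + \<Phi> u *\<^sub>R tangent_proj u)) \<le> norm (S2 u) + \<bar>\<Phi> u\<bar> * norm (tangent_proj u)"
          using norm_triangle_ineq[of "S2 u" "\<Phi> u *\<^sub>R tangent_proj u"] unfolding norm_minus_cancel by simp
        also have "\<dots> \<le> norm (S2 u) + \<bar>\<Phi> u\<bar> * (?n + 1)"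
          by (intro add_left_mono mult_left_mono norm_tangent_proj_le u) auto
        finally show ?thesis by (simp add: b_def)
      qed
      have s: "\<bar>\<Phi> u\<bar> \<le> \<eta>" "norm (S2 u) \<le> \<eta>" using small u by auto
      have "b \<le> \<eta> + \<eta> * (?n + 1) + \<eta>"
        using s by (intro order_trans[OF bS] add_mono mult_right_mono) auto
      also have "\<dots> \<le> K * \<eta>" using \<eta> n2 by (simp add: K_def algebra_simps)
      finally have b\<eta>: "b \<le> K * \<eta>" .
      have "\<bar>\<Phi> u\<bar> * (?n + 1) \<le> norm (M2 u) * (?n + 1)"
        using unit_bounds(1)[OF u] by (intro mult_right_mono) auto
      then have "b \<le> (2 * ?n + 7) * norm (M2 u) + norm (M2 u) * (?n + 1) + norm (M2 u)"
        using bS unit_bounds[OF u] by linarith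
      then have bM: "b \<le> K * norm (M2 u)" by (simp add: K_def algebra_simps)
      have b0: "0 \<le> b" by (simp add: b_def)
      have "\<bar>trace (S2 u) + lam * \<Phi> u\<bar> \<le> C * b\<^sup>2"
        unfolding b_def
      proof (rule C(2)[OF u S2_left[OF u]])
        show "norm (- (S2 u + \<Phi> u *\<^sub>R tangent_proj u)) \<le> 1"
          using b\<eta> K\<eta> \<epsilon>1 unfolding b_def by linarith
        show "\<bar>\<Phi> u\<bar> \<le> 1 / 2" using s(1) \<eta>\<epsilon> \<epsilon>1 by linarith
      qed (use pde u in blast)
      also have "\<dots> \<le> (C + 1) * ((K * \<eta>) * (K * norm (M2 u)))"
        unfolding power2_eq_square using b\<eta> bM b0 C(1) K \<eta> by (intro mult_mono) auto
      also have "\<dots> = (C + 1) * (K * K) * \<eta> * norm (M2 u)" by simp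
      also have "\<dots> \<le> \<epsilon> * norm (M2 u)" using \<eta>K by (intro mult_right_mono) auto
      finally show ?thesis by (simp add: trace_S2[OF u])
    qed
    show "\<Phi> x = 0"
    proof (rule rigidity[OF _ _ lam _ eps2 _ x])
      show "2 \<le> CARD('n)" using m by simp
      show "0 \<le> \<epsilon>" using eps by simp
      show "\<Phi> (- x) = \<Phi> x" for x using even by blast
      fix y :: "real^'n" assume y: "y \<noteq> 0"
      \<comment> \<open>\<open>M2\<close> and \<Phi> have degree 0, so the inequality on the sphere
        holds at every y.\<close>
      define c where "c = inverse (norm y)"
      have c: "c > 0" "norm (c *\<^sub>R y) = 1" using y by (simp_all add: c_def)
      from unit[OF c(2)] show "\<bar>trace (M2 y) - 2 * ?n * \<Phi> y + lam * \<Phi> y\<bar> \<le> \<epsilon> * norm (M2 y)"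
        unfolding M2_hom[OF c(1)] hom[OF c(1)] .
    qed
  qed
qed

section \<open>Change of variables\<close>

text \<open>The change of variables formula of the library needs a well-ordered index type; a copy of
  the index type is ordered through an enumeration.\<close>

typedef 'a wo = "UNIV :: 'a set" morphisms of_wo to_wo by simp

lemma of_wo_to_wo [simp]: "of_wo (to_wo x) = x"
  by (simp add: to_wo_inverse)

lemma to_wo_of_wo [simp]: "to_wo (of_wo x) = x"
  by (simp add: of_wo_inverse)

lemma bij_of_wo: "bij of_wo"
  by (rule bijI') (auto simp: of_wo_inject intro: of_wo_to_wo[symmetric])

lemma bij_to_wo: "bij to_wo"
  by (rule bijI') (auto simp: to_wo_inject intro: to_wo_of_wo[symmetric])

instance wo :: (finite) finite
proof
  have "finite (range (to_wo :: 'a \<Rightarrow> 'a wo))" by simp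
  then show "finite (UNIV :: 'a wo set)" unfolding bij_is_surj[OF bij_to_wo] .
qed

instantiation wo :: (countable) wellorder
begin

definition less_eq_wo :: "'a wo \<Rightarrow> 'a wo \<Rightarrow> bool" where
  "x \<le> y \<longleftrightarrow> to_nat (of_wo x) \<le> to_nat (of_wo y)"

definition less_wo :: "'a wo \<Rightarrow> 'a wo \<Rightarrow> bool" where
  "x < y \<longleftrightarrow> to_nat (of_wo x) < to_nat (of_wo y)"

instance
proof
  fix P :: "'a wo \<Rightarrow> bool" and a :: "'a wo"
  assume step: "\<And>x. (\<And>y. y < x \<Longrightarrow> P y) \<Longrightarrow> P x"
  show "P a"
    by (induction a rule: measure_induct_rule[of "\<lambda>x. to_nat (of_wo x)"])
       (auto intro: step simp: less_wo_def)
qed (auto simp: less_eq_wo_def less_wo_def of_wo_inject)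

end

definition reindex :: "real^'n \<Rightarrow> real^('n wo)" where
  "reindex x = (\<chi> i. x $ of_wo i)"

definition unreindex :: "real^('n wo) \<Rightarrow> real^'n" where
  "unreindex y = (\<chi> i. y $ to_wo i)"

lemma reindex_inverse [simp]: "unreindex (reindex x) = x" "reindex (unreindex y) = y"
  by (simp_all add: reindex_def unreindex_def vec_eq_iff)

lemma linear_reindex: "linear reindex" "linear unreindex"
  by (auto intro!: linearI simp: reindex_def unreindex_def vec_eq_iff)

lemma reindex_measurable [measurable]: "reindex \<in> borel_measurable borel" "unreindex \<in> borel_measurable borel"
  by (intro borel_measurable_continuous_onI linear_continuous_on linear_conv_bounded_linear[THEN iffD1] linear_reindex)+

lemma prod_Basis_vec:
  fixes x :: "real^'n"
  shows "(\<Prod>b\<in>Basis. x \<bullet> b) = (\<Prod>i\<in>UNIV. x $ i)"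
proof -
  have "(Basis :: (real^'n) set) = range (\<lambda>i. axis i 1)" by (auto simp: Basis_vec_def)
  then have "(\<Prod>b\<in>Basis. x \<bullet> b) = (\<Prod>b\<in>range (\<lambda>i. axis i 1). x \<bullet> b)" by simp
  also have "\<dots> = (\<Prod>i\<in>UNIV. x \<bullet> axis i 1)"
    by (subst prod.reindex) (auto simp: inj_def axis_eq_axis)
  finally show ?thesis by (simp add: inner_axis)
qed

text \<open>The preimage of a box is a box with relabelled sides, hence of the same volume, and
  Lebesgue measure is determined by boxes.\<close>

lemma lborel_reindex: "distr lborel borel reindex = (lborel :: (real^('n::finite wo)) measure)"
proof (rule lborel_eqI[symmetric])
  fix l u :: "real^('n wo)"
  assume le: "\<And>b. b \<in> Basis \<Longrightarrow> l \<bullet> b \<le> u \<bullet> b"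
  then have le': "l $ i \<le> u $ i" for i
    using le[of "axis i 1"] by (simp add: inner_axis axis_in_Basis_iff)
  have "reindex -` box l u = box (unreindex l) (unreindex u)"
  proof (intro set_eqI iffI)
    fix x assume "x \<in> reindex -` box l u"
    then have "l $ i < x $ of_wo i \<and> x $ of_wo i < u $ i" for i by (auto simp: mem_box_cart reindex_def)
    from this[of "to_wo _"] show "x \<in> box (unreindex l) (unreindex u)"
      by (auto simp: mem_box_cart unreindex_def)
  next
    fix x assume "x \<in> box (unreindex l) (unreindex u)"
    then have "l $ to_wo i < x $ i \<and> x $ i < u $ to_wo i" for i by (auto simp: mem_box_cart unreindex_def)
    from this[of "of_wo _"] show "x \<in> reindex -` box l u"
      by (auto simp: mem_box_cart reindex_def)
  qed
  then have "emeasure (distr lborel borel reindex) (box l u) = emeasure lborel (box (unreindex l) (unreindex u))"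
    by (simp add: emeasure_distr)
  also have "\<dots> = ennreal (\<Prod>b\<in>Basis. (unreindex u - unreindex l) \<bullet> b)"
  proof (rule emeasure_lborel_box)
    fix b :: "real^'n" assume "b \<in> Basis"
    then obtain i where "b = axis i 1" by (auto simp: Basis_vec_def)
    then show "unreindex l \<bullet> b \<le> unreindex u \<bullet> b" using le' by (simp add: inner_axis unreindex_def)
  qed
  also have "(\<Prod>b\<in>Basis. (unreindex u - unreindex l) \<bullet> b) = (\<Prod>i\<in>UNIV. u $ to_wo i - l $ to_wo i)"
    unfolding prod_Basis_vec by (simp add: unreindex_def)
  also have "\<dots> = (\<Prod>i\<in>UNIV. u $ i - l $ i)"
    by (rule prod.reindex_bij_betw[OF bij_to_wo])
  also have "\<dots> = (\<Prod>b\<in>Basis. (u - l) \<bullet> b)"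
    unfolding prod_Basis_vec by simp
  finally show "emeasure (distr lborel borel reindex) (box l u) = (\<Prod>b\<in>Basis. (u - l) \<bullet> b)" .
qed simp

text \<open>Conjugation by a bijection sends transpositions to transpositions, so the parity of a
  permutation, and with it the determinant, survives relabelling.\<close>

lemma swapidseq_conj:
  assumes "swapidseq k p" and f: "bij f" and g: "\<And>x. g (f x) = x" "\<And>y. f (g y) = y"
  shows "swapidseq k (f \<circ> p \<circ> g)"
  using assms(1)
proof (induction rule: swapidseq.induct)
  case id
  have "f \<circ> id \<circ> g = id" using g by auto
  then show ?case by (metis swapidseq.id)
next
  case (comp_Suc k p a b)
  have "f (Transposition.transpose a b x) = Transposition.transpose (f a) (f b) (f x)" for x
    by (simp add: Transposition.transpose_def inj_eq[OF bij_is_inj[OF f]])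
  then have "f \<circ> (Transposition.transpose a b \<circ> p) \<circ> g = Transposition.transpose (f a) (f b) \<circ> (f \<circ> p \<circ> g)"
    by (auto simp: fun_eq_iff)
  moreover have "f a \<noteq> f b" using comp_Suc f by (auto simp: bij_def inj_def)
  ultimately show ?case using comp_Suc by (metis swapidseq.comp_Suc)
qed

lemma det_reindex:
  fixes A :: "real^'n^'n"
  shows "det (\<chi> i j. A $ of_wo i $ of_wo j) = det A"
proof -
  define c where "c p = to_wo \<circ> p \<circ> of_wo" for p :: "'n \<Rightarrow> 'n"
  define c' where "c' p = of_wo \<circ> p \<circ> to_wo" for p :: "'n wo \<Rightarrow> 'n wo"
  have c_perm: "c p permutes UNIV" if "p permutes UNIV" for p
    unfolding c_def
    by (rule bij_imp_permutes[of _ UNIV])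
       (use bij_comp[OF bij_of_wo bij_comp[OF permutes_bij[OF that] bij_to_wo]] in \<open>auto simp: o_assoc\<close>)
  have c'_perm: "c' p permutes UNIV" if "p permutes UNIV" for p
    unfolding c'_def
    by (rule bij_imp_permutes[of _ UNIV])
       (use bij_comp[OF bij_to_wo bij_comp[OF permutes_bij[OF that] bij_of_wo]] in \<open>auto simp: o_assoc\<close>)
  have sign: "sign (c p) = sign p" if "p permutes UNIV" for p
  proof -
    have "permutation p" using that finite permutation_permutes by blast
    then obtain k where k: "swapidseq k p" unfolding permutation_def by blast
    then have "swapidseq k (c p)" unfolding c_def by (rule swapidseq_conj[OF _ bij_to_wo]) auto
    then have "evenperm (c p) = evenperm p"
      using evenperm_unique[OF k] evenperm_unique by metis
    then show ?thesis by (simp add: sign_def)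
  qed
  have "det A = (\<Sum>p | p permutes (UNIV :: 'n set). of_int (sign (c p)) * (\<Prod>i\<in>UNIV. A $ of_wo i $ of_wo (c p i)))"
    unfolding det_def
  proof (rule sum.cong)
    fix p :: "'n \<Rightarrow> 'n" assume "p \<in> {p. p permutes UNIV}"
    moreover have "(\<Prod>i\<in>UNIV. A $ of_wo i $ of_wo (c p i)) = (\<Prod>i\<in>UNIV. A $ i $ p i)"
      unfolding c_def o_def of_wo_to_wo by (rule prod.reindex_bij_betw[OF bij_of_wo])
    ultimately show "of_int (sign p) * (\<Prod>i\<in>UNIV. A $ i $ p i) =
        of_int (sign (c p)) * (\<Prod>i\<in>UNIV. A $ of_wo i $ of_wo (c p i))"
      using sign by simp
  qed simp
  also have "\<dots> = (\<Sum>p | p permutes (UNIV :: 'n wo set). of_int (sign p) * (\<Prod>i\<in>UNIV. A $ of_wo i $ of_wo (p i)))"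
    by (rule sum.reindex_bij_witness[of _ c' c]) (auto simp: c_perm c'_perm, auto simp: c_def c'_def o_def)
  also have "\<dots> = det (\<chi> i j. A $ of_wo i $ of_wo j)" by (simp add: det_def)
  finally show ?thesis ..
qed

text \<open>F is conjugated with the relabelling, under which volume and determinant are invariant.
  \<open>J\<close> is a Borel function on the whole space that agrees with the Jacobian on S, so the
  result is a nonnegative integral although A itself is an arbitrary function.\<close>

theorem emeasure_differentiable_image:
  fixes F :: "real^'n \<Rightarrow> real^'n"
  assumes S: "S \<in> sets borel" and FS: "F ` S \<in> sets borel" and fin: "emeasure lborel (F ` S) < \<infinity>"
    and D: "\<And>x. x \<in> S \<Longrightarrow> (F has_derivative (\<lambda>h. A x *v h)) (at x)" and inj: "inj_on F S"
    and J: "J \<in> borel_measurable borel" "\<And>x. 0 \<le> J x" "\<And>x. x \<in> S \<Longrightarrow> J x = \<bar>det (A x)\<bar>"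
  shows "emeasure lborel (F ` S) = (\<integral>\<^sup>+x. ennreal (indicator S x * J x) \<partial>lborel)"
proof -
  define R where "R = (reindex :: real^'n \<Rightarrow> _)"
  define R' where "R' = (unreindex :: _ \<Rightarrow> real^'n)"
  have RR: "R' (R x) = x" "R (R' y) = y" for x y by (simp_all add: R_def R'_def)
  have [measurable]: "R \<in> borel_measurable borel" "R' \<in> borel_measurable borel"
    by (simp_all add: R_def R'_def)
  note [measurable] = J(1) S
  define F' where "F' = R \<circ> F \<circ> R'"
  define T where "T = R ` S"
  have vim: "R ` X = R' -` X" for X
  proof (intro set_eqI iffI)
    fix y assume "y \<in> R' -` X"
    then have "R (R' y) \<in> R ` X" by blast
    then show "y \<in> R ` X" by (simp add: RR)
  qed (auto simp: RR)
  have borel_image: "R ` X \<in> sets borel" if "X \<in> sets borel" for X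
    unfolding vim using measurable_sets[OF \<open>R' \<in> borel_measurable borel\<close> that] by simp
  have em: "emeasure lborel (R ` X) = emeasure lborel X" if "X \<in> sets borel" for X
  proof -
    have "emeasure lborel (R ` X) = emeasure (distr lborel borel R) (R ` X)"
      unfolding R_def lborel_reindex ..
    also have "\<dots> = emeasure lborel (R -` (R ` X))"
      using borel_image[OF that] by (simp add: emeasure_distr)
    also have "R -` (R ` X) = X" unfolding vim by (auto simp: RR)
    finally show ?thesis .
  qed
  have T: "T \<in> sets borel" unfolding T_def by (rule borel_image[OF S])
  have FT: "F' ` T = R ` (F ` S)" by (force simp: F'_def T_def RR image_iff)
  define A' where "A' y = (\<chi> i j. A (R' y) $ of_wo i $ of_wo j)" for y
  have D': "(F' has_derivative (\<lambda>h. A' y *v h)) (at y within T)" if "y \<in> T" for y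
  proof -
    have blR: "bounded_linear R" "bounded_linear R'"
      using linear_reindex by (simp_all add: R_def R'_def linear_conv_bounded_linear)
    have "R' y \<in> S" using that RR by (auto simp: T_def)
    then have "((\<lambda>y. F (R' y)) has_derivative (\<lambda>h. A (R' y) *v R' h)) (at y)"
      by (intro has_derivative_compose[OF bounded_linear_imp_has_derivative[OF blR(2)] D])
    then have "((\<lambda>y. R (F (R' y))) has_derivative (\<lambda>h. R (A (R' y) *v R' h))) (at y)"
      by (rule bounded_linear.has_derivative[OF blR(1)])
    moreover have "R (A (R' y) *v R' h) = A' y *v h" for h
    proof -
      have "(\<Sum>j\<in>UNIV. A (R' y) $ of_wo i $ j * h $ to_wo j) = (\<Sum>j\<in>UNIV. A (R' y) $ of_wo i $ of_wo j * h $ j)" for i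
        by (rule sum.reindex_bij_witness[of _ of_wo to_wo]) auto
      then show ?thesis
        by (simp add: vec_eq_iff R_def R'_def reindex_def unreindex_def matrix_vector_mult_def A'_def)
    qed
    ultimately show ?thesis
      by (simp add: F'_def o_def has_derivative_at_withinI)
  qed
  have inj': "inj_on F' T"
  proof (rule inj_onI)
    fix x y assume "x \<in> T" "y \<in> T" "F' x = F' y"
    then have "F (R' x) = F (R' y)" "R' x \<in> S" "R' y \<in> S" using RR by (auto simp: F'_def T_def dest: arg_cong[of _ _ R'])
    then show "x = y" using inj RR by (metis inj_onD)
  qed
  have FTm: "F' ` T \<in> sets borel" unfolding FT by (rule borel_image[OF FS])
  have emFT: "emeasure lborel (F' ` T) = emeasure lborel (F ` S)"
    unfolding FT by (rule em[OF FS])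
  have lm: "F' ` T \<in> lmeasurable"
    using FTm fin emFT by (intro fmeasurableI) (auto simp: less_top[symmetric])
  define I where "I = measure lebesgue (F' ` T)"
  have mat: "matrix (\<lambda>h. A' y *v h) = A' y" for y by (simp add: matrix_of_matrix_vector_mul)
  have "((\<lambda>y. \<bar>det (matrix (\<lambda>h. A' y *v h))\<bar>) has_integral I) T"
    using has_measure_differentiable_image[OF _ D' inj', of I] T lm by (auto simp: I_def)
  then have "((\<lambda>y. J (R' y)) has_integral I) T"
  proof (rule has_integral_eq[rotated])
    fix y assume "y \<in> T"
    then have "R' y \<in> S" using RR by (auto simp: T_def)
    then show "\<bar>det (matrix (\<lambda>h. A' y *v h))\<bar> = J (R' y)"
      unfolding mat by (simp add: A'_def det_reindex J(3))
  qed
  then have "((\<lambda>y. if y \<in> T then J (R' y) else 0) has_integral I) UNIV"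
    by (simp only: has_integral_restrict_UNIV)
  then have hi: "((\<lambda>y. indicator S (R' y) * J (R' y)) has_integral I) UNIV"
    by (rule has_integral_eq[rotated]) (auto simp: T_def vim)
  have "(\<integral>\<^sup>+y. ennreal (indicator S (R' y) * J (R' y)) \<partial>lborel) = ennreal I"
    by (rule nn_integral_has_integral_lborel[OF _ _ hi]) (use J(2) in \<open>auto simp: indicator_def\<close>)
  moreover have "(\<integral>\<^sup>+y. ennreal (indicator S (R' y) * J (R' y)) \<partial>lborel) =
      (\<integral>\<^sup>+y. ennreal (indicator S (R' y) * J (R' y)) \<partial>distr lborel borel R)"
    unfolding R_def lborel_reindex ..
  moreover have "\<dots> = (\<integral>\<^sup>+x. ennreal (indicator S x * J x) \<partial>lborel)"
    by (subst nn_integral_distr) (auto simp: RR)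
  moreover have "ennreal I = emeasure lborel (F ` S)"
  proof -
    have "ennreal I = emeasure lebesgue (F' ` T)"
      unfolding I_def using lm by (intro emeasure_eq_measure2[symmetric]) (auto simp: fmeasurable_def)
    also have "\<dots> = emeasure lborel (F' ` T)" using FTm by simp
    finally show ?thesis using emFT by simp
  qed
  ultimately show ?thesis by simp
qed

section \<open>Support functions and area measures\<close>

lemma inner_le_support_fun:
  assumes "compact K" "y \<in> K"
  shows "x \<bullet> y \<le> support_fun K x"
proof -
  have "compact ((\<lambda>y. x \<bullet> y) ` K)"
    by (intro compact_continuous_image continuous_intros assms)
  then have "bdd_above ((\<lambda>y. x \<bullet> y) ` K)"
    by (intro bounded_imp_bdd_above compact_imp_bounded)
  then show ?thesis unfolding support_fun_def using assms(2) by (rule cSUP_upper[rotated])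
qed

text \<open>\<Phi> is the degree 0 extension of the deviation of K from the ball; the support
  function itself has degree 1, hence the factor \<open>norm x\<close>.\<close>

locale smooth_support = zero_homogeneous \<Phi> g H
  for \<Phi> :: "real^'n \<Rightarrow> real" and g :: "real^'n \<Rightarrow> real^'n" and H :: "real^'n \<Rightarrow> real^'n^'n" +
  fixes K :: "(real^'n) set"
  assumes body: "convex_body K"
    and support: "\<And>x. x \<noteq> 0 \<Longrightarrow> support_fun K x = norm x * (1 - \<Phi> x)"
begin

lemma K: "K \<noteq> {}" "compact K" "convex K" "closed K"
  using body by (auto simp: convex_body_def compact_imp_closed)

lemma inner_le_support: "y \<in> K \<Longrightarrow> x \<bullet> y \<le> support_fun K x"
  by (rule inner_le_support_fun[OF K(2)])

lemma support_attained: obtains y where "y \<in> K" "x \<bullet> y = support_fun K x"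
proof -
  obtain y where y: "y \<in> K" "\<And>z. z \<in> K \<Longrightarrow> x \<bullet> z \<le> x \<bullet> y"
  proof -
    have "continuous_on K (\<lambda>y. x \<bullet> y)" by (intro continuous_intros)
    from continuous_attains_sup[OF K(2,1) this] show ?thesis using that by blast
  qed
  then have "support_fun K x \<le> x \<bullet> y"
    unfolding support_fun_def by (intro cSUP_least K) auto
  then show ?thesis using that[of y] y inner_le_support[OF y(1), of x] by simp
qed

text \<open>The gradient of the support function, as \<open>D_support\<close> confirms: G x is the
  boundary point of K with outer normal x, so G is the reverse Gauss map.\<close>

definition G :: "real^'n \<Rightarrow> real^'n" where
  "G x = ((1 - \<Phi> x) * inverse (norm x)) *\<^sub>R x - norm x *\<^sub>R g x"

lemma D_support:
  assumes "x \<noteq> 0"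
  shows "(support_fun K has_derivative (\<lambda>v. G x \<bullet> v)) (at x)"
proof -
  have "((\<lambda>x. norm x * (1 - \<Phi> x)) has_derivative
      (\<lambda>v. norm x * (0 - g x \<bullet> v) + (sgn x \<bullet> v) * (1 - \<Phi> x))) (at x)"
    using assms has_derivative_norm[OF assms]
    by (intro has_derivative_mult has_derivative_diff has_derivative_const D_\<Phi>) (simp_all add: inner_commute)
  then have "(support_fun K has_derivative
      (\<lambda>v. norm x * (0 - g x \<bullet> v) + (sgn x \<bullet> v) * (1 - \<Phi> x))) (at x)"
    by (rule has_derivative_transform_within_open[of _ _ _ _ "- {0}"]) (use assms support in auto)
  then show ?thesis
    by (rule has_derivative_eq_rhs)
       (auto simp: fun_eq_iff G_def sgn_div_norm inner_diff_left algebra_simps divide_inverse)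
qed

text \<open>The function h(v) - v . y, with h the support function, is nonnegative and vanishes at
  x. So x is a minimum, and the gradient G x - y is zero there.\<close>

lemma support_point_unique:
  assumes x: "x \<noteq> 0" and y: "y \<in> K" "x \<bullet> y = support_fun K x"
  shows "y = G x"
proof -
  have "((\<lambda>v. support_fun K v - v \<bullet> y) has_derivative (\<lambda>v. G x \<bullet> v - v \<bullet> y)) (at x)"
    by (intro has_derivative_diff D_support[OF x] bounded_linear_imp_has_derivative bounded_linear_inner_left)
  then have eq: "(\<lambda>v. G x \<bullet> v - v \<bullet> y) = (\<lambda>v. 0)"
    by (rule differential_zero_maxmin[of x UNIV, rotated 2]) (use inner_le_support[OF y(1)] y(2) in auto)
  have "\<forall>v. y \<bullet> v = G x \<bullet> v" using fun_cong[OF eq] by (simp add: inner_commute)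
  then show ?thesis by (simp only: vector_eq_rdot)
qed

lemma G_in: "x \<noteq> 0 \<Longrightarrow> G x \<in> K" and inner_G: "x \<noteq> 0 \<Longrightarrow> x \<bullet> G x = support_fun K x"
  using support_attained[of x] support_point_unique[of x] by metis+

text \<open>Leaves K at G x along the normal x. The distance reached is |x|, so local parallel sets
  are images of sectors, and F is a bijection from the punctured space onto the complement of
  K.\<close>

definition F :: "real^'n \<Rightarrow> real^'n" where "F x = G x + x"

lemma closest_point_F:
  assumes x: "x \<noteq> 0"
  shows "closest_point K (F x) = G x"
proof (rule closest_point_unique[OF K(3,4) G_in[OF x], symmetric], rule ballI)
  fix z assume z: "z \<in> K"
  have "0 \<le> x \<bullet> (G x - z)"
    using inner_le_support[OF z, of x] inner_G[OF x] by (simp add: inner_diff_right)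
  moreover have "(norm (x + (G x - z)))\<^sup>2 = (norm x)\<^sup>2 + 2 * (x \<bullet> (G x - z)) + (norm (G x - z))\<^sup>2"
    by (simp add: power2_norm_eq_inner inner_add_left inner_add_right inner_commute)
  ultimately have "(norm x)\<^sup>2 \<le> (norm (x + (G x - z)))\<^sup>2" by simp
  then have "norm x \<le> norm (x + (G x - z))" by (rule power2_le_imp_le) simp
  then show "dist (F x) (G x) \<le> dist (F x) z" by (simp add: F_def dist_norm algebra_simps)
qed

lemma infdist_closest: "infdist z K = norm (z - closest_point K z)"
  using setdist_closest_point[OF K(4,1), of z] by (simp add: infdist_eq_setdist dist_norm)

text \<open>By the obtuse angle property of the metric projection, the foot point of z maximizes the
  scalar product with z - \<open>closest_point K z\<close> over K; it is therefore the unique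
  support point in that direction.\<close>

lemma F_surj:
  assumes "z \<notin> K"
  shows "z - closest_point K z \<noteq> 0" "F (z - closest_point K z) = z"
proof -
  let ?c = "closest_point K z"
  let ?x = "z - ?c"
  have c: "?c \<in> K" by (rule closest_point_in_set[OF K(4,1)])
  show x: "?x \<noteq> 0" using assms c by auto
  have "?x \<bullet> y \<le> ?x \<bullet> ?c" if "y \<in> K" for y
    using closest_point_dot[OF K(3,4) that, of z] by (simp add: inner_diff_right)
  then have "support_fun K ?x \<le> ?x \<bullet> ?c"
    unfolding support_fun_def by (intro cSUP_least K) auto
  then have "?x \<bullet> ?c = support_fun K ?x" using inner_le_support[OF c, of ?x] by simp
  then have "?c = G ?x" by (rule support_point_unique[OF x c])
  then have "F ?x = ?c + ?x" by (simp add: F_def)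
  then show "F ?x = z" by simp
qed

lemma inj_F: "inj_on F (- {0})"
proof (rule inj_onI)
  fix x y assume "x \<in> - {0}" "y \<in> - {0}" "F x = F y"
  then have "G x = G y" using closest_point_F by (metis ComplD singletonI)
  then show "x = y" using \<open>F x = F y\<close> by (simp add: F_def)
qed

definition sector :: "real \<Rightarrow> (real^'n) set \<Rightarrow> (real^'n) set" where
  "sector \<rho> \<omega> = {x. x \<noteq> 0 \<and> norm x \<le> \<rho> \<and> sgn x \<in> \<omega>}"

lemma local_parallel_set_eq: "local_parallel_set K \<rho> \<omega> = F ` sector \<rho> \<omega>"
proof (intro set_eqI iffI)
  fix z assume "z \<in> local_parallel_set K \<rho> \<omega>"
  then have z: "0 < infdist z K" "infdist z K \<le> \<rho>" "sgn (z - closest_point K z) \<in> \<omega>"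
    by (auto simp: local_parallel_set_def)
  then have "z \<notin> K" by auto
  from F_surj[OF this] z show "z \<in> F ` sector \<rho> \<omega>"
    by (intro image_eqI[of _ _ "z - closest_point K z"]) (auto simp: sector_def infdist_closest)
next
  fix z assume "z \<in> F ` sector \<rho> \<omega>"
  then obtain x where x: "z = F x" "x \<noteq> 0" "norm x \<le> \<rho>" "sgn x \<in> \<omega>" by (auto simp: sector_def)
  have eq: "z - closest_point K z = x" unfolding x(1) closest_point_F[OF x(2)] by (simp add: F_def)
  then have "infdist z K = norm x" by (simp add: infdist_closest)
  then show "z \<in> local_parallel_set K \<rho> \<omega>"
    using x unfolding local_parallel_set_def mem_Collect_eq eq by simp
qed

text \<open>The Hessian of the support function \<open>\<lambda>x. norm x * (1 - \<Phi> x)\<close> at a unit vector.\<close>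

definition A :: "real^'n \<Rightarrow> real^'n^'n" where
  "A u = tangent_proj u + - (S2 u + \<Phi> u *\<^sub>R tangent_proj u)"

text \<open>G has degree 0, so its derivative at x is the one at \<open>sgn x\<close> divided by
  |x|. The computation multiplies by |x|, which moves \<Phi>, g and H to the unit vector according
  to their degrees.\<close>

lemma D_G:
  assumes x: "x \<noteq> 0"
  shows "(G has_derivative (\<lambda>v. ((1 / norm x) *\<^sub>R A (sgn x)) *v v)) (at x)"
proof -
  let ?r = "norm x" and ?u = "sgn x"
  have r: "?r > 0" using x by simp
  have u: "norm ?u = 1" using x by (simp add: norm_sgn)
  have xu: "x = ?r *\<^sub>R ?u" using x by (simp add: sgn_div_norm)
  have u0: "?u \<noteq> 0" using x by (simp add: sgn_zero_iff)
  have \<Phi>x: "\<Phi> x = \<Phi> ?u" using hom[OF r, of ?u] by (simp flip: xu)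
  have gx: "?r *\<^sub>R g x = g ?u" using g_hom[OF r u0] by (simp flip: xu)
  have Hx: "(?r * ?r) *\<^sub>R H x = H ?u" using H_hom[OF r u0] by (simp flip: xu)
  have dn: "((\<lambda>x. norm x) has_derivative (\<lambda>v. ?u \<bullet> v)) (at x)"
    using has_derivative_norm[OF x] by (simp add: inner_commute)
  have "(G has_derivative (\<lambda>v. ((1 - \<Phi> x) * inverse ?r) *\<^sub>R v +
      ((1 - \<Phi> x) * (- (inverse ?r * (?u \<bullet> v) * inverse ?r)) + (0 - g x \<bullet> v) * inverse ?r) *\<^sub>R x -
      (?r *\<^sub>R (H x *v v) + (?u \<bullet> v) *\<^sub>R g x))) (at x)"
  proof -
    have "norm x \<noteq> 0" using x by simp
    note inv = Deriv.has_derivative_inverse[OF this dn]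
    note c = has_derivative_mult[OF has_derivative_diff[OF has_derivative_const[of 1] D_\<Phi>[OF x]] inv]
    show ?thesis
      unfolding G_def[abs_def]
      by (rule has_derivative_diff[OF has_derivative_scaleR[OF c has_derivative_ident]
            has_derivative_scaleR[OF dn D_g[OF x]]])
  qed
  then show ?thesis
  proof (rule has_derivative_eq_rhs, intro ext)
    fix v
    have lhs: "?r *\<^sub>R (((1 - \<Phi> x) * inverse ?r) *\<^sub>R v +
      ((1 - \<Phi> x) * (- (inverse ?r * (?u \<bullet> v) * inverse ?r)) + (0 - g x \<bullet> v) * inverse ?r) *\<^sub>R x -
      (?r *\<^sub>R (H x *v v) + (?u \<bullet> v) *\<^sub>R g x)) =
      (1 - \<Phi> ?u) *\<^sub>R v - ((1 - \<Phi> ?u) * (?u \<bullet> v)) *\<^sub>R ?u - (g ?u \<bullet> v) *\<^sub>R ?u - H ?u *v v - (?u \<bullet> v) *\<^sub>R g ?u"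
      (is "?r *\<^sub>R (?a *\<^sub>R v + ?b *\<^sub>R x - (?r *\<^sub>R ?Hv + ?c *\<^sub>R g x)) = _")
    proof -
      have "?r * ?b * ?r = - (1 - \<Phi> x) * ?c - (?r *\<^sub>R g x) \<bullet> v"
        using r by (simp add: field_simps)
      then have 1: "?r *\<^sub>R (?b *\<^sub>R x) = (- (1 - \<Phi> ?u) * ?c - g ?u \<bullet> v) *\<^sub>R ?u"
        unfolding gx \<Phi>x by (subst (2) xu) (simp add: mult.assoc)
      have 2: "?r *\<^sub>R (?a *\<^sub>R v) = (1 - \<Phi> ?u) *\<^sub>R v" using r by (simp add: \<Phi>x)
      have 3: "?r *\<^sub>R (?r *\<^sub>R ?Hv) = H ?u *v v"
        unfolding Hx[symmetric] by (simp add: scaleR_matrix_vector_assoc[symmetric])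
      have 4: "?r *\<^sub>R (?c *\<^sub>R g x) = ?c *\<^sub>R g ?u"
        unfolding gx[symmetric] by (simp add: mult.commute)
      show ?thesis
        unfolding scaleR_diff_right scaleR_add_right 1 2 3 4 by (simp add: algebra_simps)
    qed
    have rhs: "A ?u *v v = (1 - \<Phi> ?u) *\<^sub>R v - ((1 - \<Phi> ?u) * (?u \<bullet> v)) *\<^sub>R ?u - (g ?u \<bullet> v) *\<^sub>R ?u - H ?u *v v - (?u \<bullet> v) *\<^sub>R g ?u"
    proof -
      have neg: "(- M) *v v = - (M *v v)" for M :: "real^'n^'n"
        by (simp add: vec_eq_iff matrix_vector_mult_def sum_negf)
      show ?thesis
        unfolding A_def S2_eq[OF u] tangent_proj_eq
        by (simp add: neg matrix_vector_mult_add_rdistrib matrix_vector_mult_diff_rdistrib outer_mult_vec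
          scaleR_matrix_vector_assoc[symmetric])
           (simp add: vec_eq_iff algebra_simps)
    qed
    let ?W = "((1 - \<Phi> x) * inverse ?r) *\<^sub>R v +
      ((1 - \<Phi> x) * (- (inverse ?r * (?u \<bullet> v) * inverse ?r)) + (0 - g x \<bullet> v) * inverse ?r) *\<^sub>R x -
      (?r *\<^sub>R (H x *v v) + (?u \<bullet> v) *\<^sub>R g x)"
    have "1 / ?r * ?r = 1" using r by simp
    then have "?W = (1 / ?r) *\<^sub>R (?r *\<^sub>R ?W)" by (simp only: scaleR_scaleR scaleR_one)
    also have "\<dots> = ((1 / ?r) *\<^sub>R A ?u) *v v"
      unfolding lhs rhs[symmetric] by (simp add: scaleR_matrix_vector_assoc)
    finally show "?W = ((1 / ?r) *\<^sub>R A ?u) *v v" .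
  qed
qed

lemma D_F:
  assumes "x \<noteq> 0"
  shows "(F has_derivative (\<lambda>v. (mat 1 + (1 / norm x) *\<^sub>R A (sgn x)) *v v)) (at x)"
proof -
  have "(F has_derivative (\<lambda>v. ((1 / norm x) *\<^sub>R A (sgn x)) *v v + v)) (at x)"
    unfolding F_def[abs_def] by (intro has_derivative_add D_G[OF assms] has_derivative_ident)
  then show ?thesis
    by (rule has_derivative_eq_rhs) (simp add: fun_eq_iff matrix_vector_mult_add_rdistrib add.commute)
qed

text \<open>A unit vector is annihilated by the matrix belonging to it. Hence det (A u) = 0, and the
  term of order n drops out of the expansion of the Jacobian.\<close>

lemma A_left: "norm u = 1 \<Longrightarrow> u v* A u = 0"
proof -
  assume u: "norm u = 1"
  have "u v* A u = (1 - \<Phi> u) *\<^sub>R (u v* tangent_proj u) - u v* S2 u"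
    by (simp add: A_def vec_eq_iff vector_matrix_mult_def sum.distrib sum_subtractf sum_distrib_left algebra_simps)
  then show ?thesis using left_tangent_proj[OF u] S2_left[OF u] by simp
qed

lemma continuous_A: "continuous_on (- {0}) (\<lambda>x. A (sgn x))"
proof -
  have sgn: "continuous_on (- {0}) (sgn :: real^'n \<Rightarrow> _)"
    unfolding sgn_div_norm[abs_def] by (intro continuous_intros) auto
  have mult: "continuous_on X (\<lambda>x. f x ** f' x)" if "continuous_on X f" "continuous_on X f'"
    for X :: "(real^'n) set" and f f' :: "real^'n \<Rightarrow> real^'n^'n"
    unfolding matrix_matrix_mult_def by (intro continuous_intros that)
  have sgn0: "sgn ` (- {0}) \<subseteq> - {0 :: real^'n}" by (auto simp: sgn_zero_iff)
  have P: "continuous_on (- {0}) (\<lambda>x. tangent_proj (sgn x :: real^'n))"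
    unfolding tangent_proj_eq by (intro continuous_intros sgn)
  show ?thesis
    unfolding A_def S2_def
    by (intro continuous_intros mult P continuous_on_compose2[OF cont_H sgn sgn0]
        continuous_on_compose2[OF cont_\<Phi> sgn sgn0])
qed

end

section \<open>Cone measures and the local Steiner formula\<close>

definition sph :: "(real^'n) measure" where
  "sph = restrict_space borel (sphere 0 1)"

text \<open>Agrees with \<open>sgn\<close> off the origin, but takes all its values in the sphere.\<close>

definition dir :: "real^'n \<Rightarrow> real^'n" where
  "dir x = (if x = 0 then axis undefined 1 else sgn x)"

text \<open>A multiple of the spherical Lebesgue measure. The weight \<open>norm x ^ - j\<close> is the one carried by
  the \<open>j\<close>-th term of \<open>det (mat 1 + A (sgn x) /\<^sub>R norm x)\<close>, so that the Jacobian of \<open>F\<close> can be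
  integrated without polar coordinates.\<close>

definition cone_measure :: "nat \<Rightarrow> (real^'n) measure" where
  "cone_measure j = distr (density lborel (\<lambda>x. ennreal (real CARD('n) / real (CARD('n) choose j) *
     (indicator (cball 0 1) x * inverse (norm x ^ j))))) sph dir"

lemma norm_dir [simp]: "norm (dir x) = 1"
  by (simp add: dir_def norm_sgn norm_axis_1)

lemma continuous_sgn_vec: "continuous_on (- {0}) (sgn :: real^'n \<Rightarrow> _)"
  unfolding sgn_div_norm[abs_def] by (intro continuous_intros) auto

lemma dir_measurable [measurable]: "dir \<in> borel \<rightarrow>\<^sub>M sph"
  unfolding sph_def
proof (rule measurable_restrict_space2)
  have "continuous_on (- {0}) (dir :: real^'n \<Rightarrow> _)"
    using continuous_sgn_vec by (rule continuous_on_cong[THEN iffD1, rotated 2]) (auto simp: dir_def)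
  then show "dir \<in> borel_measurable borel"
    by (rule borel_measurable_continuous_countable_exceptions[rotated]) simp
qed auto

lemma sets_cone [simp, measurable_cong]: "sets (cone_measure j) = sets sph"
  by (simp add: cone_measure_def)

lemma nn_integral_cone:
  fixes f :: "real^'n \<Rightarrow> ennreal"
  assumes [measurable]: "f \<in> borel_measurable sph"
  shows "(\<integral>\<^sup>+u. f u \<partial>cone_measure j) = (\<integral>\<^sup>+x. ennreal (real CARD('n) / real (CARD('n) choose j) *
     (indicator (cball 0 1) x * inverse (norm x ^ j))) * f (dir x) \<partial>lborel)"
proof -
  have [measurable]: "(\<lambda>x. f (dir x)) \<in> borel_measurable borel"
    by (rule measurable_compose[OF dir_measurable assms])
  have [measurable]: "cball (0 :: real^'n) 1 \<in> sets borel" by simp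
  have "(\<integral>\<^sup>+u. f u \<partial>cone_measure j) = (\<integral>\<^sup>+x. f (dir x) \<partial>density lborel (\<lambda>x. ennreal (real CARD('n) /
      real (CARD('n) choose j) * (indicator (cball 0 1) x * inverse (norm x ^ j)))))"
    unfolding cone_measure_def by (rule nn_integral_distr) measurable
  also have "\<dots> = (\<integral>\<^sup>+x. ennreal (real CARD('n) / real (CARD('n) choose j) *
     (indicator (cball 0 1) x * inverse (norm x ^ j))) * f (dir x) \<partial>lborel)"
    by (rule nn_integral_density) measurable
  finally show ?thesis .
qed

lemma nn_integral_scale:
  fixes f :: "'a::euclidean_space \<Rightarrow> ennreal"
  assumes [measurable]: "f \<in> borel_measurable borel" and c: "c > 0"
  shows "(\<integral>\<^sup>+x. f x \<partial>lborel) = ennreal (c ^ DIM('a)) * (\<integral>\<^sup>+x. f (c *\<^sub>R x) \<partial>lborel)"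
proof -
  have "(\<integral>\<^sup>+x. f x \<partial>lborel) =
      (\<integral>\<^sup>+x. f x \<partial>density (distr lborel borel (\<lambda>x. 0 + c *\<^sub>R x)) (\<lambda>_. ennreal (\<bar>c\<bar> ^ DIM('a))))"
    using c by (subst lborel_affine[of c 0]) auto
  also have "\<dots> = ennreal (c ^ DIM('a)) * (\<integral>\<^sup>+x. f (c *\<^sub>R x) \<partial>lborel)"
    using c by (subst nn_integral_density) (auto simp: nn_integral_distr nn_integral_cmult)
  finally show ?thesis .
qed

text \<open>Divided by \<rho>^n, the Steiner sum is a polynomial in 1 / \<rho>, so its coefficients
  are determined. This uniqueness gives the definite description in \<open>area_measure\<close> its
  value.\<close>

lemma steiner_family_unique:
  fixes K :: "(real^'n) set"
  assumes S: "steiner_family K S" and S': "steiner_family K S'" and j: "j < CARD('n)"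
  shows "S j = S' j"
proof (rule measure_eqI)
  note d = S[unfolded steiner_family_def] S'[unfolded steiner_family_def]
  have sets: "sets (S i) = sets (restrict_space borel (sphere 0 1))" "sets (S' i) = sets (restrict_space borel (sphere 0 1))"
    and fin: "finite_measure (S i)" "finite_measure (S' i)" if "i < CARD('n)" for i
    using d that by auto
  show "sets (S j) = sets (S' j)" using sets[OF j] by simp
  fix \<omega> assume "\<omega> \<in> sets (S j)"
  then have \<omega>: "\<omega> \<in> sets (restrict_space borel (sphere 0 1))" using sets[OF j] by simp
  define N where "N = CARD('n) - 1"
  have N: "CARD('n) = Suc N" by (simp add: N_def)
  define c where "c i = real (CARD('n) choose i) * (measure (S i) \<omega> - measure (S' i) \<omega>)" for i
  have "(\<Sum>i\<le>N. c i * t ^ i) = 0" if t: "t > 0" for t :: real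
  proof -
    define \<rho> where "\<rho> = 1 / t"
    have \<rho>: "\<rho> > 0" using t by (simp add: \<rho>_def)
    have "(\<Sum>i<CARD('n). real (CARD('n) choose i) * \<rho> ^ (CARD('n) - i) * measure (S i) \<omega>) =
        (\<Sum>i<CARD('n). real (CARD('n) choose i) * \<rho> ^ (CARD('n) - i) * measure (S' i) \<omega>)"
      using d(1)[THEN conjunct2, rule_format, OF \<rho> \<omega>] d(2)[THEN conjunct2, rule_format, OF \<rho> \<omega>] by simp
    then have "0 = (\<Sum>i<CARD('n). c i * \<rho> ^ (CARD('n) - i))"
      by (simp add: c_def right_diff_distrib left_diff_distrib sum_subtractf mult_ac)
    also have "\<dots> = (\<Sum>i<CARD('n). \<rho> ^ CARD('n) * (c i * t ^ i))"
    proof (rule sum.cong)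
      fix i assume "i \<in> {..<CARD('n)}"
      then have "\<rho> ^ CARD('n) = \<rho> ^ (CARD('n) - i) * \<rho> ^ i" by (simp flip: power_add)
      moreover have "\<rho> ^ i * t ^ i = 1" using t by (simp add: \<rho>_def flip: power_mult_distrib)
      ultimately have "\<rho> ^ CARD('n) * t ^ i = \<rho> ^ (CARD('n) - i)" by (simp add: mult.assoc)
      then show "c i * \<rho> ^ (CARD('n) - i) = \<rho> ^ CARD('n) * (c i * t ^ i)" by (simp add: mult.left_commute)
    qed simp
    also have "\<dots> = \<rho> ^ CARD('n) * (\<Sum>i\<le>N. c i * t ^ i)"
      by (simp add: sum_distrib_left N lessThan_Suc_atMost)
    finally show ?thesis using \<rho> by simp
  qed
  from polyfun_zero_on_pos[OF this, of j] j have "c j = 0" by (simp add: N)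
  then have "measure (S j) \<omega> = measure (S' j) \<omega>" using j by (simp add: c_def)
  then show "emeasure (S j) \<omega> = emeasure (S' j) \<omega>"
    using fin[OF j] by (simp add: finite_measure.emeasure_eq_measure)
qed

text \<open>Nonnegativity serves twice: \<open>ennreal\<close> cuts negative values to 0, so
  \<open>area\<close> has the intended density only under it, and it makes the Jacobian of F equal
  to its absolute value.\<close>

locale nice_support = smooth_support \<Phi> g H K
  for \<Phi> :: "real^'n \<Rightarrow> real" and g :: "real^'n \<Rightarrow> real^'n" and H :: "real^'n \<Rightarrow> real^'n^'n" and K +
  assumes esym_nonneg: "\<And>j u. j < CARD('n) \<Longrightarrow> norm u = 1 \<Longrightarrow> 0 \<le> esym j (A u)"
begin

definition area :: "nat \<Rightarrow> (real^'n) measure" where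
  "area j = density (cone_measure j) (\<lambda>u. ennreal (esym j (A u)))"

lemma esym_A_measurable [measurable]: "(\<lambda>u. esym j (A u)) \<in> borel_measurable sph"
  unfolding sph_def
proof (rule borel_measurable_continuous_on_restrict)
  have "continuous_on (sphere 0 1) (\<lambda>x. esym j (A (sgn x)))"
    by (intro continuous_esym continuous_on_subset[OF continuous_A]) auto
  then show "continuous_on (sphere 0 1) (\<lambda>u. esym j (A u))"
    by (rule continuous_on_cong[THEN iffD1, rotated 2]) (auto simp: sgn_div_norm)
qed

lemma sets_area: "sets (area j) = sets sph"
  by (simp add: area_def)

text \<open>The j-th term of the Jacobian of F, restricted to radii up to \<rho> and directions in
  \<omega>.\<close>

definition weight :: "real \<Rightarrow> (real^'n) set \<Rightarrow> nat \<Rightarrow> real^'n \<Rightarrow> real" where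
  "weight \<rho> \<omega> j x = indicator (cball 0 \<rho>) x * indicator \<omega> (dir x) * (inverse (norm x ^ j) * esym j (A (dir x)))"

lemma weight_measurable:
  assumes "\<omega> \<in> sets sph"
  shows "weight \<rho> \<omega> j \<in> borel_measurable borel"
proof -
  have [measurable]: "(\<lambda>x. indicator \<omega> (dir x) :: real) \<in> borel_measurable borel"
    using assms by (intro measurable_compose[OF dir_measurable]) simp
  have [measurable]: "cball (0 :: real^'n) \<rho> \<in> sets borel" by simp
  show ?thesis unfolding weight_def[abs_def] by measurable
qed

lemma weight_nonneg: "j < CARD('n) \<Longrightarrow> 0 \<le> weight \<rho> \<omega> j x"
  unfolding weight_def by (intro mult_nonneg_nonneg esym_nonneg) auto

lemma emeasure_area:
  assumes j: "j < CARD('n)" and \<omega>: "\<omega> \<in> sets sph"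
  shows "emeasure (area j) \<omega> = ennreal (real CARD('n) / real (CARD('n) choose j)) * (\<integral>\<^sup>+x. ennreal (weight 1 \<omega> j x) \<partial>lborel)"
proof -
  have "emeasure (area j) \<omega> = (\<integral>\<^sup>+u. ennreal (esym j (A u)) * indicator \<omega> u \<partial>cone_measure j)"
    unfolding area_def using \<omega> by (intro emeasure_density) auto
  also have "\<dots> = (\<integral>\<^sup>+x. ennreal (real CARD('n) / real (CARD('n) choose j) *
     (indicator (cball 0 1) x * inverse (norm x ^ j))) * (ennreal (esym j (A (dir x))) * indicator \<omega> (dir x)) \<partial>lborel)"
    using \<omega> by (intro nn_integral_cone) simp
  also have "\<dots> = (\<integral>\<^sup>+x. ennreal (real CARD('n) / real (CARD('n) choose j)) * ennreal (weight 1 \<omega> j x) \<partial>lborel)"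
  proof (rule nn_integral_cong)
    fix x :: "real^'n"
    have e: "0 \<le> esym j (A (dir x))" using esym_nonneg[OF j] by simp
    show "ennreal (real CARD('n) / real (CARD('n) choose j) * (indicator (cball 0 1) x * inverse (norm x ^ j))) *
        (ennreal (esym j (A (dir x))) * indicator \<omega> (dir x)) =
        ennreal (real CARD('n) / real (CARD('n) choose j)) * ennreal (weight 1 \<omega> j x)"
      using e by (simp add: weight_def indicator_def mult_ac flip: ennreal_mult)
  qed
  also have "\<dots> = ennreal (real CARD('n) / real (CARD('n) choose j)) * (\<integral>\<^sup>+x. ennreal (weight 1 \<omega> j x) \<partial>lborel)"
    using weight_measurable[OF \<omega>] by (intro nn_integral_cmult) measurable
  finally show ?thesis .
qed

text \<open>Substituting \<rho> x gives \<rho>^n from the volume and \<rho>^(-j) from the weight;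
  this is the origin of the powers in the Steiner formula.\<close>

lemma nn_integral_weight_scale:
  assumes \<rho>: "\<rho> > 0" and \<omega>: "\<omega> \<in> sets sph" and j: "j < CARD('n)"
  shows "(\<integral>\<^sup>+x. ennreal (weight \<rho> \<omega> j x) \<partial>lborel) = ennreal (\<rho> ^ (CARD('n) - j)) * (\<integral>\<^sup>+x. ennreal (weight 1 \<omega> j x) \<partial>lborel)"
proof -
  note [measurable] = weight_measurable[OF \<omega>]
  have dir: "dir (\<rho> *\<^sub>R x) = dir x" for x :: "real^'n"
    using \<rho> by (simp add: dir_def sgn_scaleR)
  have w: "weight \<rho> \<omega> j (\<rho> *\<^sub>R x) = inverse (\<rho> ^ j) * weight 1 \<omega> j x" for x
    using \<rho> by (simp add: weight_def dir indicator_def power_mult_distrib)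
  have "(\<integral>\<^sup>+x. ennreal (weight \<rho> \<omega> j x) \<partial>lborel) =
      ennreal (\<rho> ^ CARD('n)) * (\<integral>\<^sup>+x. ennreal (inverse (\<rho> ^ j) * weight 1 \<omega> j x) \<partial>lborel)"
    using nn_integral_scale[of "\<lambda>x. ennreal (weight \<rho> \<omega> j x)" \<rho>] \<rho> by (simp add: w)
  also have "(\<integral>\<^sup>+x. ennreal (inverse (\<rho> ^ j) * weight 1 \<omega> j x) \<partial>lborel) =
      ennreal (inverse (\<rho> ^ j)) * (\<integral>\<^sup>+x. ennreal (weight 1 \<omega> j x) \<partial>lborel)"
    using \<rho> weight_nonneg[OF j] by (subst nn_integral_cmult[symmetric]) (auto simp: ennreal_mult)
  also have "ennreal (\<rho> ^ CARD('n)) * (ennreal (inverse (\<rho> ^ j)) * (\<integral>\<^sup>+x. ennreal (weight 1 \<omega> j x) \<partial>lborel)) =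
      ennreal (\<rho> ^ CARD('n) * inverse (\<rho> ^ j)) * (\<integral>\<^sup>+x. ennreal (weight 1 \<omega> j x) \<partial>lborel)"
    using \<rho> by (simp add: ennreal_mult mult.assoc)
  also have "\<rho> ^ CARD('n) * inverse (\<rho> ^ j) = \<rho> ^ (CARD('n) - j)"
    using \<rho> j by (simp add: power_diff divide_inverse)
  finally show ?thesis .
qed

text \<open>At positive distance from K the maps \<open>sgn\<close> and \<open>dir\<close> agree on
  x - \<open>closest_point K x\<close>, and \<open>dir\<close> is measurable into the sphere, so
  membership in \<omega> becomes a measurable preimage.\<close>

lemma local_parallel_set_borel:
  assumes \<omega>: "\<omega> \<in> sets sph"
  shows "local_parallel_set K \<rho> \<omega> \<in> sets borel"
proof -
  have [measurable]: "closest_point K \<in> borel_measurable borel"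
    by (intro borel_measurable_continuous_onI continuous_on_closest_point K)
  have [measurable]: "(\<lambda>x. infdist x K) \<in> borel_measurable borel"
    by (intro borel_measurable_continuous_onI continuous_intros)
  have m: "(\<lambda>x. dir (x - closest_point K x)) \<in> borel \<rightarrow>\<^sub>M sph"
    by measurable
  have "local_parallel_set K \<rho> \<omega> = {x \<in> space borel. 0 < infdist x K \<and> infdist x K \<le> \<rho>} \<inter>
      ((\<lambda>x. dir (x - closest_point K x)) -` \<omega> \<inter> space borel)"
    by (auto simp: local_parallel_set_def dir_def infdist_closest)
  also have "\<dots> \<in> sets borel"
    using measurable_sets[OF m \<omega>] by measurable
  finally show ?thesis .
qed

lemma sector_borel:
  assumes \<omega>: "\<omega> \<in> sets sph"
  shows "sector \<rho> \<omega> \<in> sets borel"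
proof -
  have "sector \<rho> \<omega> = {x \<in> space borel. x \<noteq> 0 \<and> norm x \<le> \<rho>} \<inter> (dir -` \<omega> \<inter> space borel)"
    by (auto simp: sector_def dir_def)
  also have "\<dots> \<in> sets borel" using measurable_sets[OF dir_measurable \<omega>] by measurable
  finally show ?thesis .
qed

lemma emeasure_local_parallel_set_finite:
  assumes "\<omega> \<in> sets sph"
  shows "emeasure lborel (local_parallel_set K \<rho> \<omega>) < \<infinity>"
proof -
  obtain B where B: "\<And>y. y \<in> K \<Longrightarrow> norm y \<le> B"
    using compact_imp_bounded[OF K(2)] unfolding bounded_iff by blast
  have "local_parallel_set K \<rho> \<omega> \<subseteq> cball 0 (B + \<rho>)"
  proof
    fix z assume "z \<in> local_parallel_set K \<rho> \<omega>"
    then obtain x where "x \<noteq> 0" "norm x \<le> \<rho>" "z = F x" unfolding local_parallel_set_eq sector_def by auto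
    then show "z \<in> cball 0 (B + \<rho>)"
      using norm_triangle_ineq[of "G x" x] B[OF G_in[of x]] by (simp add: F_def)
  qed
  then have "emeasure lborel (local_parallel_set K \<rho> \<omega>) \<le> emeasure lborel (cball (0 :: real^'n) (B + \<rho>))"
    by (intro emeasure_mono) auto
  also have "\<dots> < \<infinity>" by (rule emeasure_lborel_cball_finite)
  finally show ?thesis .
qed

text \<open>The change of variables by F turns the volume into the integral of the Jacobian over a
  sector. The determinant expansion splits it into the weights of orders below n, order n being
  absent as A u is singular, and scaling relates each to its value at radius 1, the area
  measure.\<close>

lemma emeasure_local_parallel_set:
  assumes \<rho>: "\<rho> > 0" and \<omega>: "\<omega> \<in> sets sph"
  shows "emeasure lborel (local_parallel_set K \<rho> \<omega>) =
    (\<Sum>j<CARD('n). ennreal (real (CARD('n) choose j) * \<rho> ^ (CARD('n) - j) / real CARD('n)) * emeasure (area j) \<omega>)"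
proof -
  define J where "J x = (\<Sum>j<CARD('n). inverse (norm x ^ j) * esym j (A (dir x)))" for x
  have J_nonneg: "0 \<le> J x" for x
    unfolding J_def by (intro sum_nonneg mult_nonneg_nonneg esym_nonneg) auto
  have det: "det (mat 1 + (1 / norm x) *\<^sub>R A (sgn x)) = J x" if x: "x \<noteq> 0" for x
  proof -
    obtain N where N: "CARD('n) = Suc N" by (metis Suc_pred zero_less_card_finite)
    have u: "norm (sgn x) = 1" using x by (simp add: norm_sgn)
    have "det (A (sgn x)) = 0"
      using det_eq_0_if_left_kernel[OF A_left[OF u]] x by (simp add: sgn_zero_iff)
    then have "esym CARD('n) (A (sgn x)) = 0" by (simp add: esym_card)
    then show ?thesis
      using x unfolding det_one_plus_scaleR J_def N
      by (simp add: dir_def lessThan_Suc_atMost power_inverse divide_inverse mult.commute)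
  qed
  have "emeasure lborel (F ` sector \<rho> \<omega>) = (\<integral>\<^sup>+x. ennreal (indicator (sector \<rho> \<omega>) x * J x) \<partial>lborel)"
  proof (rule emeasure_differentiable_image)
    show "F ` sector \<rho> \<omega> \<in> sets borel" "emeasure lborel (F ` sector \<rho> \<omega>) < \<infinity>"
      using local_parallel_set_borel[OF \<omega>] emeasure_local_parallel_set_finite[OF \<omega>]
      by (simp_all add: local_parallel_set_eq)
    show "(F has_derivative (\<lambda>h. (mat 1 + (1 / norm x) *\<^sub>R A (sgn x)) *v h)) (at x)"
      if "x \<in> sector \<rho> \<omega>" for x
      using that by (intro D_F) (auto simp: sector_def)
    show "inj_on F (sector \<rho> \<omega>)" by (rule inj_on_subset[OF inj_F]) (auto simp: sector_def)
    show "J x = \<bar>det (mat 1 + (1 / norm x) *\<^sub>R A (sgn x))\<bar>" if "x \<in> sector \<rho> \<omega>" for x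
      using that det[of x] J_nonneg[of x] by (auto simp: sector_def)
    show "J \<in> borel_measurable borel" unfolding J_def[abs_def] by measurable
  qed (auto simp: sector_borel[OF \<omega>] J_nonneg)
  also have "\<dots> = (\<integral>\<^sup>+x. (\<Sum>j<CARD('n). ennreal (weight \<rho> \<omega> j x)) \<partial>lborel)"
  proof (rule nn_integral_cong_AE)
    show "AE x in lborel. ennreal (indicator (sector \<rho> \<omega>) x * J x) = (\<Sum>j<CARD('n). ennreal (weight \<rho> \<omega> j x))"
      using AE_lborel_nonzero
    proof eventually_elim
      fix x :: "real^'n" assume x: "x \<noteq> 0"
      have "indicator (sector \<rho> \<omega>) x * J x = (\<Sum>j<CARD('n). weight \<rho> \<omega> j x)"
        using x by (auto simp: J_def weight_def sector_def dir_def indicator_def)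
      then show "ennreal (indicator (sector \<rho> \<omega>) x * J x) = (\<Sum>j<CARD('n). ennreal (weight \<rho> \<omega> j x))"
        by (subst sum_ennreal) (auto intro: weight_nonneg)
    qed
  qed
  also have "\<dots> = (\<Sum>j<CARD('n). \<integral>\<^sup>+x. ennreal (weight \<rho> \<omega> j x) \<partial>lborel)"
    using weight_measurable[OF \<omega>] by (intro nn_integral_sum) measurable
  also have "\<dots> = (\<Sum>j<CARD('n). ennreal (real (CARD('n) choose j) * \<rho> ^ (CARD('n) - j) / real CARD('n)) * emeasure (area j) \<omega>)"
  proof (rule sum.cong)
    fix j assume "j \<in> {..<CARD('n)}"
    then have j: "j < CARD('n)" by simp
    then have c: "0 < real (CARD('n) choose j)" by (simp add: zero_less_binomial)
    have "ennreal (real (CARD('n) choose j) * \<rho> ^ (CARD('n) - j) / real CARD('n)) * emeasure (area j) \<omega> =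
       ennreal (real (CARD('n) choose j) * \<rho> ^ (CARD('n) - j) / real CARD('n) * (real CARD('n) / real (CARD('n) choose j))) *
       (\<integral>\<^sup>+x. ennreal (weight 1 \<omega> j x) \<partial>lborel)"
      unfolding emeasure_area[OF j \<omega>] using \<rho> by (subst ennreal_mult) (simp_all only: mult.assoc, simp_all)
    also have "real (CARD('n) choose j) * \<rho> ^ (CARD('n) - j) / real CARD('n) * (real CARD('n) / real (CARD('n) choose j)) = \<rho> ^ (CARD('n) - j)"
      using c by simp
    finally show "(\<integral>\<^sup>+x. ennreal (weight \<rho> \<omega> j x) \<partial>lborel) =
        ennreal (real (CARD('n) choose j) * \<rho> ^ (CARD('n) - j) / real CARD('n)) * emeasure (area j) \<omega>"
      unfolding nn_integral_weight_scale[OF \<rho> \<omega> j] ..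
  qed simp
  finally show ?thesis unfolding local_parallel_set_eq .
qed

text \<open>Each term of the Steiner sum at radius 1 is at most the volume of a bounded set.\<close>

lemma finite_area:
  assumes j: "j < CARD('n)"
  shows "finite_measure (area j)"
proof
  have sp: "space (area j) = sphere 0 1" "space (area j) \<in> sets sph"
  proof -
    show eq: "space (area j) = sphere 0 1"
      using sets_eq_imp_space_eq[OF sets_area[of j]] by (simp add: sph_def space_restrict_space)
    show "space (area j) \<in> sets sph" using sets.top[of "area j"] by (simp add: sets_area)
  qed
  let ?c = "\<lambda>i. ennreal (real (CARD('n) choose i) * 1 ^ (CARD('n) - i) / real CARD('n))"
  have "?c j * emeasure (area j) (space (area j)) \<le> (\<Sum>i<CARD('n). ?c i * emeasure (area i) (space (area j)))"
    using j by (intro member_le_sum) auto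
  also have "\<dots> < \<infinity>"
    using emeasure_local_parallel_set[OF zero_less_one sp(2)] emeasure_local_parallel_set_finite[OF sp(2), of 1]
    by simp
  finally have "?c j * emeasure (area j) (space (area j)) \<noteq> \<infinity>" by simp
  moreover have "?c j \<noteq> 0" using j by (simp add: zero_less_binomial)
  ultimately show "emeasure (area j) (space (area j)) \<noteq> \<infinity>"
    by (metis ennreal_mult_eq_top_iff infinity_ennreal_def)
qed

theorem steiner_family_area: "steiner_family K area"
  unfolding steiner_family_def
proof (intro conjI allI impI ballI)
  fix \<rho> :: real and \<omega> :: "(real^'n) set"
  assume \<rho>: "0 < \<rho>" and "\<omega> \<in> sets (restrict_space borel (sphere 0 1))"
  then have \<omega>: "\<omega> \<in> sets sph" by (simp add: sph_def)
  let ?c = "\<lambda>j. real (CARD('n) choose j) * \<rho> ^ (CARD('n) - j) / real CARD('n)"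
  have "emeasure lborel (local_parallel_set K \<rho> \<omega>) = (\<Sum>j<CARD('n). ennreal (?c j * measure (area j) \<omega>))"
    unfolding emeasure_local_parallel_set[OF \<rho> \<omega>]
    using \<rho> finite_area by (intro sum.cong) (auto simp: finite_measure.emeasure_eq_measure simp flip: ennreal_mult)
  also have "\<dots> = ennreal (\<Sum>j<CARD('n). ?c j * measure (area j) \<omega>)"
    using \<rho> by (intro sum_ennreal) auto
  finally have "measure lborel (local_parallel_set K \<rho> \<omega>) = (\<Sum>j<CARD('n). ?c j * measure (area j) \<omega>)"
    using \<rho> by (simp add: measure_def sum_nonneg)
  then show "measure lborel (local_parallel_set K \<rho> \<omega>) =
      (\<Sum>j<CARD('n). real (CARD('n) choose j) * \<rho> ^ (CARD('n) - j) * measure (area j) \<omega>) / real CARD('n)"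
    by (simp add: sum_divide_distrib)
qed (auto simp: finite_area sets_area sph_def)

lemma area_measure_eq:
  assumes "j < CARD('n)"
  shows "area_measure j K = area j"
  unfolding area_measure_def
proof (rule the_equality)
  show "\<exists>S. steiner_family K S \<and> area j = S j" using steiner_family_area by blast
  show "\<mu> = area j" if "\<exists>S. steiner_family K S \<and> \<mu> = S j" for \<mu>
    using that steiner_family_unique[OF _ steiner_family_area assms] by blast
qed

end

section \<open>Bodies close to the ball\<close>

text \<open>One inequality is shown for every positive factor and then used for both c and 1 /
  c.\<close>

lemma support_fun_scale:
  fixes K :: "(real^'n) set"
  assumes K: "compact K" "K \<noteq> {}" and c: "c > 0"
  shows "support_fun K (c *\<^sub>R x) = c * support_fun K x"
proof -
  have le: "support_fun K (c *\<^sub>R x) \<le> c * support_fun K x" if c: "c > 0" for c x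
    unfolding support_fun_def[of K "c *\<^sub>R x"]
  proof (rule cSUP_least[OF K(2)])
    fix y assume "y \<in> K"
    from inner_le_support_fun[OF K(1) this, of x] c
    show "(c *\<^sub>R x) \<bullet> y \<le> c * support_fun K x" by simp
  qed
  have "support_fun K ((1 / c) *\<^sub>R (c *\<^sub>R x)) \<le> (1 / c) * support_fun K (c *\<^sub>R x)"
    using c by (intro le) simp
  then have "c * support_fun K x \<le> support_fun K (c *\<^sub>R x)"
    using c by (simp add: field_simps)
  with le[OF c, of x] show ?thesis by simp
qed

lemma support_fun_cball: "support_fun (cball 0 1) x = norm x" for x :: "real^'n"
proof (rule antisym)
  show "support_fun (cball 0 1) x \<le> norm x"
    unfolding support_fun_def
  proof (rule cSUP_least)
    fix y :: "real^'n" assume "y \<in> cball 0 1"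
    then have "norm x * norm y \<le> norm x" by (simp add: mult_left_le)
    then show "x \<bullet> y \<le> norm x" using norm_cauchy_schwarz[of x y] by linarith
  qed simp
  have "x \<bullet> sgn x \<le> support_fun (cball 0 1) x"
    by (rule inner_le_support_fun) (auto simp: norm_sgn)
  moreover have "x \<bullet> sgn x = norm x"
    by (cases "x = 0") (simp_all add: sgn_div_norm dot_square_norm power2_eq_square)
  ultimately show "norm x \<le> support_fun (cball 0 1) x" by simp
qed

lemma support_fun_even:
  assumes "origin_symmetric K"
  shows "support_fun K (- x) = support_fun K x"
proof -
  have "support_fun K x = support_fun (uminus ` K) x"
    using assms unfolding origin_symmetric_def by simp
  also have "\<dots> = support_fun K (- x)"
    by (simp add: support_fun_def image_image)
  finally show ?thesis ..
qed

text \<open>A finite norm excludes the branch with value \<infinity>, which is how smoothness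
  enters; each of the three suprema is at most their sum.\<close>

lemma C2_norm_sphere_bounds:
  fixes f :: "real^'n \<Rightarrow> real"
  assumes le: "C2_norm_sphere f \<le> ennreal \<eta>" and \<eta>: "0 \<le> \<eta>"
  shows "C2_sphere f"
    and "norm u = 1 \<Longrightarrow> \<bar>f u\<bar> \<le> \<eta>"
    and "norm u = 1 \<Longrightarrow> norm (sphere_gradient f u) \<le> \<eta>"
    and "norm u = 1 \<Longrightarrow> norm (sphere_hessian f u) \<le> \<eta>"
proof -
  show C2: "C2_sphere f"
    using le by (auto simp: C2_norm_sphere_def top_unique split: if_splits)
  let ?a = "SUP u\<in>sphere 0 1. ennreal \<bar>f u\<bar>"
  let ?b = "SUP u\<in>sphere 0 1. ennreal (norm (sphere_gradient f u))"
  let ?c = "SUP u\<in>sphere 0 1. ennreal (norm (sphere_hessian f u))"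
  have sum: "?a + ?b + ?c \<le> ennreal \<eta>" using le C2 by (simp add: C2_norm_sphere_def)
  have abc: "?a \<le> ennreal \<eta>" "?b \<le> ennreal \<eta>" "?c \<le> ennreal \<eta>"
    using order_trans[OF _ sum] by (metis add_increasing add_increasing2 order_refl zero_le)+
  have *: "t u \<le> \<eta>" if "(SUP u\<in>sphere 0 1. ennreal (t u)) \<le> ennreal \<eta>" "norm u = 1" for t :: "real^'n \<Rightarrow> real" and u
  proof -
    have "ennreal (t u) \<le> (SUP u\<in>sphere 0 1. ennreal (t u))" using that(2) by (intro SUP_upper) simp
    then have "ennreal (t u) \<le> ennreal \<eta>" using that(1) by (rule order_trans)
    then show ?thesis using \<eta> by (simp add: ennreal_le_iff)
  qed
  show "norm u = 1 \<Longrightarrow> \<bar>f u\<bar> \<le> \<eta>"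
    "norm u = 1 \<Longrightarrow> norm (sphere_gradient f u) \<le> \<eta>"
    "norm u = 1 \<Longrightarrow> norm (sphere_hessian f u) \<le> \<eta>"
    using *[OF abc(1)] *[OF abc(2)] *[OF abc(3)] by auto
qed

lemma zero_homogeneous_C2_sphere:
  assumes "C2_sphere f"
  shows "zero_homogeneous (\<lambda>x. f (sgn x)) (gradient (\<lambda>x. f (sgn x))) (hessian (\<lambda>x. f (sgn x)))"
proof
  note C2 = assms[unfolded C2_sphere_def C2_on_def]
  show "f (sgn (c *\<^sub>R x)) = f (sgn x)" if "c > 0" for c x
    using that by (simp add: sgn_scaleR)
  fix x :: "real^'a" assume x: "x \<noteq> 0"
  then have "GDERIV (\<lambda>x. f (sgn x)) x :> gradient (\<lambda>x. f (sgn x)) x" using C2 by auto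
  then show "((\<lambda>x. f (sgn x)) has_derivative (\<lambda>h. gradient (\<lambda>x. f (sgn x)) x \<bullet> h)) (at x)"
    unfolding gderiv_def by (simp add: inner_commute)
  have "gradient (\<lambda>x. f (sgn x)) differentiable (at x)" using C2 x by auto
  then show "(gradient (\<lambda>x. f (sgn x)) has_derivative (\<lambda>h. hessian (\<lambda>x. f (sgn x)) x *v h)) (at x)"
    unfolding hessian_def jacobian_works .
qed (use assms in \<open>auto simp: C2_sphere_def C2_on_def\<close>)

lemma esym_zero_matrix: "0 < i \<Longrightarrow> esym i (0 :: real^'n^'n) = 0"
proof -
  assume i: "0 < i"
  obtain C where "\<forall>A :: real^'n^'n. \<bar>esym i A\<bar> \<le> C * norm A ^ i"
    using esym_bound[where 'n = 'n, of i] by blast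
  then have "\<bar>esym i (0 :: real^'n^'n)\<bar> \<le> C * norm (0 :: real^'n^'n) ^ i" by blast
  then show ?thesis using zero_power[OF i, where 'a = real] by simp
qed

lemma esym_tangent_proj:
  fixes u :: "real^'n"
  assumes u: "norm u = 1" and j: "j < CARD('n)"
  shows "esym j (tangent_proj u) = real ((CARD('n) - 1) choose j)"
proof -
  have "u v* (0 :: real^'n^'n) = 0" by (simp add: vec_eq_iff vector_matrix_mult_def)
  from esym_tangent_proj_add[OF u this j]
  have "esym j (tangent_proj u) = (\<Sum>i\<le>j. real ((CARD('n) - 1 - i) choose (j - i)) * esym i (0 :: real^'n^'n))"
    by simp
  also have "\<dots> = (\<Sum>i\<le>j. if i = 0 then real ((CARD('n) - 1) choose j) else 0)"
    by (intro sum.cong) (auto simp: esym_0 esym_zero_matrix)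
  finally show ?thesis by simp
qed

text \<open>At the projection itself the value is a binomial coefficient, hence at least 1, and the
  terms with i \<ge> 1 sum to at most D |B| \<le> 1. Bounding all binomials by 2^n lets one D serve
  every j.\<close>

lemma esym_nonneg_near_tangent_proj:
  "\<exists>\<delta>>0. \<forall>u (B :: real^'n^'n) j. norm u = 1 \<longrightarrow> u v* B = 0 \<longrightarrow> norm B \<le> \<delta> \<longrightarrow> j < CARD('n) \<longrightarrow>
    0 \<le> esym j (tangent_proj u + B)"
proof -
  obtain c where c: "\<And>i. c i \<ge> 0" "\<And>i (A :: real^'n^'n). \<bar>esym i A\<bar> \<le> c i * norm A ^ i"
    using esym_bound[where 'n = 'n] by metis
  define D where "D = (\<Sum>i\<le>CARD('n). 2 ^ CARD('n) * c i)"
  have D: "D \<ge> 0" unfolding D_def using c(1) by (intro sum_nonneg) auto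
  define \<delta> where "\<delta> = 1 / (D + 1)"
  have \<delta>: "\<delta> > 0" "\<delta> \<le> 1" "D * \<delta> \<le> 1" using D by (auto simp: \<delta>_def divide_simps)
  have "0 \<le> esym j (tangent_proj u + B)"
    if u: "norm u = 1" and uB: "u v* B = 0" and B: "norm B \<le> \<delta>" and j: "j < CARD('n)" for u j and B :: "real^'n^'n"
  proof -
    let ?f = "\<lambda>i. real ((CARD('n) - 1 - i) choose (j - i)) * esym i B"
    have split: "(\<Sum>i\<le>j. ?f i) = ?f 0 + (\<Sum>i\<in>{1..j}. ?f i)"
      by (simp add: sum.atLeast_Suc_atMost atMost_atLeast0)
    have "\<bar>\<Sum>i\<in>{1..j}. ?f i\<bar> \<le> (\<Sum>i\<in>{1..j}. 2 ^ CARD('n) * c i * norm B)"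
    proof (rule order_trans[OF sum_abs sum_mono])
      fix i assume i: "i \<in> {1..j}"
      have "(CARD('n) - 1 - i) choose (j - i) \<le> 2 ^ (CARD('n) - 1 - i)" by (rule binomial_le_pow2)
      also have "\<dots> \<le> 2 ^ CARD('n)" by (intro power_increasing) auto
      finally have "(CARD('n) - 1 - i) choose (j - i) \<le> 2 ^ CARD('n)" .
      then have 1: "real ((CARD('n) - 1 - i) choose (j - i)) \<le> 2 ^ CARD('n)"
        using of_nat_mono by fastforce
      have "norm B ^ i \<le> norm B ^ 1" using i B \<delta> by (intro power_decreasing) auto
      then have "\<bar>esym i B\<bar> \<le> c i * norm B"
        using c(2)[of i B] mult_left_mono[OF _ c(1)[of i]] by (metis order_trans power_one_right)
      with 1 show "\<bar>?f i\<bar> \<le> 2 ^ CARD('n) * c i * norm B"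
        unfolding abs_mult mult.assoc by (intro mult_mono) auto
    qed
    also have "\<dots> \<le> D * norm B"
      unfolding D_def sum_distrib_right[symmetric] using c(1) j by (intro mult_right_mono sum_mono2) auto
    also have "\<dots> \<le> D * \<delta>" using B D by (intro mult_left_mono)
    finally have "\<bar>\<Sum>i\<in>{1..j}. ?f i\<bar> \<le> 1" using \<delta>(3) by simp
    moreover have "?f 0 \<ge> 1"
    proof -
      have "1 \<le> (CARD('n) - 1) choose j" using j by (simp add: Suc_le_eq)
      then have "1 \<le> real ((CARD('n) - 1) choose j)" unfolding real_of_nat_ge_one_iff .
      then show ?thesis by (simp only: esym_0 diff_zero mult_1_right)
    qed
    ultimately show ?thesis unfolding esym_tangent_proj_add[OF u uB j] split by linarith
  qed
  then show ?thesis using \<delta>(1) by blast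
qed

text \<open>The ball is the case \<Phi> = 0. Its area measures thus come from the same Steiner
  argument and with the same normalization as those of K.\<close>

interpretation unit_ball: nice_support "\<lambda>_. 0" "\<lambda>_. 0" "\<lambda>_. 0 :: real^'n^'n" "cball 0 1"
proof -
  interpret smooth_support "\<lambda>_. 0" "\<lambda>_. 0" "\<lambda>_. 0 :: real^'n^'n" "cball 0 1"
    by unfold_locales (auto simp: convex_body_def support_fun_cball intro!: continuous_intros)
  have "A u = tangent_proj u" for u
    by (simp add: A_def S2_def vec_eq_iff matrix_matrix_mult_def)
  then show "nice_support (\<lambda>_. 0) (\<lambda>_. 0) (\<lambda>_. 0 :: real^'n^'n) (cball 0 1)"
    by unfold_locales (simp add: esym_tangent_proj)
qed

lemma area_measure_cball:
  assumes j: "j < CARD('n)"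
  shows "area_measure j (cball 0 1) = density (cone_measure j) (\<lambda>u :: real^'n. ennreal (real ((CARD('n) - 1) choose j)))"
proof -
  have A_eq: "unit_ball.A = (tangent_proj :: real^'n \<Rightarrow> real^'n^'n)"
    by (rule ext) (simp add: unit_ball.A_def unit_ball.S2_def vec_eq_iff matrix_matrix_mult_def)
  then have "area_measure j (cball 0 1) = density (cone_measure j) (\<lambda>u :: real^'n. ennreal (esym j (tangent_proj u)))"
    using unit_ball.area_measure_eq[OF j] unfolding unit_ball.area_def by simp
  also have "\<dots> = density (cone_measure j) (\<lambda>u. ennreal (real ((CARD('n) - 1) choose j)))"
  proof (rule density_cong)
    have sp: "space (cone_measure j :: (real^'n) measure) = sphere 0 1"
      using sets_eq_imp_space_eq[OF sets_cone[of j]] by (simp add: sph_def space_restrict_space)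
    show "AE u in cone_measure j. ennreal (esym j (tangent_proj (u :: real^'n))) = ennreal (real ((CARD('n) - 1) choose j))"
      by (rule AE_I2) (simp add: sp esym_tangent_proj[OF _ j])
    have "(\<lambda>u :: real^'n. esym j (unit_ball.A u)) \<in> borel_measurable sph"
      by (rule unit_ball.esym_A_measurable)
    then have [measurable]: "(\<lambda>u :: real^'n. esym j (tangent_proj u)) \<in> borel_measurable sph"
      unfolding A_eq .
    show "(\<lambda>u :: real^'n. ennreal (esym j (tangent_proj u))) \<in> borel_measurable (cone_measure j)"
      by measurable
  qed simp
  finally show ?thesis .
qed

text \<open>Finiteness is inherited from the area measure of the ball, a positive constant multiple
  of the cone measure, so no integral of |x|^(-j) has to be computed. It is the condition under
  which densities are unique.\<close>

lemma finite_measure_cone: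
  assumes j: "j < CARD('n)"
  shows "finite_measure (cone_measure j :: (real^'n) measure)"
proof
  let ?C = "real ((CARD('n) - 1) choose j)"
  have C: "?C > 0" using j by (simp add: zero_less_binomial)
  interpret area: finite_measure "area_measure j (cball (0 :: real^'n) 1)"
    using unit_ball.finite_area[OF j] unit_ball.area_measure_eq[OF j] by simp
  have "emeasure (area_measure j (cball (0 :: real^'n) 1)) (space (cone_measure j)) = ennreal ?C * emeasure (cone_measure j) (space (cone_measure j :: (real^'n) measure))"
    unfolding area_measure_cball[OF j] by (rule emeasure_density_const) (rule sets.top)
  then have "ennreal ?C * emeasure (cone_measure j) (space (cone_measure j :: (real^'n) measure)) \<noteq> \<infinity>"
    using area.emeasure_finite[of "space (cone_measure j)"] unfolding infinity_ennreal_def by (elim subst)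
  then show "emeasure (cone_measure j) (space (cone_measure j :: (real^'n) measure)) \<noteq> \<infinity>"
    using C by (auto simp: ennreal_mult_eq_top_iff)
qed

context nice_support
begin

text \<open>Uniqueness of densities gives the equation almost everywhere for the cone measure.
  Pulled back along \<open>dir\<close> it holds almost everywhere in the punctured unit ball, and
  continuity of w removes the exceptional set.\<close>

lemma pointwise_equation:
  assumes j: "j < CARD('n)"
    and eq: "density (area_measure j K) (\<lambda>u. ennreal (support_fun K u powr a)) = area_measure j (cball 0 1)"
    and u: "norm u = 1"
    and pos: "\<And>x. x \<noteq> 0 \<Longrightarrow> 0 < 1 - \<Phi> x"
  shows "(1 - \<Phi> u) powr a * esym j (A u) = real ((CARD('n) - 1) choose j)"
proof -
  let ?C = "real ((CARD('n) - 1) choose j)"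
  define w where "w x = (1 - \<Phi> x) powr a * esym j (A (sgn x))" for x
  have cont_w: "continuous_on (- {0}) w"
    unfolding w_def[abs_def]
    by (intro continuous_intros continuous_esym continuous_A cont_\<Phi>) (use pos in force)
  have sp: "space (cone_measure j :: (real^'n) measure) = sphere 0 1"
    using sets_eq_imp_space_eq[OF sets_cone[of j]] by (simp add: sph_def space_restrict_space)
  have supp_meas [measurable]: "(\<lambda>u. support_fun K u) \<in> borel_measurable sph"
    unfolding sph_def
  proof (rule borel_measurable_continuous_on_restrict)
    show "continuous_on (sphere 0 1) (\<lambda>u. support_fun K u)"
      by (auto intro!: continuous_at_imp_continuous_on has_derivative_continuous[OF D_support])
  qed
  have "density (cone_measure j) (\<lambda>u. ennreal (esym j (A u)) * ennreal (support_fun K u powr a)) =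
      density (density (cone_measure j) (\<lambda>u. ennreal (esym j (A u)))) (\<lambda>u. ennreal (support_fun K u powr a))"
    by (rule density_density_eq[symmetric]) measurable
  also have "\<dots> = density (cone_measure j) (\<lambda>u. ennreal ?C)"
    using eq unfolding area_measure_eq[OF j] area_def area_measure_cball[OF j] .
  finally have dens: "density (cone_measure j) (\<lambda>u. ennreal (esym j (A u)) * ennreal (support_fun K u powr a)) =
    density (cone_measure j) (\<lambda>u. ennreal ?C)" .
  interpret cone_measure: finite_measure "cone_measure j :: (real^'n) measure" by (rule finite_measure_cone[OF j])
  have "AE u in cone_measure j. ennreal (esym j (A u)) * ennreal (support_fun K u powr a) = ennreal ?C"
    by (rule cone_measure.density_unique[OF _ _ dens]) measurable
  then have "AE x in density lborel (\<lambda>x. ennreal (real CARD('n) / real (CARD('n) choose j) *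
     (indicator (cball 0 1) x * inverse (norm x ^ j)))).
     ennreal (esym j (A (dir x))) * ennreal (support_fun K (dir x) powr a) = ennreal ?C"
    unfolding cone_measure_def by (subst (asm) AE_distr_iff) measurable
  then have "AE x in lborel. 0 < ennreal (real CARD('n) / real (CARD('n) choose j) *
     (indicator (cball 0 1) x * inverse (norm x ^ j))) \<longrightarrow>
     ennreal (esym j (A (dir x))) * ennreal (support_fun K (dir x) powr a) = ennreal ?C"
  proof (subst (asm) AE_density)
    have [measurable]: "cball (0 :: real^'n) 1 \<in> sets borel" by simp
    show "(\<lambda>x :: real^'n. ennreal (real CARD('n) / real (CARD('n) choose j) *
     (indicator (cball 0 1) x * inverse (norm x ^ j)))) \<in> borel_measurable lborel" by measurable
  qed
  then have ae: "AE x in lborel. x \<in> - {0} \<inter> ball 0 1 \<longrightarrow> w x = ?C"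
  proof eventually_elim
    fix x :: "real^'n"
    assume *: "0 < ennreal (real CARD('n) / real (CARD('n) choose j) *
     (indicator (cball 0 1) x * inverse (norm x ^ j))) \<longrightarrow>
     ennreal (esym j (A (dir x))) * ennreal (support_fun K (dir x) powr a) = ennreal ?C"
    show "x \<in> - {0} \<inter> ball 0 1 \<longrightarrow> w x = ?C"
    proof
      assume x: "x \<in> - {0} \<inter> ball 0 1"
      then have x0: "x \<noteq> 0" and x1: "x \<in> cball 0 1" by auto
      have "0 < real CARD('n) / real (CARD('n) choose j) * (indicator (cball 0 1) x * inverse (norm x ^ j))"
        using x0 x1 j by (auto simp: zero_less_binomial)
      then have "ennreal (esym j (A (dir x)) * support_fun K (dir x) powr a) = ennreal ?C"
        using * esym_nonneg[OF j norm_dir[of x]] by (simp add: ennreal_mult)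
      then have "esym j (A (dir x)) * support_fun K (dir x) powr a = ?C"
        using esym_nonneg[OF j norm_dir[of x]] by (subst (asm) ennreal_inj) auto
      moreover have "support_fun K (dir x) = 1 - \<Phi> x"
      proof -
        have "dir x \<noteq> 0" using norm_dir[of x] by (metis norm_zero zero_neq_one)
        from support[OF this] have "support_fun K (dir x) = 1 - \<Phi> (dir x)" by simp
        moreover have "\<Phi> (dir x) = \<Phi> x"
          using hom[of "inverse (norm x)" x] x0 by (simp add: dir_def sgn_div_norm)
        ultimately show ?thesis by simp
      qed
      ultimately show "w x = ?C" using x0 by (simp add: w_def dir_def mult.commute)
    qed
  qed
  have "open (- {0} \<inter> w -` (- {?C}))"
    by (rule continuous_open_preimage[OF cont_w]) auto
  then have "open (ball 0 1 \<inter> (- {0} \<inter> w -` (- {?C})))" by (rule open_Int[OF open_ball])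
  moreover have "negligible (ball 0 1 \<inter> (- {0} \<inter> w -` (- {?C})))"
  proof -
    from ae obtain S where "S \<in> null_sets lborel" and S: "{x. \<not> (x \<in> - {0} \<inter> ball 0 1 \<longrightarrow> w x = ?C)} \<subseteq> S"
      by (auto simp: eventually_ae_filter)
    then have "S \<in> null_sets lebesgue" by (intro null_sets_completionI)
    then have "negligible S" by (simp add: negligible_iff_null_sets)
    then show ?thesis by (rule negligible_subset) (use S in blast)
  qed
  ultimately have empty: "ball 0 1 \<inter> (- {0} \<inter> w -` (- {?C})) = {}"
    using open_not_negligible by blast
  have "u \<noteq> 0" using u by auto
  \<comment> \<open>The open ball omits u itself; w has degree 0, so its value at u is read off at u
    / 2.\<close>
  then have "(1 / 2) *\<^sub>R u \<in> ball 0 1 \<inter> - {0}" using u by simp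
  then have "w ((1 / 2) *\<^sub>R u) = ?C" using empty by blast
  moreover have "\<Phi> ((1 / 2) *\<^sub>R u) = \<Phi> u" by (rule hom) simp
  moreover have "sgn ((1 / 2) *\<^sub>R u) = u" using u by (simp add: sgn_scaleR sgn_div_norm)
  ultimately show ?thesis by (simp add: w_def)
qed

end

text \<open>Points z of K satisfy |z|^2 \<le> |z|. A point z of the ball outside K would be F x for
  some nonzero x, and then x . z = |x| + |x|^2 would exceed |x| |z|.\<close>

lemma (in smooth_support) eq_cball:
  assumes "\<And>x. x \<noteq> 0 \<Longrightarrow> \<Phi> x = 0"
  shows "K = cball 0 1"
proof (intro set_eqI iffI)
  have h: "support_fun K x = norm x" if "x \<noteq> 0" for x using support[OF that] assms[OF that] by simp
  fix z
  show "z \<in> cball 0 1" if "z \<in> K"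
  proof (cases "z = 0")
    case False
    then show ?thesis
      using inner_le_support[OF that, of z] h[of z] by (simp add: dot_square_norm power2_eq_square)
  qed simp
  show "z \<in> K" if z: "z \<in> cball 0 1"
  proof (rule ccontr)
    assume "z \<notin> K"
    from F_surj[OF this] obtain x where x: "x \<noteq> 0" "F x = z" by blast
    have "x \<bullet> z = norm x + norm x * norm x"
      using inner_G[OF x(1)] h[OF x(1)] unfolding x(2)[symmetric] F_def
      by (simp add: inner_add_right dot_square_norm power2_eq_square)
    moreover have "x \<bullet> z \<le> norm x * norm z" by (rule norm_cauchy_schwarz)
    moreover have "norm x * norm z \<le> norm x" using z by (simp add: mult_left_le)
    moreover have "0 < norm x * norm x" using x(1) by simp
    ultimately show False by linarith
  qed
qed

theorem theorem1p6:
  fixes p :: real and k :: nat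
  assumes "CARD('n::finite) \<ge> 2"
    and "p \<in> {0..<1}"
    and "k \<in> {2..CARD('n) - 2}"
  shows "\<exists>\<eta>>0. \<forall>K :: (real^'n) set.
    convex_body K \<and> origin_symmetric K \<and> class_C2plus K \<and>
    C2_norm_sphere (\<lambda>u. 1 - support_fun K u) \<le> ennreal \<eta> \<longrightarrow>
    (density (area_measure (k - 1) K) (\<lambda>u. ennreal (support_fun K u powr (1 - p)))
       = area_measure (k - 1) (cball 0 1) \<longrightarrow>
     K = cball 0 1)"
proof -
  \<comment> \<open>The order of the area measure; the range of k places it between 1 and n -
    1.\<close>
  define m where "m = k - 1"
  have m: "1 \<le> m" "m < CARD('n)" using assms(3) by (auto simp: m_def)
  have a: "0 < 1 - p" "1 - p \<le> 1" using assms(2) by auto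
  obtain \<eta>1 where \<eta>1: "\<eta>1 > 0" and rigid: "\<forall>\<Phi> g (H :: real^'n \<Rightarrow> real^'n^'n).
    zero_homogeneous \<Phi> g H \<longrightarrow> (\<forall>x. \<Phi> (- x) = \<Phi> x) \<longrightarrow>
    (\<forall>u. norm u = 1 \<longrightarrow> \<bar>\<Phi> u\<bar> \<le> \<eta>1 \<and> norm (g u) \<le> \<eta>1 \<and> norm (zero_homogeneous.S2 H u) \<le> \<eta>1) \<longrightarrow>
    (\<forall>u. norm u = 1 \<longrightarrow> (1 - \<Phi> u) powr (1 - p) *
       esym m (tangent_proj u + - (zero_homogeneous.S2 H u + \<Phi> u *\<^sub>R tangent_proj u)) =
       real ((CARD('n) - 1) choose m)) \<longrightarrow> (\<forall>x. x \<noteq> 0 \<longrightarrow> \<Phi> x = 0)"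
    using rigidity_esym[OF m a] by (elim exE conjE) (rule that)
  obtain \<delta> where \<delta>: "\<delta> > 0" and esym_nonneg: "\<forall>u (B :: real^'n^'n) j. norm u = 1 \<longrightarrow> u v* B = 0 \<longrightarrow>
    norm B \<le> \<delta> \<longrightarrow> j < CARD('n) \<longrightarrow> 0 \<le> esym j (tangent_proj u + B)"
    using esym_nonneg_near_tangent_proj[where 'n = 'n] by (elim exE conjE) (rule that)
  \<comment> \<open>The three bounds serve the rigidity theorem, the positivity of 1 - \<Phi>, and
    the nonnegativity of all \<open>esym j (A u)\<close>. The factor n + 2 comes from |S2| +
    |\<Phi>| |P| \<le> \<eta> + \<eta> (n + 1), with P the tangent projection.\<close>
  define \<eta> where "\<eta> = min (min \<eta>1 (1 / 2)) (\<delta> / (real CARD('n) + 2))"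
  have \<eta>: "\<eta> > 0" "\<eta> \<le> \<eta>1" "\<eta> \<le> 1 / 2"
    using \<eta>1 \<delta> unfolding \<eta>_def by (simp, linarith, linarith)
  have "\<eta> \<le> \<delta> / (real CARD('n) + 2)" by (simp add: \<eta>_def)
  then have \<eta>\<delta>: "\<eta> * (real CARD('n) + 2) \<le> \<delta>" by (simp add: pos_le_divide_eq)
  show ?thesis
  proof (intro exI[of _ \<eta>] conjI allI impI \<eta>(1))
    fix K :: "(real^'n) set"
    assume "convex_body K \<and> origin_symmetric K \<and> class_C2plus K \<and>
      C2_norm_sphere (\<lambda>u. 1 - support_fun K u) \<le> ennreal \<eta>"
    then have body: "convex_body K" and sym: "origin_symmetric K"
      and small: "C2_norm_sphere (\<lambda>u. 1 - support_fun K u) \<le> ennreal \<eta>" by auto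
    assume eq: "density (area_measure (k - 1) K) (\<lambda>u. ennreal (support_fun K u powr (1 - p))) =
      area_measure (k - 1) (cball 0 1)"
    define f where "f u = 1 - support_fun K u" for u
    define \<Phi> where "\<Phi> x = f (sgn x)" for x
    define g where "g = gradient (\<lambda>x. f (sgn x))"
    define H where "H = hessian (\<lambda>x. f (sgn x))"
    note bounds = C2_norm_sphere_bounds[OF small[folded f_def] less_imp_le[OF \<eta>(1)]]
    have K: "compact K" "K \<noteq> {}" using body by (auto simp: convex_body_def)
    have zh: "zero_homogeneous \<Phi> g H"
      using zero_homogeneous_C2_sphere[OF bounds(1)] unfolding \<Phi>_def[abs_def] g_def H_def .
    have "smooth_support \<Phi> g H K"
    proof (intro smooth_support.intro smooth_support_axioms.intro zh body)
      fix x :: "real^'n" assume x: "x \<noteq> 0"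
      have "support_fun K (norm x *\<^sub>R sgn x) = norm x * support_fun K (sgn x)"
        using x by (intro support_fun_scale K) simp
      then show "support_fun K x = norm x * (1 - \<Phi> x)"
        using x by (simp add: \<Phi>_def f_def sgn_div_norm)
    qed
    then interpret smooth_support \<Phi> g H K .
    have unit: "\<bar>\<Phi> u\<bar> \<le> \<eta>" "norm (g u) \<le> \<eta>" "norm (S2 u) \<le> \<eta>" if u: "norm u = 1" for u
    proof -
      have su: "sgn u = u" using u by (simp add: sgn_div_norm)
      show "\<bar>\<Phi> u\<bar> \<le> \<eta>" using bounds(2)[OF u] by (simp add: \<Phi>_def su)
      show "norm (g u) \<le> \<eta>" using bounds(3)[OF u] by (simp add: g_def sphere_gradient_def)
      show "norm (S2 u) \<le> \<eta>" using bounds(4)[OF u] unfolding S2_def unfolding H_def sphere_hessian_def .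
    qed
    have "nice_support \<Phi> g H K"
    proof unfold_locales
      fix j and u :: "real^'n" assume j: "j < CARD('n)" and u: "norm u = 1"
      let ?B = "- (S2 u + \<Phi> u *\<^sub>R tangent_proj u)"
      have "norm ?B \<le> norm (S2 u) + \<bar>\<Phi> u\<bar> * norm (tangent_proj u)"
        using norm_triangle_ineq[of "S2 u" "\<Phi> u *\<^sub>R tangent_proj u"] unfolding norm_minus_cancel by simp
      also have "\<dots> \<le> \<eta> + \<eta> * (real CARD('n) + 1)"
        using unit[OF u] norm_tangent_proj_le[OF u] \<eta>(1) by (intro add_mono mult_mono) auto
      also have "\<dots> \<le> \<delta>" using \<eta>\<delta> by (simp add: algebra_simps)
      finally have "norm ?B \<le> \<delta>" .
      moreover have "u v* ?B = 0"
      proof -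
        have "u v* ?B = u v* A u - u v* tangent_proj u"
          by (simp add: A_def flip: vector_matrix_mult_diff_rdistrib)
        then show ?thesis using A_left[OF u] left_tangent_proj[OF u] by simp
      qed
      ultimately show "0 \<le> esym j (A u)" unfolding A_def by (intro esym_nonneg[rule_format] u j)
    qed
    then interpret nice_support \<Phi> g H K .
    have pos: "0 < 1 - \<Phi> x" if "x \<noteq> 0" for x
    proof -
      have "\<bar>\<Phi> (sgn x)\<bar> \<le> 1 / 2" using unit(1)[of "sgn x"] that \<eta>(3) by (simp add: norm_sgn)
      moreover have "sgn (sgn x) = sgn x" using that by (simp add: sgn_div_norm norm_sgn)
      then have "\<Phi> (sgn x) = \<Phi> x" by (simp add: \<Phi>_def)
      ultimately show ?thesis by linarith
    qed
    have "\<Phi> x = 0" if x: "x \<noteq> 0" for x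
    proof (rule rigid[rule_format, OF zh _ _ _ x])
      show "\<Phi> (- x) = \<Phi> x" for x
        using support_fun_even[OF sym, of "sgn x"] by (simp add: \<Phi>_def f_def sgn_minus)
      show "\<bar>\<Phi> u\<bar> \<le> \<eta>1 \<and> norm (g u) \<le> \<eta>1 \<and> norm (S2 u) \<le> \<eta>1" if "norm u = 1" for u
        using unit[OF that] \<eta>(2) by auto
      show "(1 - \<Phi> u) powr (1 - p) * esym m (tangent_proj u + - (S2 u + \<Phi> u *\<^sub>R tangent_proj u)) =
        real ((CARD('n) - 1) choose m)" if "norm u = 1" for u
        using pointwise_equation[OF m(2) eq[folded m_def] that pos] unfolding A_def .
    qed
    then show "K = cball 0 1" by (rule eq_cball)
  qed
qed

end
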